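(* Let $(N,C,A_1,A_2,\ldots)$ be a random vector with values in $\{0,1,2,\ldots\}\times\mathbb{R}\times(0,\infty)^{\mathbb{N}}$ such that (i) $\int_{1-\varepsilon}^1 \frac{\mathrm{d}s}{s-\mathbb{E}[s^N]}=\infty$ for all sufficiently small $\varepsilon>0$; (ii) $\mathbb{P}[A_1>0,\ldots,A_m>0\mid N=m]=1$ for every $m\in\mathbb{N}$; (iii) for some $m$ with $\mathbb{P}[N=m]>0$ one has $\mathbb{P}[A_1=1,\ldots,A_m=1\mid N=m]<1$; (iv) $\mathbb{E}[N]\in(1,\infty]$. Suppose also that $\mathbb{E}[C]\ne0$, $\mathbb{E}|C|^p<\infty$ for some $p>1$, $1\in\mathrm{int}(\mathcal{D})$ and $\mu'(1)<0$. With $C_t$, $\Phi$, $\mu$, $\mathcal{D}$, $M_\infty(1)$ as defined in the context, the following hold as $t\to\infty$. (a) If $\Phi(1)>0$, then $e^{-\mu(1)t}C_t\to\frac{\mathbb{E}[C]}{\Phi(1)}M_\infty(1)$ in probability. (b) If $\Phi(1)=0$, then $\frac1t C_t\to\mathbb{E}[C]\,M_\infty(1)$ in probability. (c) If $\Phi(1)<0$, then $C_t\to C_\infty:=\sum_{x\in\mathcal{T}_\infty}e^{V(x)}C(x)$ in probability, where $C_\infty$ is a.s. finite and satisfies the equality in distribution $$C_\infty\overset{d}{=}\sum_{k=1}^N A_kC_{k,\infty}+C,$$ with $(C_{k,\infty})_{k\in\mathbb{N}}$ independent copies of $C_\infty$ that are also independent of $(C,N,A_1,A_2,\ldots)$.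
   Context: Notation: $\Phi(s)=\mathbb{E}\big[\sum_{k=1}^N A_k^s\big]-1$ for $s\ge0$; $\mathcal{D}=\{s>0:\mathbb{E}[\sum_{k=1}^N A_k^s]<\infty\}$; $\mu(s)=\Phi(s)/s$ for $s\in\mathcal{D}$. Marked continuous-time branching random walk. Let $E$ be a unit mean exponential random variable independent of $(N,C,A_1,A_2,\ldots)$. Let $\bigcup_{n\ge0}\mathbb{N}^n$ ($\mathbb{N}^0=\{\varnothing\}$) be the set of Ulam-Harris labels and equip the vertices $x$ with independent copies $(E(x),N(x),C(x),A_1(x),A_2(x),\ldots)$ of $(E,N,C,A_1,A_2,\ldots)$. The full Galton-Watson tree $\mathcal{T}_\infty$ contains $\varnothing$, and for each $x\in\mathcal{T}_\infty$ the children of $x$ in $\mathcal{T}_\infty$ are $xi$, $1\le i\le N(x)$. Birth times $B$, death times $D$ and positions $V$ are defined by $B(\varnothing)=0$, $D(x)=B(x)+E(x)$, $B(xi)=D(x)$, $V(\varnothing)=0$, $V(xi)=V(x)+\log A_i(x)$. For $t\ge0$ let $\partial\mathcal{T}_t=\{x\in\mathcal{T}_\infty: B(x)\le t<D(x)\}$ and $\mathcal{T}_t^o=\{x\in\mathcal{T}_\infty: D(x)\le t\}$. Put $$C_t=\sum_{x\in\mathcal{T}_t^o}e^{V(x)}C(x),\qquad M_t(\gamma)=e^{-\Phi(\gamma)t}\sum_{x\in\partial\mathcal{T}_t}e^{\gamma V(x)},\quad\gamma\in\mathcal{D}.$$ $(M_t(\gamma))_{t\ge0}$ is a nonnegative martingale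 and $M_\infty(\gamma)$ denotes its a.s. limit as $t\to\infty$. *)

theory Defs
  imports "HOL-Probability.Probability"
begin

section \<open>The generic mark $(N,C,A_1,A_2,\ldots)$\<close>

text \<open>The state space is $\{0,1,2,\ldots\}\times{\bf R}\times(0,\infty)^{\{1,2,\ldots\}}$. The weights
  are indexed from 1, so a function \<open>A\<close> enters only through its values \<open>A k\<close>
  with \<open>k \<ge> 1\<close>.\<close>

definition mark_space :: "(nat \<times> real \<times> (nat \<Rightarrow> real)) measure" where
  "mark_space = count_space UNIV \<Otimes>\<^sub>M borel \<Otimes>\<^sub>M (\<Pi>\<^sub>M k\<in>{1..}. restrict_space borel {0<..})"

definition mark ::
  "('a \<Rightarrow> nat) \<Rightarrow> ('a \<Rightarrow> real) \<Rightarrow> (nat \<Rightarrow> 'a \<Rightarrow> real) \<Rightarrow> 'a \<Rightarrow> nat \<times> real \<times> (nat \<Rightarrow> real)"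
  where "mark N C A = (\<lambda>\<omega>. (N \<omega>, C \<omega>, \<lambda>k\<in>{1..}. A k \<omega>))"

definition moment_domain :: "'a measure \<Rightarrow> ('a \<Rightarrow> nat) \<Rightarrow> (nat \<Rightarrow> 'a \<Rightarrow> real) \<Rightarrow> real set" where
  "moment_domain M N A =
     {s. s > 0 \<and> (\<integral>\<^sup>+\<omega>. ennreal (\<Sum>k=1..N \<omega>. A k \<omega> powr s) \<partial>M) < \<infinity>}"

text \<open>The value of \<open>Phi\<close> at \<open>s\<close> is meaningful only where the expectation is finite, in particular
  on \<open>moment_domain\<close>; elsewhere the mathematical value is $+\infty$, while the Bochner integral
  is 0 by convention.\<close>

definition Phi :: "'a measure \<Rightarrow> ('a \<Rightarrow> nat) \<Rightarrow> (nat \<Rightarrow> 'a \<Rightarrow> real) \<Rightarrow> real \<Rightarrow> real" where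
  "Phi M N A s = (\<integral>\<omega>. (\<Sum>k=1..N \<omega>. A k \<omega> powr s) \<partial>M) - 1"

definition mu :: "'a measure \<Rightarrow> ('a \<Rightarrow> nat) \<Rightarrow> (nat \<Rightarrow> 'a \<Rightarrow> real) \<Rightarrow> real \<Rightarrow> real" where
  "mu M N A s = Phi M N A s / s"


section \<open>The tree, for a fixed realization of the marks\<close>

text \<open>Ulam-Harris labels are lists of positive integers; the label $xi$ is \<open>x @ [i]\<close>.\<close>

definition labels :: "nat list set" where
  "labels = lists {1..}"

inductive_set gw_tree :: "(nat list \<Rightarrow> nat) \<Rightarrow> nat list set" for N :: "nat list \<Rightarrow> nat" where
  root: "[] \<in> gw_tree N"
| child: "x \<in> gw_tree N \<Longrightarrow> 1 \<le> i \<Longrightarrow> i \<le> N x \<Longrightarrow> x @ [i] \<in> gw_tree N"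

fun birth :: "(nat list \<Rightarrow> real) \<Rightarrow> nat list \<Rightarrow> real" where
  "birth E x = (if x = [] then 0 else birth E (butlast x) + E (butlast x))"

declare birth.simps [simp del]

definition death :: "(nat list \<Rightarrow> real) \<Rightarrow> nat list \<Rightarrow> real" where
  "death E x = birth E x + E x"

fun pos :: "(nat list \<Rightarrow> nat \<Rightarrow> real) \<Rightarrow> nat list \<Rightarrow> real" where
  "pos A x = (if x = [] then 0 else pos A (butlast x) + ln (A (butlast x) (last x)))"

declare pos.simps [simp del]

text \<open>The recursions of the branching random walk.\<close>

lemma birth_Nil [simp]: "birth E [] = 0"
  by (simp add: birth.simps)

lemma birth_snoc [simp]: "birth E (x @ [i]) = death E x"
  by (subst birth.simps) (simp add: death_def)

lemma pos_Nil [simp]: "pos A [] = 0"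
  by (simp add: pos.simps)

lemma pos_snoc [simp]: "pos A (x @ [i]) = pos A x + ln (A x i)"
  by (subst pos.simps) simp

definition alive :: "(nat list \<Rightarrow> real) \<Rightarrow> (nat list \<Rightarrow> nat) \<Rightarrow> real \<Rightarrow> nat list set" where
  "alive E N t = {x \<in> gw_tree N. birth E x \<le> t \<and> t < death E x}"

definition dead :: "(nat list \<Rightarrow> real) \<Rightarrow> (nat list \<Rightarrow> nat) \<Rightarrow> real \<Rightarrow> nat list set" where
  "dead E N t = {x \<in> gw_tree N. death E x \<le> t}"


section \<open>The processes $C_t$, $M_t(\gamma)$ and the variable $C_\infty$\<close>

text \<open>From here on \<open>E x\<close>, \<open>N x\<close>, \<open>C x\<close>, \<open>A x k\<close> are random variables attached to the label \<open>x\<close>.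
  All sums are unconditional sums; whether \<open>C_sum_inf\<close> converges is part of the theorem.\<close>

definition C_sum ::
  "(nat list \<Rightarrow> 'w \<Rightarrow> real) \<Rightarrow> (nat list \<Rightarrow> 'w \<Rightarrow> nat) \<Rightarrow> (nat list \<Rightarrow> 'w \<Rightarrow> real) \<Rightarrow>
   (nat list \<Rightarrow> nat \<Rightarrow> 'w \<Rightarrow> real) \<Rightarrow> real \<Rightarrow> 'w \<Rightarrow> real" where
  "C_sum E N C A t \<omega> =
     (\<Sum>\<^sub>\<infinity>x\<in>dead (\<lambda>x. E x \<omega>) (\<lambda>x. N x \<omega>) t. exp (pos (\<lambda>x k. A x k \<omega>) x) * C x \<omega>)"

definition C_sum_inf ::
  "(nat list \<Rightarrow> 'w \<Rightarrow> nat) \<Rightarrow> (nat list \<Rightarrow> 'w \<Rightarrow> real) \<Rightarrow>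
   (nat list \<Rightarrow> nat \<Rightarrow> 'w \<Rightarrow> real) \<Rightarrow> 'w \<Rightarrow> real" where
  "C_sum_inf N C A \<omega> =
     (\<Sum>\<^sub>\<infinity>x\<in>gw_tree (\<lambda>x. N x \<omega>). exp (pos (\<lambda>x k. A x k \<omega>) x) * C x \<omega>)"

text \<open>The first argument of \<open>add_mart\<close> is the function $\Phi$ of the generic mark.\<close>

definition add_mart ::
  "(real \<Rightarrow> real) \<Rightarrow> (nat list \<Rightarrow> 'w \<Rightarrow> real) \<Rightarrow> (nat list \<Rightarrow> 'w \<Rightarrow> nat) \<Rightarrow>
   (nat list \<Rightarrow> nat \<Rightarrow> 'w \<Rightarrow> real) \<Rightarrow> real \<Rightarrow> real \<Rightarrow> 'w \<Rightarrow> real" where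
  "add_mart \<Phi> E N A \<gamma> t \<omega> =
     exp (- \<Phi> \<gamma> * t) *
     (\<Sum>\<^sub>\<infinity>x\<in>alive (\<lambda>x. E x \<omega>) (\<lambda>x. N x \<omega>) t. exp (\<gamma> * pos (\<lambda>x k. A x k \<omega>) x))"


section \<open>Modes of convergence\<close>

text \<open>Almost sure limits are unique only up to null sets; \<open>as_limit\<close> admits every measurable
  version. Measurability is part of both notions since \<open>measure\<close> vanishes on non-measurable sets.\<close>

definition as_limit ::
  "'w measure \<Rightarrow> ('t \<Rightarrow> 'w \<Rightarrow> real) \<Rightarrow> ('w \<Rightarrow> real) \<Rightarrow> 't filter \<Rightarrow> bool" where
  "as_limit P X Y F \<longleftrightarrow>
     Y \<in> borel_measurable P \<and> (AE \<omega> in P. ((\<lambda>t. X t \<omega>) \<longlongrightarrow> Y \<omega>) F)"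

definition tendsto_in_prob ::
  "'w measure \<Rightarrow> ('t \<Rightarrow> 'w \<Rightarrow> real) \<Rightarrow> ('w \<Rightarrow> real) \<Rightarrow> 't filter \<Rightarrow> bool" where
  "tendsto_in_prob P X Y F \<longleftrightarrow>
     (\<forall>\<^sub>F t in F. X t \<in> borel_measurable P) \<and> Y \<in> borel_measurable P \<and>
     (\<forall>\<epsilon>>0. ((\<lambda>t. \<P>(\<omega> in P. \<bar>X t \<omega> - Y \<omega>\<bar> > \<epsilon>)) \<longlongrightarrow> 0) F)"

end

theory Submission
  imports Defs
begin

text \<open>Write $\Phi = \Phi(1)$, let $w(x)$ be $e^{V(x)}$ for $x$ in the tree and $0$ for all other labels, let
$Y_s = \sum_{x \in \partial{\cal T}_s} e^{V(x)} = e^{\Phi s} M_s(1)$ and $c = {\bf E}[C]$. A vertex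
alive at time $s$ dies at rate one, and at its death it contributes $w(x) C(x)$, so $C_t$ should be close
to $c \int_0^t Y_s\,ds$. As $M_s(1)$ converges almost surely, a weighted Cesaro mean gives
$e^{-\Phi t} \int_0^t Y_s\,ds \to M_\infty(1)/\Phi$ if $\Phi > 0$ (\<open>exp_weighted_cesaro\<close>) and
$\frac1t \int_0^t Y_s\,ds \to M_\infty(1)$ if $\Phi = 0$ (\<open>plain_cesaro\<close>). It remains to see that the
difference is negligible on these scales.

The difference is a sum over the vertices born up to time $t$ of $w(x)\,\xi_x$, where
$\xi_x = C(x) 1\{E(x) \le u\} - c \min(E(x), u)$ with $u = t - B(x)$
(\<open>regular_cost_decomposition\<close>). For fixed $u$ the variable $\xi_x$ is centred, because
${\bf P}[E \le u] = {\bf E}[\min(E, u)]$ for a standard exponential $E$ independent of $C$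
(\<open>innovation_mean\<close>), and it is a function of the data at $x$, whereas $w(x)$ and $B(x)$ depend on
the data at strict ancestors of $x$ only. So the sum behaves like a martingale whose increments are
revealed in the order of the length of the labels, and for $1 < q \le 2$ a von Bahr-Esseen inequality
bounds its $q$-th absolute moment by a multiple of $\sum_x {\bf E}[w(x)^q 1\{B(x) \le t\}]$
(\<open>moment_sum_le\<close>). Conditional expectations are avoided: all that is used about the increments is
that resampling the data of a single vertex leaves the law of the whole family unchanged.

For $\theta \ge 0$ the indicator of $B(x) \le t$ is at most $e^{\theta t} e^{-\theta B(x)}$, and
${\bf E}[w(x)^q e^{-\theta B(x)}]$ is a product along the ancestral line of $x$. Summed over the children of a vertex,
its factors give $(1 + \Phi(q))/(1 + \theta)$, so for $\theta > \Phi(q)$ the sum over all labels is a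
convergent geometric series (\<open>tree_sum_born_le\<close>) and the $q$-th moment of the difference is
$O(e^{\theta t})$ (\<open>deviation_moment_le\<close>). Because $\mu'(1) < 0$, some $q > 1$ satisfies
$\Phi(q) < q\,\Phi$ (\<open>exists_moment_order\<close>). If $\Phi > 0$, one can therefore take $\theta < q\,\Phi$, and
$e^{-\Phi t}$ times the difference tends to $0$ in $L^q$; if $\Phi = 0$, then $\Phi(q) < 0$, so $\theta = 0$
is allowed and the difference is bounded in $L^q$.

If $\Phi < 0$, the same geometric series with $q = 1$ and $\theta = 0$ shows that
$\sum_x w(x) |C(x)|$ has finite expectation, and $C_t \to C_\infty$ almost surely by dominated convergence.
The equation for the law of $C_\infty$ is the decomposition of the tree at its root: the subtrees of the
children are independent of each other and of the root, and each has the law of the whole family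
(\<open>total_cost_fixed_point\<close>).\<close>

section \<open>Power inequalities\<close>

lemma powr_subadditive:
  fixes x y r :: real
  assumes "0 \<le> x" "0 \<le> y" "0 < r" "r \<le> 1"
  shows "(x + y) powr r \<le> x powr r + y powr r"
proof (cases "x + y = 0")
  case True
  then show ?thesis using assms by simp
next
  case False
  define s where "s = x + y"
  have s: "s > 0" using False assms by (simp add: s_def)
  have *: "z / s \<le> (z / s) powr r" if "0 \<le> z" "z \<le> s" for z
  proof (cases "z = 0")
    case False
    have "(z / s) powr 1 \<le> (z / s) powr r"
      using that s assms False by (intro powr_mono') auto
    then show ?thesis using that s by simp
  qed simp
  have "1 = x / s + y / s" using s by (simp add: s_def add_divide_distrib[symmetric])
  also have "\<dots> \<le> (x / s) powr r + (y / s) powr r"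
    using assms by (intro add_mono *) (auto simp: s_def)
  also have "\<dots> = (x powr r + y powr r) / s powr r"
    using assms s by (simp add: powr_divide add_divide_distrib)
  finally show ?thesis using s by (simp add: s_def field_simps)
qed

lemma signed_powr_hoelder:
  fixes u v r :: real
  assumes "0 < r" "r \<le> 1"
  shows "\<bar>sgn u * \<bar>u\<bar> powr r - sgn v * \<bar>v\<bar> powr r\<bar> \<le> 2 * \<bar>u - v\<bar> powr r"
proof -
  have same: "\<bar>x powr r - y powr r\<bar> \<le> \<bar>x - y\<bar> powr r" if xy: "0 \<le> x" "0 \<le> y" for x y :: real
  proof -
    have *: "\<bar>x powr r - y powr r\<bar> \<le> \<bar>x - y\<bar> powr r" if "0 \<le> y" "y \<le> x" for x y :: real
      using powr_subadditive[of "x - y" y r] powr_mono2[of r y x] that assms by auto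
    show ?thesis using *[of x y] *[of y x] xy by (cases "y \<le> x") (auto simp: abs_minus_commute)
  qed
  have opp: "x powr r + y powr r \<le> 2 * (x + y) powr r" if "0 \<le> x" "0 \<le> y" for x y :: real
    using powr_mono2[of r x "x + y"] powr_mono2[of r y "x + y"] that assms by auto
  consider "u \<ge> 0" "v \<ge> 0" | "u < 0" "v < 0" | "u \<ge> 0" "v < 0" | "u < 0" "v \<ge> 0" by linarith
  then show ?thesis
  proof cases
    case 1
    have "\<bar>u powr r - v powr r\<bar> \<le> 2 * \<bar>u - v\<bar> powr r"
      using same[OF 1] powr_ge_zero[of "\<bar>u - v\<bar>" r] by linarith
    then show ?thesis using 1 by (auto simp: sgn_if)
  next
    case 2
    then show ?thesis using same[of "-u" "-v"] powr_ge_zero[of "\<bar>u - v\<bar>" r]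
      by (auto simp: sgn_if abs_minus_commute)
  next
    case 3
    then show ?thesis using opp[of u "-v"] by (auto simp: sgn_if)
  next
    case 4
    then have "\<bar>u - v\<bar> = - u + v" by simp
    moreover have "sgn u * \<bar>u\<bar> powr r - sgn v * \<bar>v\<bar> powr r = - ((- u) powr r + v powr r)"
      using 4 by (cases "v = 0") (simp_all add: sgn_if)
    moreover have "\<bar>- ((- u) powr r + v powr r)\<bar> = (- u) powr r + v powr r"
      by (simp only: abs_minus_cancel) simp
    ultimately show ?thesis using 4 opp[of "-u" v] by auto
  qed
qed

lemma abs_powr_has_derivative:
  fixes x q :: real
  assumes "1 < q"
  shows "((\<lambda>x. \<bar>x\<bar> powr q) has_real_derivative (q * sgn x * \<bar>x\<bar> powr (q - 1))) (at x)"
proof -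
  consider "x > 0" | "x < 0" | "x = 0" by linarith
  then show ?thesis
  proof cases
    case 1
    have "((\<lambda>x. x powr q) has_real_derivative (q * x powr (q - 1))) (at x)"
      using 1 by (auto intro!: derivative_eq_intros)
    moreover have "\<forall>\<^sub>F y in nhds x. y powr q = \<bar>y\<bar> powr q"
      using eventually_nhds_in_open[of "{0<..}" x] 1 by (auto elim!: eventually_mono)
    ultimately show ?thesis using 1 by (subst DERIV_cong_ev[OF refl _ refl, symmetric]) auto
  next
    case 2
    have "((\<lambda>x. (- x) powr q) has_real_derivative (- q * (- x) powr (q - 1))) (at x)"
      using 2 by (auto intro!: derivative_eq_intros)
    moreover have "\<forall>\<^sub>F y in nhds x. (- y) powr q = \<bar>y\<bar> powr q"
      using eventually_nhds_in_open[of "{..<0}" x] 2 by (auto elim!: eventually_mono)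
    ultimately show ?thesis using 2 by (subst DERIV_cong_ev[OF refl _ refl, symmetric]) auto
  next
    case 3
    have "((\<lambda>h. \<bar>h\<bar> powr (q - 1)) \<longlongrightarrow> \<bar>0\<bar> powr (q - 1)) (at (0::real))"
      using assms by (intro tendsto_powr' tendsto_intros) auto
    then have "((\<lambda>h. \<bar>h\<bar> powr (q - 1)) \<longlongrightarrow> 0) (at (0::real))"
      by simp
    moreover have bd: "norm (\<bar>h\<bar> powr q / h) \<le> \<bar>h\<bar> powr (q - 1)" for h :: real
      by (cases "h = 0") (auto simp: powr_diff)
    ultimately have "((\<lambda>h. \<bar>h\<bar> powr q / h) \<longlongrightarrow> 0) (at (0::real))"
      by (intro Lim_null_comparison[OF always_eventually[OF allI[OF bd]]])
    then show ?thesis using 3 assms by (simp add: DERIV_def)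
  qed
qed

text \<open>The inequality behind moment bounds for martingales of order $q \in (1,2]$: once $b$ is centred given $a$,
the middle term vanishes in expectation. It follows from the mean value theorem, because the derivative
of $|x|^q$ is Hoelder continuous of order $q - 1$.\<close>

lemma abs_powr_add_le:
  fixes a b q :: real
  assumes "1 < q" "q \<le> 2"
  shows "\<bar>a + b\<bar> powr q \<le> \<bar>a\<bar> powr q + q * sgn a * \<bar>a\<bar> powr (q - 1) * b + 2 * q * \<bar>b\<bar> powr q"
proof (cases "b = 0")
  case False
  define \<phi> where "\<phi> x = q * sgn x * \<bar>x\<bar> powr (q - 1)" for x :: real
  have d: "((\<lambda>s. \<bar>a + s * b\<bar> powr q) has_real_derivative \<phi> (a + s * b) * b) (at s)" for s
  proof -
    have "((\<lambda>s. a + s * b) has_real_derivative b) (at s)"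
      by (auto intro!: derivative_eq_intros)
    from DERIV_chain2[OF abs_powr_has_derivative[OF assms(1)] this] show ?thesis
      by (simp add: \<phi>_def)
  qed
  obtain s where s: "0 < s" "s < 1" and
    eq: "\<bar>a + 1 * b\<bar> powr q - \<bar>a + 0 * b\<bar> powr q = (1 - 0) * (\<phi> (a + s * b) * b)"
    using MVT2[of 0 1 "\<lambda>s. \<bar>a + s * b\<bar> powr q" "\<lambda>s. \<phi> (a + s * b) * b", OF _ d] zero_less_one by blast
  have "\<bar>\<phi> (a + s * b) - \<phi> a\<bar> \<le> q * (2 * \<bar>s * b\<bar> powr (q - 1))"
    using signed_powr_hoelder[of "q - 1" "a + s * b" a] assms
    by (auto simp: \<phi>_def mult.assoc right_diff_distrib[symmetric] abs_mult)
  also have "\<dots> \<le> q * (2 * \<bar>b\<bar> powr (q - 1))"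
    using s assms by (intro mult_left_mono powr_mono2) (auto simp: abs_mult mult_left_le_one_le)
  finally have "\<bar>(\<phi> (a + s * b) - \<phi> a) * b\<bar> \<le> q * (2 * \<bar>b\<bar> powr (q - 1)) * \<bar>b\<bar>"
    by (simp add: abs_mult mult_right_mono)
  also have "\<dots> = 2 * q * \<bar>b\<bar> powr q" using False by (simp add: powr_diff)
  finally have "(\<phi> (a + s * b) - \<phi> a) * b \<le> 2 * q * \<bar>b\<bar> powr q" by linarith
  moreover have "\<bar>a + b\<bar> powr q = \<bar>a\<bar> powr q + \<phi> a * b + (\<phi> (a + s * b) - \<phi> a) * b"
    using eq by (simp add: left_diff_distrib)
  ultimately show ?thesis by (simp add: \<phi>_def)
qed (use assms in simp)

lemma powr_le_one_plus:
  fixes x a b :: real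
  assumes "0 \<le> x" "0 \<le> a" "a \<le> b"
  shows "x powr a \<le> 1 + x powr b"
proof (cases "x \<le> 1")
  case True
  then have "x powr a \<le> 1" using assms by (simp add: powr_le1)
  then show ?thesis using powr_ge_zero[of x b] by linarith
next
  case False
  then have "x powr a \<le> x powr b" using assms by (intro powr_mono) auto
  then show ?thesis by linarith
qed

text \<open>Guarantees that the middle term of \<open>abs_powr_add_le\<close> is integrable as soon as $|a|^q$ and
$|b|^q$ are; it replaces Hoelder's inequality.\<close>

lemma powr_mult_le:
  fixes a b q :: real
  assumes "1 < q" "0 \<le> a" "0 \<le> b"
  shows "a powr (q - 1) * b \<le> a powr q + b powr q"
proof (cases "a \<le> b")
  case True
  have "a powr (q - 1) * b \<le> b powr (q - 1) * b"
    using True assms by (intro mult_right_mono powr_mono2) auto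
  also have "\<dots> = b powr q" using assms by (cases "b = 0") (auto simp: powr_diff)
  finally show ?thesis using powr_ge_zero[of a q] by linarith
next
  case False
  have "a powr (q - 1) * b \<le> a powr (q - 1) * a"
    using False assms by (intro mult_left_mono) auto
  also have "\<dots> = a powr q" using assms False by (auto simp: powr_diff)
  finally show ?thesis using powr_ge_zero[of b q] by linarith
qed

lemma abs_add_powr_le:
  fixes a b q :: real
  assumes "0 \<le> q"
  shows "\<bar>a + b\<bar> powr q \<le> 2 powr q * (\<bar>a\<bar> powr q + \<bar>b\<bar> powr q)"
proof -
  have "\<bar>a + b\<bar> powr q \<le> (2 * max \<bar>a\<bar> \<bar>b\<bar>) powr q"
    using assms by (intro powr_mono2) auto
  also have "\<dots> = 2 powr q * max \<bar>a\<bar> \<bar>b\<bar> powr q"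
    by (simp add: powr_mult)
  also have "max \<bar>a\<bar> \<bar>b\<bar> powr q \<le> \<bar>a\<bar> powr q + \<bar>b\<bar> powr q"
    by (auto simp: max_def)
  finally show ?thesis by (simp add: mult_left_mono)
qed

section \<open>Unconditional sums as integrals\<close>

text \<open>For real summands, unconditional summability is absolute summability, so unconditional sums are
Lebesgue integrals; measurability, dominated convergence and Tonelli's theorem become available for
them. Divergent sums and non-integrable functions both have the default value $0$.\<close>

lemma summable_on_iff_integrable_count_space:
  fixes f :: "'b \<Rightarrow> real"
  shows "f summable_on S \<longleftrightarrow> integrable (count_space S) f"
  unfolding Infinite_Set_Sum.abs_summable_on_def[symmetric] abs_summable_equivalent[symmetric]
  by (rule summable_on_iff_abs_summable_on_real)

lemma infsum_eq_integral_count_space: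
  fixes f :: "'b \<Rightarrow> real"
  shows "infsum f S = (\<integral>x. f x \<partial>count_space S)"
proof (cases "integrable (count_space S) f")
  case True
  then show ?thesis
    using infsetsum_infsum[of f S] by (simp add: infsetsum_def Infinite_Set_Sum.abs_summable_on_def)
next
  case False
  then show ?thesis
    using summable_on_iff_integrable_count_space[of f S]
    by (simp add: infsum_not_exists not_integrable_integral_eq)
qed

lemma borel_measurable_infsum:
  fixes f :: "'b \<Rightarrow> 'c \<Rightarrow> real"
  assumes "countable S" "\<And>x. x \<in> S \<Longrightarrow> f x \<in> borel_measurable R"
  shows "(\<lambda>\<omega>. infsum (\<lambda>x. f x \<omega>) S) \<in> borel_measurable R"
proof -
  interpret S: sigma_finite_measure "count_space S"
    using assms(1) by (rule sigma_finite_measure_count_space_countable)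
  have "case_prod (\<lambda>\<omega> x. f x \<omega>) \<in> borel_measurable (R \<Otimes>\<^sub>M count_space S)"
    by (subst measurable_pair_swap_iff, rule measurable_pair_measure_countable1) (use assms in auto)
  then show ?thesis
    unfolding infsum_eq_integral_count_space by (intro S.borel_measurable_lebesgue_integral) auto
qed

lemma sum_le_nn_integral_count_space:
  fixes a :: "'b \<Rightarrow> ennreal"
  assumes "finite F" "F \<subseteq> S"
  shows "(\<Sum>x\<in>F. a x) \<le> (\<integral>\<^sup>+x. a x \<partial>count_space S)"
proof -
  have "(\<Sum>x\<in>F. a x) = (\<Sum>x\<in>F. a x * indicator F x)" by simp
  also have "\<dots> = (\<integral>\<^sup>+x. a x * indicator F x \<partial>count_space S)"
    by (rule nn_integral_count_space'[symmetric]) (use assms in auto)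
  also have "\<dots> \<le> (\<integral>\<^sup>+x. a x \<partial>count_space S)"
    by (rule nn_integral_mono) (auto simp: indicator_def)
  finally show ?thesis .
qed

lemma has_sum_finite_UN:
  fixes f :: "'b \<Rightarrow> real"
  assumes "finite I" "\<And>i. i \<in> I \<Longrightarrow> (f has_sum s i) (B i)" "disjoint_family_on B I"
  shows "(f has_sum (\<Sum>i\<in>I. s i)) (\<Union>i\<in>I. B i)"
  using assms
proof (induction I)
  case (insert i I)
  have "(f has_sum (s i + (\<Sum>i\<in>I. s i))) (B i \<union> (\<Union>i\<in>I. B i))"
  proof (rule has_sum_Un_disjoint)
    show "(f has_sum (\<Sum>i\<in>I. s i)) (\<Union>i\<in>I. B i)"
      using insert.prems by (intro insert.IH) (auto simp: disjoint_family_on_def)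
    show "B i \<inter> (\<Union>i\<in>I. B i) = {}"
      using insert.prems(2) insert.hyps(2) by (fastforce simp: disjoint_family_on_def)
  qed (use insert.prems in auto)
  then show ?case using insert.hyps by simp
qed simp

lemma AE_nn_integral_count_space_finite:
  fixes g :: "'b \<Rightarrow> 'c \<Rightarrow> ennreal"
  assumes S: "countable S" and g: "\<And>x. x \<in> S \<Longrightarrow> g x \<in> borel_measurable R"
    and fin: "(\<integral>\<^sup>+x. \<integral>\<^sup>+\<omega>. g x \<omega> \<partial>R \<partial>count_space S) < \<infinity>"
  shows "AE \<omega> in R. (\<integral>\<^sup>+x. g x \<omega> \<partial>count_space S) \<noteq> \<infinity>"
proof (rule nn_integral_PInf_AE)
  interpret S: sigma_finite_measure "count_space S"
    using S by (rule sigma_finite_measure_count_space_countable)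
  have "(\<lambda>(\<omega>, x). g x \<omega>) \<in> borel_measurable (R \<Otimes>\<^sub>M count_space S)"
    by (subst measurable_pair_swap_iff, rule measurable_pair_measure_countable1) (use S g in auto)
  then show "(\<lambda>\<omega>. \<integral>\<^sup>+x. g x \<omega> \<partial>count_space S) \<in> borel_measurable R"
    by (rule S.borel_measurable_nn_integral)
  have "(\<integral>\<^sup>+\<omega>. \<integral>\<^sup>+x. g x \<omega> \<partial>count_space S \<partial>R) = (\<integral>\<^sup>+x. \<integral>\<^sup>+\<omega>. g x \<omega> \<partial>R \<partial>count_space S)"
    by (rule nn_integral_count_space_nn_integral[OF S g])
  then show "(\<integral>\<^sup>+\<omega>. \<integral>\<^sup>+x. g x \<omega> \<partial>count_space S \<partial>R) \<noteq> \<infinity>" using fin by simp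
qed

section \<open>Cesaro means and convergence in probability\<close>

lemma weighted_cesaro:
  fixes f h :: "real \<Rightarrow> real"
  assumes h: "\<And>s. h s > 0" and hi: "\<And>t. set_integrable lborel {0..t} h"
    and fi: "\<And>t. set_integrable lborel {0..t} f"
    and lim: "((\<lambda>s. f s / h s) \<longlongrightarrow> L) at_top"
    and H: "filterlim (\<lambda>t. LINT s:{0..t}|lborel. h s) at_top at_top"
  shows "((\<lambda>t. (LINT s:{0..t}|lborel. f s) / (LINT s:{0..t}|lborel. h s)) \<longlongrightarrow> L) at_top"
proof (rule tendstoI)
  fix e :: real assume e: "e > 0"
  define g where "g s = f s - L * h s" for s
  have gi: "set_integrable lborel {0..t} g" for t
    unfolding g_def using fi hi by (intro set_integral_diff set_integrable_mult_right) auto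
  have "\<forall>\<^sub>F s in at_top. dist (f s / h s) L < e / 2"
    using tendstoD[OF lim, of "e / 2"] e by simp
  then obtain T where T: "\<And>s. s \<ge> T \<Longrightarrow> dist (f s / h s) L < e / 2"
    by (auto simp: eventually_at_top_linorder)
  have gT: "\<bar>g s\<bar> \<le> e / 2 * h s" if "s \<ge> T" for s
  proof -
    have "g s = (f s / h s - L) * h s" using h[of s] by (simp add: g_def field_simps)
    then show ?thesis using T[OF that] h[of s] by (simp add: abs_mult dist_real_def)
  qed
  define K where "K = (LINT s:{0..T}|lborel. \<bar>g s\<bar>)"
  have bound: "\<bar>LINT s:{0..t}|lborel. g s\<bar> \<le> K + e / 2 * (LINT s:{0..t}|lborel. h s)" for t
  proof -
    have "\<bar>LINT s:{0..t}|lborel. g s\<bar> \<le> (LINT s:{0..t}|lborel. \<bar>g s\<bar>)"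
      using set_integral_norm_bound[OF gi] by simp
    also have "\<dots> \<le> (\<integral>s. (indicator {0..T} s * \<bar>g s\<bar>) + e / 2 * (indicator {0..t} s * h s) \<partial>lborel)"
      unfolding set_lebesgue_integral_def real_scaleR_def
    proof (rule integral_mono)
      show "integrable lborel (\<lambda>x. indicat_real {0..t} x * \<bar>g x\<bar>)"
        using set_integrable_abs[OF gi[of t]] by (simp add: set_integrable_def)
      show "integrable lborel (\<lambda>s. (indicator {0..T} s * \<bar>g s\<bar>) + e / 2 * (indicator {0..t} s * h s))"
        using set_integrable_abs[OF gi[of T]] hi[of t] by (simp add: set_integrable_def)
      show "indicat_real {0..t} x * \<bar>g x\<bar> \<le> indicator {0..T} x * \<bar>g x\<bar> + e / 2 * (indicator {0..t} x * h x)" for x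
        using gT[of x] h[of x] e by (auto simp: indicator_def)
    qed
    also have "\<dots> = K + e / 2 * (LINT s:{0..t}|lborel. h s)"
      using set_integrable_abs[OF gi[of T]] hi[of t]
      unfolding K_def set_lebesgue_integral_def set_integrable_def real_scaleR_def
      by simp
    finally show ?thesis .
  qed
  have "\<forall>\<^sub>F t in at_top. (LINT s:{0..t}|lborel. h s) > max 1 (2 * K / e)"
    using H unfolding filterlim_at_top_dense by blast
  then show "\<forall>\<^sub>F t in at_top. dist ((LINT s:{0..t}|lborel. f s) / (LINT s:{0..t}|lborel. h s)) L < e"
  proof (rule eventually_mono)
    fix t assume t: "(LINT s:{0..t}|lborel. h s) > max 1 (2 * K / e)"
    let ?H = "LINT s:{0..t}|lborel. h s"
    have Hp: "?H > 0" and K: "K < e / 2 * ?H" using t e by (auto simp: field_simps)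
    have "(LINT s:{0..t}|lborel. g s) = (LINT s:{0..t}|lborel. f s) - L * ?H"
      unfolding g_def using fi hi by (subst set_integral_diff) (auto intro!: set_integrable_mult_right)
    then have "\<bar>(LINT s:{0..t}|lborel. f s) - L * ?H\<bar> < e * ?H"
      using bound[of t] K by (simp add: algebra_simps)
    moreover have "(LINT s:{0..t}|lborel. f s) / ?H - L = ((LINT s:{0..t}|lborel. f s) - L * ?H) / ?H"
      using Hp by (simp add: field_simps)
    ultimately show "dist ((LINT s:{0..t}|lborel. f s) / ?H) L < e"
      using Hp by (simp add: dist_real_def abs_divide pos_divide_less_eq)
  qed
qed

lemma integral_exp_Icc:
  fixes a t :: real
  assumes "0 \<le> t" "a \<noteq> 0"
  shows "(LINT s:{0..t}|lborel. exp (a * s)) = (exp (a * t) - 1) / a"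
proof -
  have "(LINT s:{0..t}|lborel. exp (a * s)) = exp (a * t) / a - exp (a * 0) / a"
    unfolding set_lebesgue_integral_def using assms
    by (intro integral_FTC_atLeastAtMost)
       (auto intro!: derivative_eq_intros continuous_intros
         simp: has_real_derivative_iff_has_vector_derivative[symmetric])
  then show ?thesis by (simp add: diff_divide_distrib)
qed

lemma set_integrable_exp_Icc: "set_integrable lborel {0..t} (\<lambda>s::real. exp (a * s))"
  by (rule borel_integrable_atLeastAtMost') (intro continuous_intros)

lemma exp_weighted_cesaro:
  fixes f :: "real \<Rightarrow> real"
  assumes a: "0 < a" and f: "\<And>t. set_integrable lborel {0..t} f"
    and lim: "((\<lambda>s. exp (- a * s) * f s) \<longlongrightarrow> L) at_top"
  shows "((\<lambda>t. exp (- a * t) * (LINT s:{0..t}|lborel. f s)) \<longlongrightarrow> L / a) at_top"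
proof -
  define H where "H t = (LINT s:{0..t}|lborel. exp (a * s))" for t
  have ev: "\<forall>\<^sub>F t in at_top. (exp (a * t) - 1) / a = H t"
    using eventually_ge_at_top[of 0] by eventually_elim (use a in \<open>simp add: H_def integral_exp_Icc\<close>)
  have "filterlim (\<lambda>t. (exp (a * t) - 1) / a) at_top at_top"
  proof (rule filterlim_at_top_mono[OF filterlim_ident], rule always_eventually, rule allI)
    fix t
    have "a * t \<le> exp (a * t) - 1" using exp_ge_add_one_self[of "a * t"] by linarith
    then show "t \<le> (exp (a * t) - 1) / a" using a by (simp add: pos_le_divide_eq mult.commute)
  qed
  then have H: "filterlim H at_top at_top"
    by (rule filterlim_cong[THEN iffD1, OF refl refl ev])
  have "((\<lambda>t. (LINT s:{0..t}|lborel. f s) / H t) \<longlongrightarrow> L) at_top"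
    unfolding H_def
  proof (rule weighted_cesaro[OF _ set_integrable_exp_Icc f _ H[unfolded H_def]])
    show "((\<lambda>s. f s / exp (a * s)) \<longlongrightarrow> L) at_top"
      using lim by (simp add: exp_minus divide_inverse mult.commute)
  qed simp
  moreover have "((\<lambda>t. exp (- a * t) * H t) \<longlongrightarrow> 1 / a) at_top"
  proof (rule Lim_transform_eventually)
    have "((\<lambda>t. exp (- a * t)) \<longlongrightarrow> 0) at_top"
      using a by (intro filterlim_compose[OF exp_at_bot]
        filterlim_tendsto_neg_mult_at_bot[OF tendsto_const _ filterlim_ident]) simp
    then have *: "((\<lambda>t. (1 - exp (- a * t)) / a) \<longlongrightarrow> (1 - 0) / a) at_top"
      using a by (intro tendsto_intros) auto
    have eq: "exp (- a * t) * ((exp (a * t) - 1) / a) = (1 - exp (- a * t)) / a" for t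
      by (simp add: right_diff_distrib exp_minus)
    show "((\<lambda>t. exp (- a * t) * ((exp (a * t) - 1) / a)) \<longlongrightarrow> 1 / a) at_top"
      using * unfolding eq diff_zero .
    show "\<forall>\<^sub>F t in at_top. exp (- a * t) * ((exp (a * t) - 1) / a) = exp (- a * t) * H t"
      using ev by eventually_elim simp
  qed
  ultimately have lim2: "((\<lambda>t. (LINT s:{0..t}|lborel. f s) / H t * (exp (- a * t) * H t)) \<longlongrightarrow> L * (1 / a)) at_top"
    by (rule tendsto_mult)
  have "\<forall>\<^sub>F t in at_top. H t > 0" using H by (simp add: filterlim_at_top_dense)
  then have "\<forall>\<^sub>F t in at_top. (LINT s:{0..t}|lborel. f s) / H t * (exp (- a * t) * H t) =
      exp (- a * t) * (LINT s:{0..t}|lborel. f s)"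
    by eventually_elim simp
  from Lim_transform_eventually[OF lim2 this] show ?thesis by simp
qed

lemma plain_cesaro:
  fixes f :: "real \<Rightarrow> real"
  assumes f: "\<And>t. set_integrable lborel {0..t} f" and lim: "(f \<longlongrightarrow> L) at_top"
  shows "((\<lambda>t. 1 / t * (LINT s:{0..t}|lborel. f s)) \<longlongrightarrow> L) at_top"
proof -
  have H: "(LINT s:{0..t}|lborel. (1::real)) = t" if "0 \<le> t" for t :: real
    using that by (simp add: set_lebesgue_integral_def)
  have i: "set_integrable lborel {0..t} (\<lambda>_. 1::real)" for t :: real
    by (rule borel_integrable_atLeastAtMost') (intro continuous_intros)
  have ev: "\<forall>\<^sub>F t in at_top. t = (LINT s:{0..t}|lborel. (1::real))"
    using eventually_ge_at_top[of "0::real"] by eventually_elim (simp only: H)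
  have "filterlim (\<lambda>t::real. t) at_top at_top" by (rule filterlim_ident)
  then have "filterlim (\<lambda>t::real. LINT s:{0..t}|lborel. (1::real)) at_top at_top"
    by (rule filterlim_cong[THEN iffD1, OF refl refl ev])
  then have "((\<lambda>t. (LINT s:{0..t}|lborel. f s) / (LINT s:{0..t}|lborel. 1)) \<longlongrightarrow> L) at_top"
    using i f lim by (intro weighted_cesaro) auto
  then show ?thesis
  proof (rule Lim_transform_eventually)
    show "\<forall>\<^sub>F t in at_top. (LINT s:{0..t}|lborel. f s) / (LINT s:{0..t}|lborel. 1) = 1 / t * (LINT s:{0..t}|lborel. f s)"
      using eventually_ge_at_top[of "0::real"] by eventually_elim (simp only: H, simp)
  qed
qed

lemma (in prob_space) nn_integral_sample:
  assumes X: "X \<in> measurable M S" "distr M S X = S" and f: "f \<in> borel_measurable S"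
  shows "(\<integral>\<^sup>+\<omega>. f (X \<omega>) \<partial>M) = (\<integral>\<^sup>+w. f w \<partial>S)"
  using nn_integral_distr[OF X(1), of f] f by (simp add: X(2))

lemma (in prob_space) AE_tendsto_imp_tendsto_in_prob:
  assumes X: "\<And>t::real. X t \<in> borel_measurable M" and Y: "Y \<in> borel_measurable M"
    and lim: "AE \<omega> in M. ((\<lambda>t. X t \<omega>) \<longlongrightarrow> Y \<omega>) at_top"
  shows "tendsto_in_prob M X Y at_top"
  unfolding tendsto_in_prob_def
proof (intro conjI allI impI)
  fix e :: real assume e: "e > 0"
  note X[measurable] Y[measurable]
  have "((\<lambda>t. \<integral>\<omega>. indicator {\<omega> \<in> space M. \<bar>X t \<omega> - Y \<omega>\<bar> > e} \<omega> \<partial>M) \<longlongrightarrow> (\<integral>\<omega>. (0::real) \<partial>M)) at_top"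
  proof (rule integral_dominated_convergence_at_top[where w="\<lambda>_. 1"])
    show "AE \<omega> in M. ((\<lambda>t. indicat_real {\<omega> \<in> space M. e < \<bar>X t \<omega> - Y \<omega>\<bar>} \<omega>) \<longlongrightarrow> 0) at_top"
      using lim
    proof eventually_elim
      case (elim \<omega>)
      have "\<forall>\<^sub>F t in at_top. indicat_real {\<omega> \<in> space M. e < \<bar>X t \<omega> - Y \<omega>\<bar>} \<omega> = 0"
        using tendstoD[OF elim e] by eventually_elim (auto simp: dist_real_def indicator_def)
      then show ?case by (rule tendsto_eventually)
    qed
  qed auto
  then show "((\<lambda>t. prob {\<omega> \<in> space M. e < \<bar>X t \<omega> - Y \<omega>\<bar>}) \<longlongrightarrow> 0) at_top"
    by simp
qed (use X Y in auto)

text \<open>A perturbation whose absolute moment of some positive order vanishes in the limit does not affect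
convergence in probability, by Markov's inequality.\<close>

lemma (in prob_space) tendsto_in_prob_add_null:
  assumes Z: "tendsto_in_prob M Z Y at_top"
    and R: "\<And>t::real. R t \<in> borel_measurable M"
    and q: "q > 0" and b: "\<And>t. t \<ge> 0 \<Longrightarrow> (\<integral>\<^sup>+\<omega>. ennreal (\<bar>R t \<omega>\<bar> powr q) \<partial>M) \<le> ennreal (b t)"
    and b0: "(b \<longlongrightarrow> 0) at_top"
    and X: "\<And>t. X t \<in> borel_measurable M" and XZR: "\<And>t. t \<ge> 0 \<Longrightarrow> AE \<omega> in M. X t \<omega> = Z t \<omega> + R t \<omega>"
  shows "tendsto_in_prob M X Y at_top"
  unfolding tendsto_in_prob_def
proof (intro conjI allI impI)
  have Y[measurable]: "Y \<in> borel_measurable M" using Z by (simp add: tendsto_in_prob_def)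
  show "Y \<in> borel_measurable M" by fact
  fix e :: real assume e: "e > 0"
  note X[measurable] R[measurable]
  have ev: "\<forall>\<^sub>F t in at_top. Z t \<in> borel_measurable M" using Z by (simp add: tendsto_in_prob_def)
  have lim: "((\<lambda>t. prob {\<omega> \<in> space M. e / 2 < \<bar>Z t \<omega> - Y \<omega>\<bar>} + \<bar>b t\<bar> / (e / 2) powr q) \<longlongrightarrow> 0 + \<bar>0\<bar> / (e / 2) powr q) at_top"
  proof (intro tendsto_intros b0)
    show "((\<lambda>t. prob {\<omega> \<in> space M. e / 2 < \<bar>Z t \<omega> - Y \<omega>\<bar>}) \<longlongrightarrow> 0) at_top"
      using Z half_gt_zero[OF e] unfolding tendsto_in_prob_def by blast
  qed (use e in simp)
  have ev2: "\<forall>\<^sub>F t in at_top. prob {\<omega> \<in> space M. e < \<bar>X t \<omega> - Y \<omega>\<bar>} \<le>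
      prob {\<omega> \<in> space M. e / 2 < \<bar>Z t \<omega> - Y \<omega>\<bar>} + \<bar>b t\<bar> / (e / 2) powr q"
    using ev eventually_ge_at_top[of "0::real"]
  proof eventually_elim
    case (elim t)
    note elim(1)[measurable]
    let ?c = "(e / 2) powr q"
    have c: "?c > 0" using e by simp
    have "emeasure M {\<omega> \<in> space M. e / 2 \<le> \<bar>R t \<omega>\<bar>} \<le>
       emeasure M {\<omega> \<in> space M. 1 \<le> ennreal (1 / ?c) * ennreal (\<bar>R t \<omega>\<bar> powr q)}"
    proof (rule emeasure_mono)
      show "{\<omega> \<in> space M. e / 2 \<le> \<bar>R t \<omega>\<bar>} \<subseteq> {\<omega> \<in> space M. 1 \<le> ennreal (1 / ?c) * ennreal (\<bar>R t \<omega>\<bar> powr q)}"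
      proof safe
        fix \<omega> assume "e / 2 \<le> \<bar>R t \<omega>\<bar>"
        then have "?c \<le> \<bar>R t \<omega>\<bar> powr q" using e q by (intro powr_mono2) auto
        then have "1 \<le> 1 / ?c * \<bar>R t \<omega>\<bar> powr q" using c by simp
        then show "1 \<le> ennreal (1 / ?c) * ennreal (\<bar>R t \<omega>\<bar> powr q)"
          using c by (subst ennreal_mult[symmetric]) auto
      qed
    qed measurable
    also have "\<dots> \<le> ennreal (1 / ?c) * (\<integral>\<^sup>+\<omega>. ennreal (\<bar>R t \<omega>\<bar> powr q) * indicator (space M) \<omega> \<partial>M)"
      using nn_integral_Markov_inequality[of "\<lambda>\<omega>. ennreal (\<bar>R t \<omega>\<bar> powr q)" "space M" M "ennreal (1 / ?c)"]
      by simp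
    also have "\<dots> \<le> ennreal (1 / ?c) * ennreal \<bar>b t\<bar>"
      using b[OF elim(2)] by (intro mult_left_mono) (auto intro: order_trans ennreal_leI)
    also have "\<dots> = ennreal (\<bar>b t\<bar> / ?c)"
      using c by (subst ennreal_mult[symmetric]) auto
    finally have R2: "prob {\<omega> \<in> space M. e / 2 \<le> \<bar>R t \<omega>\<bar>} \<le> \<bar>b t\<bar> / ?c"
      using c by (simp add: emeasure_eq_measure ennreal_le_iff)
    have "prob {\<omega> \<in> space M. e < \<bar>X t \<omega> - Y \<omega>\<bar>} \<le>
       prob ({\<omega> \<in> space M. e / 2 < \<bar>Z t \<omega> - Y \<omega>\<bar>} \<union> {\<omega> \<in> space M. e / 2 \<le> \<bar>R t \<omega>\<bar>})"
    proof (rule finite_measure_mono_AE)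
      show "AE \<omega> in M. \<omega> \<in> {\<omega> \<in> space M. e < \<bar>X t \<omega> - Y \<omega>\<bar>} \<longrightarrow>
          \<omega> \<in> {\<omega> \<in> space M. e / 2 < \<bar>Z t \<omega> - Y \<omega>\<bar>} \<union> {\<omega> \<in> space M. e / 2 \<le> \<bar>R t \<omega>\<bar>}"
        using XZR[OF elim(2)]
      proof eventually_elim
        case (elim \<omega>)
        have "e / 2 < \<bar>Z t \<omega> - Y \<omega>\<bar> \<or> e / 2 \<le> \<bar>R t \<omega>\<bar>" if "e < \<bar>Z t \<omega> + R t \<omega> - Y \<omega>\<bar>"
          using that by linarith
        with elim show ?case by auto
      qed
    qed measurable
    also have "\<dots> \<le> prob {\<omega> \<in> space M. e / 2 < \<bar>Z t \<omega> - Y \<omega>\<bar>} + prob {\<omega> \<in> space M. e / 2 \<le> \<bar>R t \<omega>\<bar>}"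
      by (rule measure_Un_le) measurable
    finally show ?case using R2 by linarith
  qed
  have lim0: "((\<lambda>t. prob {\<omega> \<in> space M. e / 2 < \<bar>Z t \<omega> - Y \<omega>\<bar>} + \<bar>b t\<bar> / (e / 2) powr q) \<longlongrightarrow> 0) at_top"
    using lim by simp
  show "((\<lambda>t. prob {\<omega> \<in> space M. e < \<bar>X t \<omega> - Y \<omega>\<bar>}) \<longlongrightarrow> 0) at_top"
    by (rule tendsto_sandwich[OF always_eventually ev2 tendsto_const lim0]) simp
qed (use X in auto)

section \<open>Weights of labels\<close>

text \<open>Extending $e^{V(x)}$ by $0$ outside the tree turns all sums over random sets of vertices into sums over
the fixed countable set of labels.\<close>

definition weight :: "(nat list \<Rightarrow> nat) \<Rightarrow> (nat list \<Rightarrow> nat \<Rightarrow> real) \<Rightarrow> nat list \<Rightarrow> real" where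
  "weight N A x = (if x \<in> gw_tree N then exp (pos A x) else 0)"

lemma snoc_in_gw_tree_iff: "x @ [i] \<in> gw_tree N \<longleftrightarrow> x \<in> gw_tree N \<and> 1 \<le> i \<and> i \<le> N x"
  by (auto elim: gw_tree.cases intro: gw_tree.child)

lemma snoc_in_labels_iff: "x @ [i] \<in> labels \<longleftrightarrow> x \<in> labels \<and> 1 \<le> i"
  by (auto simp: labels_def)

lemma Nil_in_labels [simp]: "[] \<in> labels"
  by (simp add: labels_def)

lemma countable_labels [simp]: "countable labels"
  by (rule countableI_type)

lemma gw_tree_subset_labels: "gw_tree N \<subseteq> labels"
proof
  fix x assume "x \<in> gw_tree N"
  then show "x \<in> labels" by induction (auto simp: labels_def)
qed

lemma weight_nonneg [simp]: "0 \<le> weight N A x"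
  by (simp add: weight_def)

lemma weight_Nil [simp]: "weight N A [] = 1"
  by (simp add: weight_def gw_tree.root)

lemma weight_snoc:
  "weight N A (x @ [i]) = weight N A x * (if 1 \<le> i \<and> i \<le> N x then exp (ln (A x i)) else 0)"
  by (auto simp: weight_def snoc_in_gw_tree_iff exp_add)

text \<open>This lemma and the next say that weight and birth time of a label are determined by the data at its
strict prefixes. Comparing lengths is cruder than comparing prefixes, but it is all that is needed when
vertices are revealed in the order of their generations.\<close>

lemma weight_cong:
  assumes "x \<in> labels"
    and "\<And>y. y \<in> labels \<Longrightarrow> length y < length x \<Longrightarrow> N y = N' y"
    and "\<And>y i. y \<in> labels \<Longrightarrow> length y < length x \<Longrightarrow> 1 \<le> i \<Longrightarrow> A y i = A' y i"
  shows "weight N A x = weight N' A' x"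
  using assms
proof (induction x rule: rev_induct)
  case (snoc i x)
  then have "weight N A x = weight N' A' x" by (simp add: snoc_in_labels_iff)
  then show ?case using snoc.prems by (simp add: weight_snoc snoc_in_labels_iff)
qed simp

lemma birth_cong:
  assumes "x \<in> labels" "\<And>y. y \<in> labels \<Longrightarrow> length y < length x \<Longrightarrow> E y = E' y"
  shows "birth E x = birth E' x"
  using assms
proof (induction x rule: rev_induct)
  case (snoc i x)
  then have "birth E x = birth E' x" by (simp add: snoc_in_labels_iff)
  then show ?case using snoc.prems by (simp add: snoc_in_labels_iff death_def)
qed simp

lemma birth_nonneg:
  assumes "x \<in> labels" "\<And>y. y \<in> labels \<Longrightarrow> 0 \<le> E y"
  shows "0 \<le> birth E x"
  using assms by (induction x rule: rev_induct) (auto simp: snoc_in_labels_iff death_def)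

lemma C_sum_eq:
  "C_sum E N C A t \<omega> = (\<Sum>\<^sub>\<infinity>x\<in>labels. weight (\<lambda>x. N x \<omega>) (\<lambda>x k. A x k \<omega>) x *
     (if death (\<lambda>x. E x \<omega>) x \<le> t then C x \<omega> else 0))"
  unfolding C_sum_def
  by (rule infsum_cong_neutral) (use gw_tree_subset_labels in \<open>auto simp: dead_def weight_def\<close>)

lemma C_sum_inf_eq:
  "C_sum_inf N C A \<omega> = (\<Sum>\<^sub>\<infinity>x\<in>labels. weight (\<lambda>x. N x \<omega>) (\<lambda>x k. A x k \<omega>) x * C x \<omega>)"
  unfolding C_sum_inf_def
  by (rule infsum_cong_neutral) (use gw_tree_subset_labels in \<open>auto simp: weight_def\<close>)

definition population_weight ::
  "(nat list \<Rightarrow> real) \<Rightarrow> (nat list \<Rightarrow> nat) \<Rightarrow> (nat list \<Rightarrow> nat \<Rightarrow> real) \<Rightarrow> real \<Rightarrow> real" where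
  "population_weight E N A t =
     (\<Sum>\<^sub>\<infinity>x\<in>labels. weight N A x * (if birth E x \<le> t \<and> t < death E x then 1 else 0))"

lemma add_mart_eq:
  "add_mart \<Phi> E N A 1 t \<omega> =
     exp (- \<Phi> 1 * t) * population_weight (\<lambda>x. E x \<omega>) (\<lambda>x. N x \<omega>) (\<lambda>x k. A x k \<omega>) t"
proof -
  have "(\<Sum>\<^sub>\<infinity>x\<in>alive (\<lambda>x. E x \<omega>) (\<lambda>x. N x \<omega>) t. exp (1 * pos (\<lambda>x k. A x k \<omega>) x)) =
      population_weight (\<lambda>x. E x \<omega>) (\<lambda>x. N x \<omega>) (\<lambda>x k. A x k \<omega>) t"
    unfolding population_weight_def
    by (rule infsum_cong_neutral) (use gw_tree_subset_labels in \<open>auto simp: alive_def weight_def\<close>)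
  then show ?thesis by (simp add: add_mart_def)
qed

text \<open>Finite sets that exhaust the labels and in which every nonempty label is a child of a label of the
same set. Recursive inequalities for a sum over all labels can be stated, and solved, on such a set,
where the sum is finite.\<close>

definition label_box :: "nat \<Rightarrow> nat list set" where
  "label_box n = {x. set x \<subseteq> {1..n} \<and> length x \<le> n}"

lemma finite_label_box: "finite (label_box n)"
  unfolding label_box_def by (rule finite_lists_length_le) simp

lemma label_box_subset: "label_box n \<subseteq> labels"
  by (auto simp: label_box_def labels_def)

lemma label_box_mono: "n \<le> m \<Longrightarrow> label_box n \<subseteq> label_box m"
  by (auto simp: label_box_def)

lemma label_box_exhaust:
  assumes "x \<in> labels" shows "\<exists>n. x \<in> label_box n"
proof
  have "1 \<le> k \<and> k \<le> length x + sum_list x" if "k \<in> set x" for k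
    using that assms member_le_sum_list[OF that] by (auto simp: labels_def)
  then show "x \<in> label_box (length x + sum_list x)"
    by (auto simp: label_box_def)
qed

lemma filterlim_label_box: "filterlim label_box (finite_subsets_at_top labels) sequentially"
  unfolding filterlim_finite_subsets_at_top
proof safe
  fix X assume X: "finite X" "X \<subseteq> labels"
  then have "\<forall>x\<in>X. \<exists>n. x \<in> label_box n" using label_box_exhaust by blast
  then obtain f where f: "\<And>x. x \<in> X \<Longrightarrow> x \<in> label_box (f x)" by metis
  show "\<forall>\<^sub>F n in sequentially. finite (label_box n) \<and> X \<subseteq> label_box n \<and> label_box n \<subseteq> labels"
    using eventually_ge_at_top[of "\<Sum>x\<in>X. f x"]
  proof eventually_elim
    case (elim n)
    have "x \<in> label_box n" if "x \<in> X" for x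
      using f[OF that] label_box_mono[of "f x" n] member_le_sum[OF that, of f] X elim by auto
    then show ?case using finite_label_box label_box_subset by auto
  qed
qed

lemma nn_integral_labels_le:
  assumes "\<And>n. (\<Sum>x\<in>label_box n. g x) \<le> (K :: ennreal)"
  shows "(\<integral>\<^sup>+x. g x \<partial>count_space labels) \<le> K"
proof -
  have "(\<integral>\<^sup>+x. g x \<partial>count_space labels) = (\<integral>\<^sup>+x. (SUP n. g x * indicator (label_box n) x) \<partial>count_space labels)"
  proof (rule nn_integral_cong)
    fix x assume "x \<in> space (count_space labels)"
    then obtain n where "x \<in> label_box n" using label_box_exhaust by auto
    then show "g x = (SUP n. g x * indicator (label_box n) x)"
      by (intro antisym SUP_upper2[of n] SUP_least) (auto simp: indicator_def)
  qed
  also have "\<dots> = (SUP n. \<integral>\<^sup>+x. g x * indicator (label_box n) x \<partial>count_space labels)"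
  proof (rule nn_integral_monotone_convergence_SUP)
    show "incseq (\<lambda>n x. g x * indicator (label_box n) x)"
      using label_box_mono by (auto simp: incseq_def le_fun_def indicator_def)
  qed simp
  also have "\<dots> \<le> K"
  proof (rule SUP_least)
    fix n
    have "(\<integral>\<^sup>+x. g x * indicator (label_box n) x \<partial>count_space labels) = (\<Sum>x\<in>label_box n. g x * indicator (label_box n) x)"
      by (rule nn_integral_count_space') (use finite_label_box label_box_subset in auto)
    then show "(\<integral>\<^sup>+x. g x * indicator (label_box n) x \<partial>count_space labels) \<le> K"
      using assms[of n] by simp
  qed
  finally show ?thesis .
qed

lemma sum_label_box_le:
  fixes g :: "nat list \<Rightarrow> ennreal"
  shows "(\<Sum>x\<in>label_box n. g x) \<le> g [] + (\<Sum>x\<in>label_box n. \<Sum>i=1..n. g (x @ [i]))"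
proof -
  have sub: "label_box n \<subseteq> insert [] ((\<lambda>(x, i). x @ [i]) ` (label_box n \<times> {1..n}))"
  proof
    fix x assume x: "x \<in> label_box n"
    show "x \<in> insert [] ((\<lambda>(x, i). x @ [i]) ` (label_box n \<times> {1..n}))"
      by (cases x rule: rev_cases) (use x in \<open>auto simp: label_box_def intro!: image_eqI\<close>)
  qed
  have "(\<Sum>x\<in>label_box n. g x) \<le> (\<Sum>x\<in>insert [] ((\<lambda>(x, i). x @ [i]) ` (label_box n \<times> {1..n})). g x)"
    by (intro sum_mono2 sub) (auto simp: finite_label_box)
  also have "\<dots> = g [] + (\<Sum>x\<in>((\<lambda>(x, i). x @ [i]) ` (label_box n \<times> {1..n})). g x)"
    by (subst sum.insert) (auto simp: finite_label_box)
  also have "(\<Sum>x\<in>((\<lambda>(x, i). x @ [i]) ` (label_box n \<times> {1..n})). g x) = (\<Sum>(x, i)\<in>label_box n \<times> {1..n}. g (x @ [i]))"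
    by (subst sum.reindex) (auto simp: inj_on_def case_prod_unfold)
  finally show ?thesis by (simp add: sum.cartesian_product)
qed

section \<open>The product space of marked trees\<close>

text \<open>The data $(E(x), N(x), C(x), A_1(x), A_2(x), \ldots)$ attached to one label.\<close>

type_synonym vertex_data = "real \<times> nat \<times> real \<times> (nat \<Rightarrow> real)"

abbreviation vertex_space :: "vertex_data measure" where
  "vertex_space \<equiv> borel \<Otimes>\<^sub>M mark_space"

abbreviation life :: "(nat list \<Rightarrow> vertex_data) \<Rightarrow> nat list \<Rightarrow> real" where
  "life w x \<equiv> fst (w x)"
abbreviation kids :: "(nat list \<Rightarrow> vertex_data) \<Rightarrow> nat list \<Rightarrow> nat" where
  "kids w x \<equiv> fst (snd (w x))"
abbreviation cost :: "(nat list \<Rightarrow> vertex_data) \<Rightarrow> nat list \<Rightarrow> real" where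
  "cost w x \<equiv> fst (snd (snd (w x)))"
abbreviation factor :: "(nat list \<Rightarrow> vertex_data) \<Rightarrow> nat list \<Rightarrow> nat \<Rightarrow> real" where
  "factor w x \<equiv> snd (snd (snd (w x)))"

abbreviation wt :: "(nat list \<Rightarrow> vertex_data) \<Rightarrow> nat list \<Rightarrow> real" where
  "wt w x \<equiv> weight (kids w) (factor w) x"

abbreviation total_weight :: "(nat list \<Rightarrow> vertex_data) \<Rightarrow> real \<Rightarrow> real" where
  "total_weight w \<equiv> population_weight (life w) (kids w) (factor w)"

text \<open>The contribution $A_i^\gamma\,1\{i \le N\}$ of the $i$-th child, as a function of the mark.\<close>

definition child_weight :: "real \<Rightarrow> nat \<Rightarrow> nat \<times> real \<times> (nat \<Rightarrow> real) \<Rightarrow> real" where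
  "child_weight \<gamma> i m = (if 1 \<le> i \<and> i \<le> fst m then snd (snd m) i powr \<gamma> else 0)"

lemma child_weight_nonneg [simp]: "0 \<le> child_weight \<gamma> i m"
  by (simp add: child_weight_def)

lemma measurable_mark_kids [measurable]: "fst \<in> measurable mark_space (count_space UNIV)"
  unfolding mark_space_def by measurable

lemma measurable_mark_cost [measurable]: "(\<lambda>m. fst (snd m)) \<in> borel_measurable mark_space"
  unfolding mark_space_def by measurable

lemma measurable_mark_factor:
  assumes "1 \<le> i" shows "(\<lambda>m. snd (snd m) i) \<in> borel_measurable mark_space"
proof -
  have "(\<lambda>m. snd (snd m) i) \<in> measurable mark_space (restrict_space borel {0<..})"
    unfolding mark_space_def
    by (rule measurable_compose[OF _ measurable_component_singleton[of i "{1..}" "\<lambda>_. restrict_space borel {0<..}"]])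
      (use assms in \<open>simp_all, measurable\<close>)
  then show ?thesis by (simp add: measurable_restrict_space2_iff)
qed

lemma mark_factor_pos:
  assumes "m \<in> space mark_space" "1 \<le> i" shows "0 < snd (snd m) i"
  using assms by (auto simp: mark_space_def space_pair_measure space_PiM space_restrict_space PiE_def Pi_def)

lemma measurable_child_weight [measurable]: "child_weight \<gamma> i \<in> borel_measurable mark_space"
proof (cases "1 \<le> i")
  case True
  note measurable_mark_factor[OF True, measurable]
  show ?thesis unfolding child_weight_def by measurable
next
  case False
  then show ?thesis by (simp add: child_weight_def[abs_def])
qed

text \<open>The law of a mark is \<open>L\<close>. All expectations are computed on the product space \<open>Om\<close>, which is
the joint law of the independent data of all labels; \<open>Q\<close> is the law of the data of one label and \<open>D\<close> that
of its lifetime.\<close>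

locale marked_tree = L: prob_space L for L :: "(nat \<times> real \<times> (nat \<Rightarrow> real)) measure" +
  assumes sets_L [measurable_cong]: "sets L = sets mark_space"
begin

definition D :: "real measure" where "D = density lborel (exponential_density 1)"
definition Q :: "vertex_data measure" where "Q = D \<Otimes>\<^sub>M L"
definition Om :: "(nat list \<Rightarrow> vertex_data) measure" where "Om = (\<Pi>\<^sub>M x\<in>labels. Q)"

lemma sets_D [measurable_cong]: "sets D = sets borel"
  by (simp add: D_def)

lemma sets_Q [measurable_cong]: "sets Q = sets vertex_space"
  unfolding Q_def by (intro sets_pair_measure_cong sets_D sets_L)

lemma sets_Om [measurable_cong]: "sets Om = sets (\<Pi>\<^sub>M x\<in>labels. vertex_space)"
  unfolding Om_def by (intro sets_PiM_cong refl sets_Q)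

sublocale D: prob_space D
  unfolding D_def by (rule prob_space_exponential_density) simp

sublocale DL: pair_prob_space D L ..

sublocale Q: prob_space Q
  unfolding Q_def by (rule DL.prob_space_axioms)

sublocale Om: prob_space Om
  unfolding Om_def by (rule prob_space_PiM) (rule Q.prob_space_axioms)

sublocale QOm: pair_prob_space Q Om ..

lemma space_Q: "space Q = space vertex_space"
  by (rule sets_eq_imp_space_eq[OF sets_Q])

lemma measurable_coord: "x \<in> labels \<Longrightarrow> (\<lambda>w. w x) \<in> measurable Om Q"
  unfolding Om_def by (rule measurable_component_singleton)

lemma coord_in_space: "w \<in> space Om \<Longrightarrow> x \<in> labels \<Longrightarrow> w x \<in> space Q"
  using measurable_space[OF measurable_coord] by blast

lemma measurable_life [measurable (raw)]: "x \<in> labels \<Longrightarrow> (\<lambda>w. life w x) \<in> borel_measurable Om"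
  by (rule measurable_compose[OF measurable_coord]) (simp_all add: measurable_fst measurable_cong_sets[OF sets_Q refl])

lemma measurable_kids: "x \<in> labels \<Longrightarrow> (\<lambda>w. kids w x) \<in> measurable Om (count_space UNIV)"
  by (rule measurable_compose[OF measurable_coord]) measurable

lemma measurable_cost: "x \<in> labels \<Longrightarrow> (\<lambda>w. cost w x) \<in> borel_measurable Om"
  by (rule measurable_compose[OF measurable_coord]) measurable

lemma measurable_factor:
  assumes "x \<in> labels" "1 \<le> i" shows "(\<lambda>w. factor w x i) \<in> borel_measurable Om"
proof (rule measurable_compose[OF measurable_coord[OF assms(1)]])
  note measurable_mark_factor[OF assms(2), measurable]
  show "(\<lambda>m. snd (snd (snd m)) i) \<in> borel_measurable Q" by measurable
qed

lemma measurable_birth: "x \<in> labels \<Longrightarrow> (\<lambda>w. birth (life w) x) \<in> borel_measurable Om"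
proof (induction x rule: rev_induct)
  case (snoc i x)
  then have x: "x \<in> labels" by (simp add: snoc_in_labels_iff)
  note [measurable] = snoc.IH[OF x] measurable_life[OF x]
  show ?case by (simp add: death_def)
qed simp

lemma measurable_wt: "x \<in> labels \<Longrightarrow> (\<lambda>w. wt w x) \<in> borel_measurable Om"
proof (induction x rule: rev_induct)
  case (snoc i x)
  then have x: "x \<in> labels" and i: "1 \<le> i" by (auto simp: snoc_in_labels_iff)
  note [measurable] = snoc.IH[OF x] measurable_kids[OF x] measurable_factor[OF x i]
  show ?case unfolding weight_snoc by measurable
qed simp

lemma wt_snoc:
  assumes "w \<in> space Om" "x \<in> labels"
  shows "wt w (x @ [i]) powr \<gamma> = wt w x powr \<gamma> * child_weight \<gamma> i (snd (w x))"
proof (cases "1 \<le> i \<and> i \<le> kids w x")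
  case True
  have "snd (w x) \<in> space mark_space"
    using coord_in_space[OF assms] by (auto simp: space_Q space_pair_measure)
  then have "0 < factor w x i" using True mark_factor_pos by blast
  then show ?thesis using True by (simp add: weight_snoc child_weight_def powr_mult)
qed (auto simp: weight_snoc child_weight_def)

section \<open>Resampling the data of one label\<close>

lemma wt_update: "z \<in> labels \<Longrightarrow> length z \<le> length x \<Longrightarrow> wt (w(x := y)) z = wt w z"
  by (rule weight_cong) auto

lemma birth_update: "z \<in> labels \<Longrightarrow> length z \<le> length x \<Longrightarrow> birth (life (w(x := y))) z = birth (life w) z"
  by (rule birth_cong) auto

lemma measurable_update:
  assumes "x \<in> labels" shows "(\<lambda>(y, w). w(x := y)) \<in> measurable (Q \<Otimes>\<^sub>M Om) Om"
proof -
  have "(\<lambda>p. (snd p)(x := fst p)) \<in> measurable (Q \<Otimes>\<^sub>M Om) (\<Pi>\<^sub>M x\<in>labels. Q)"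
  proof (rule measurable_fun_upd[where J=labels])
    show "labels = labels \<union> {x}" using assms by auto
    show "snd \<in> measurable (Q \<Otimes>\<^sub>M Om) (\<Pi>\<^sub>M x\<in>labels. Q)" unfolding Om_def by measurable
  qed measurable
  then show ?thesis by (simp add: Om_def case_prod_unfold)
qed

text \<open>The law of the family is unchanged if the data at one label are replaced by an independent copy. This
invariance replaces conditioning on the past of a vertex in all later arguments. It is the insertion
of one more coordinate into a product measure, applied to a label that is already present, so that its
old value is overwritten.\<close>

lemma distr_update:
  assumes "x \<in> labels" shows "distr (Q \<Otimes>\<^sub>M Om) Om (\<lambda>(y, w). w(x := y)) = Om"
proof -
  have "insert x labels = labels" using assms by auto
  then show ?thesis
    using distr_pair_PiM_eq_PiM[of labels "\<lambda>_. Q" x] Q.prob_space_axioms by (simp add: Om_def)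
qed

lemma nn_integral_resample:
  assumes x: "x \<in> labels" and f[measurable]: "f \<in> borel_measurable Om"
  shows "(\<integral>\<^sup>+w. f w \<partial>Om) = (\<integral>\<^sup>+w. \<integral>\<^sup>+y. f (w(x := y)) \<partial>Q \<partial>Om)"
proof -
  note m[measurable] = measurable_update[OF x]
  have f': "(\<lambda>(y, w). f (w(x := y))) \<in> borel_measurable (Q \<Otimes>\<^sub>M Om)"
    using measurable_compose[OF m f] by (simp add: case_prod_unfold)
  have "(\<integral>\<^sup>+w. f w \<partial>Om) = (\<integral>\<^sup>+w. f w \<partial>distr (Q \<Otimes>\<^sub>M Om) Om (\<lambda>(y, w). w(x := y)))"
    by (simp add: distr_update[OF x])
  also have "\<dots> = (\<integral>\<^sup>+(y, w). f (w(x := y)) \<partial>(Q \<Otimes>\<^sub>M Om))"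
    by (subst nn_integral_distr) (auto simp: case_prod_unfold)
  also have "\<dots> = (\<integral>\<^sup>+w. \<integral>\<^sup>+y. f (w(x := y)) \<partial>Q \<partial>Om)"
    using QOm.nn_integral_snd[OF f'] by simp
  finally show ?thesis .
qed

lemma integral_resample:
  fixes f :: "_ \<Rightarrow> real"
  assumes x: "x \<in> labels" and f: "integrable Om f"
  shows "(\<integral>w. f w \<partial>Om) = (\<integral>w. \<integral>y. f (w(x := y)) \<partial>Q \<partial>Om)"
proof -
  note m[measurable] = measurable_update[OF x]
  have fm[measurable]: "f \<in> borel_measurable Om" using f by auto
  have "integrable (distr (Q \<Otimes>\<^sub>M Om) Om (\<lambda>(y, w). w(x := y))) f"
    using f by (simp add: distr_update[OF x])
  then have i: "integrable (Q \<Otimes>\<^sub>M Om) (\<lambda>(y, w). f (w(x := y)))"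
    by (subst (asm) integrable_distr_eq) (auto simp: case_prod_unfold)
  have "(\<integral>w. f w \<partial>Om) = (\<integral>w. f w \<partial>distr (Q \<Otimes>\<^sub>M Om) Om (\<lambda>(y, w). w(x := y)))"
    by (simp add: distr_update[OF x])
  also have "\<dots> = (\<integral>(y, w). f (w(x := y)) \<partial>(Q \<Otimes>\<^sub>M Om))"
    by (subst integral_distr) (auto simp: case_prod_unfold)
  also have "\<dots> = (\<integral>w. \<integral>y. f (w(x := y)) \<partial>Q \<partial>Om)"
    using QOm.integral_snd[OF i] by simp
  finally show ?thesis .
qed

text \<open>One step of the von Bahr-Esseen inequality. The function \<open>g\<close> is centred given all labels except \<open>x\<close>, and \<open>f\<close>
ignores \<open>x\<close>; so the mixed term of \<open>abs_powr_add_le\<close> has integral $0$, as is seen by resampling \<open>x\<close>.\<close>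

lemma moment_add_resampled_le:
  fixes f g :: "_ \<Rightarrow> real"
  assumes x: "x \<in> labels" and q: "1 < q" "q \<le> 2"
    and f[measurable]: "f \<in> borel_measurable Om" and g[measurable]: "g \<in> borel_measurable Om"
    and fx: "\<And>w y. w \<in> space Om \<Longrightarrow> y \<in> space Q \<Longrightarrow> f (w(x := y)) = f w"
    and gx: "\<And>w. w \<in> space Om \<Longrightarrow> (\<integral>y. g (w(x := y)) \<partial>Q) = 0"
    and fq: "(\<integral>\<^sup>+w. ennreal (\<bar>f w\<bar> powr q) \<partial>Om) < \<infinity>"
    and gq: "(\<integral>\<^sup>+w. ennreal (\<bar>g w\<bar> powr q) \<partial>Om) < \<infinity>"
  shows "(\<integral>\<^sup>+w. ennreal (\<bar>f w + g w\<bar> powr q) \<partial>Om) \<le>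
    (\<integral>\<^sup>+w. ennreal (\<bar>f w\<bar> powr q) \<partial>Om) + ennreal (2 * q) * (\<integral>\<^sup>+w. ennreal (\<bar>g w\<bar> powr q) \<partial>Om)"
proof -
  define F where "F w = \<bar>f w\<bar> powr q" for w
  define G where "G w = \<bar>g w\<bar> powr q" for w
  define H where "H w = q * sgn (f w) * \<bar>f w\<bar> powr (q - 1) * g w" for w
  have [measurable]: "F \<in> borel_measurable Om" "G \<in> borel_measurable Om" "H \<in> borel_measurable Om"
    unfolding F_def G_def H_def by measurable
  have F: "integrable Om F" using fq by (intro integrableI_nonneg) (auto simp: F_def)
  have G: "integrable Om G" using gq by (intro integrableI_nonneg) (auto simp: G_def)
  have H: "integrable Om H"
  proof (rule Bochner_Integration.integrable_bound[of _ "\<lambda>w. q * (F w + G w)"])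
    show "integrable Om (\<lambda>w. q * (F w + G w))" using F G by auto
    show "AE w in Om. norm (H w) \<le> norm (q * (F w + G w))"
    proof (rule AE_I2)
      fix w
      have "\<bar>H w\<bar> \<le> q * (\<bar>f w\<bar> powr (q - 1) * \<bar>g w\<bar>)"
        using q by (auto simp: H_def abs_mult sgn_if)
      also have "\<dots> \<le> q * (F w + G w)"
        unfolding F_def G_def using q by (intro mult_left_mono powr_mult_le) auto
      finally show "norm (H w) \<le> norm (q * (F w + G w))"
        using q by (simp add: F_def G_def)
    qed
  qed simp
  have "(\<integral>w. H w \<partial>Om) = (\<integral>w. \<integral>y. H (w(x := y)) \<partial>Q \<partial>Om)"
    by (rule integral_resample[OF x H])
  also have "\<dots> = (\<integral>w. 0 \<partial>Om)"
  proof (rule Bochner_Integration.integral_cong[OF refl])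
    fix w assume w: "w \<in> space Om"
    have "(\<integral>y. H (w(x := y)) \<partial>Q) = (\<integral>y. q * sgn (f w) * \<bar>f w\<bar> powr (q - 1) * g (w(x := y)) \<partial>Q)"
      by (rule Bochner_Integration.integral_cong[OF refl]) (simp add: H_def fx[OF w])
    also have "\<dots> = q * sgn (f w) * \<bar>f w\<bar> powr (q - 1) * (\<integral>y. g (w(x := y)) \<partial>Q)"
      by (rule integral_mult_right_zero)
    finally show "(\<integral>y. H (w(x := y)) \<partial>Q) = 0" by (simp add: gx[OF w])
  qed
  finally have H0: "(\<integral>w. H w \<partial>Om) = 0" by simp
  have FGH: "integrable Om (\<lambda>w. F w + H w + 2 * q * G w)" using F G H by auto
  have "(\<integral>\<^sup>+w. ennreal (\<bar>f w + g w\<bar> powr q) \<partial>Om) \<le> (\<integral>\<^sup>+w. ennreal (F w + H w + 2 * q * G w) \<partial>Om)"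
    using abs_powr_add_le[OF q] by (intro nn_integral_mono ennreal_leI) (auto simp: F_def G_def H_def)
  also have "\<dots> = ennreal (\<integral>w. F w + H w + 2 * q * G w \<partial>Om)"
  proof (rule nn_integral_eq_integral[OF FGH], rule AE_I2)
    fix w
    show "0 \<le> F w + H w + 2 * q * G w"
      using abs_powr_add_le[OF q, of "f w" "g w"] powr_ge_zero[of "\<bar>f w + g w\<bar>" q]
      unfolding F_def G_def H_def by linarith
  qed
  also have "(\<integral>w. F w + H w + 2 * q * G w \<partial>Om) = (\<integral>w. F w \<partial>Om) + 2 * q * (\<integral>w. G w \<partial>Om)"
    using F G H H0 by simp
  also have "ennreal \<dots> = ennreal (\<integral>w. F w \<partial>Om) + ennreal (2 * q) * ennreal (\<integral>w. G w \<partial>Om)"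
    using q by (simp add: ennreal_plus ennreal_mult F_def G_def)
  also have "ennreal (\<integral>w. F w \<partial>Om) = (\<integral>\<^sup>+w. ennreal (F w) \<partial>Om)"
    by (rule nn_integral_eq_integral[symmetric, OF F]) (simp add: F_def)
  also have "ennreal (\<integral>w. G w \<partial>Om) = (\<integral>\<^sup>+w. ennreal (G w) \<partial>Om)"
    by (rule nn_integral_eq_integral[symmetric, OF G]) (simp add: G_def)
  finally show ?thesis by (simp add: F_def G_def)
qed

text \<open>Peeling off a label of maximal length makes the remaining partial sum independent of the data at
that label, so the previous lemma applies.\<close>

lemma moment_sum_le:
  fixes Z :: "nat list \<Rightarrow> _ \<Rightarrow> real"
  assumes q: "1 < q" "q \<le> 2"
    and Z: "\<And>x. x \<in> labels \<Longrightarrow> Z x \<in> borel_measurable Om"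
    and Zx: "\<And>x z w y. x \<in> labels \<Longrightarrow> z \<in> labels \<Longrightarrow> z \<noteq> x \<Longrightarrow> length z \<le> length x \<Longrightarrow>
       Z z (w(x := y)) = Z z w"
    and Z0: "\<And>x w. x \<in> labels \<Longrightarrow> w \<in> space Om \<Longrightarrow> (\<integral>y. Z x (w(x := y)) \<partial>Q) = 0"
    and Zq: "\<And>x. x \<in> labels \<Longrightarrow> (\<integral>\<^sup>+w. ennreal (\<bar>Z x w\<bar> powr q) \<partial>Om) < \<infinity>"
    and F: "finite F" "F \<subseteq> labels"
  shows "(\<integral>\<^sup>+w. ennreal (\<bar>\<Sum>x\<in>F. Z x w\<bar> powr q) \<partial>Om) \<le>
    ennreal (2 * q) * (\<Sum>x\<in>F. \<integral>\<^sup>+w. ennreal (\<bar>Z x w\<bar> powr q) \<partial>Om)"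
  using F
proof (induction F rule: finite_psubset_induct)
  case (psubset F)
  show ?case
  proof (cases "F = {}")
    case True
    then show ?thesis using q by simp
  next
    case False
    \<comment> \<open>No other label of $F$ is longer than $x$, so none has $x$ as a strict prefix.\<close>
    then obtain x where x: "x \<in> F" and max: "\<And>z. z \<in> F \<Longrightarrow> length z \<le> length x"
      using Max_in[of "length ` F"] Max_ge[of "length ` F"] psubset.hyps
      by (metis (no_types, lifting) finite_imageI image_iff image_is_empty)
    define F' where "F' = F - {x}"
    have F: "F = insert x F'" "x \<notin> F'" "finite F'" using x psubset.hyps by (auto simp: F'_def)
    have xl: "x \<in> labels" and F'l: "F' \<subseteq> labels" using x psubset.prems by (auto simp: F'_def)
    have IH: "(\<integral>\<^sup>+w. ennreal (\<bar>\<Sum>x\<in>F'. Z x w\<bar> powr q) \<partial>Om) \<le>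
        ennreal (2 * q) * (\<Sum>x\<in>F'. \<integral>\<^sup>+w. ennreal (\<bar>Z x w\<bar> powr q) \<partial>Om)"
      using x F'l by (intro psubset.IH) (auto simp: F'_def)
    also have "\<dots> < \<infinity>"
      using Zq F'l F(3) by (auto simp: ennreal_mult_less_top less_top subset_iff)
    finally have fin: "(\<integral>\<^sup>+w. ennreal (\<bar>\<Sum>x\<in>F'. Z x w\<bar> powr q) \<partial>Om) < \<infinity>" .
    have "(\<integral>\<^sup>+w. ennreal (\<bar>\<Sum>x\<in>F. Z x w\<bar> powr q) \<partial>Om) =
        (\<integral>\<^sup>+w. ennreal (\<bar>(\<Sum>x\<in>F'. Z x w) + Z x w\<bar> powr q) \<partial>Om)"
      using F by (simp add: add.commute)
    also have "\<dots> \<le> (\<integral>\<^sup>+w. ennreal (\<bar>\<Sum>x\<in>F'. Z x w\<bar> powr q) \<partial>Om) +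
        ennreal (2 * q) * (\<integral>\<^sup>+w. ennreal (\<bar>Z x w\<bar> powr q) \<partial>Om)"
    proof (rule moment_add_resampled_le[OF xl q _ Z[OF xl] _ Z0[OF xl] fin Zq[OF xl]])
      show "(\<lambda>w. \<Sum>x\<in>F'. Z x w) \<in> borel_measurable Om"
        using Z F'l by (intro borel_measurable_sum) auto
      show "(\<Sum>z\<in>F'. Z z (w(x := y))) = (\<Sum>z\<in>F'. Z z w)" for w y
        using F'l max by (intro sum.cong refl Zx xl) (auto simp: F'_def)
    qed
    also have "\<dots> \<le> ennreal (2 * q) * (\<Sum>x\<in>F'. \<integral>\<^sup>+w. ennreal (\<bar>Z x w\<bar> powr q) \<partial>Om) +
        ennreal (2 * q) * (\<integral>\<^sup>+w. ennreal (\<bar>Z x w\<bar> powr q) \<partial>Om)"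
      by (rule add_right_mono[OF IH])
    also have "\<dots> = ennreal (2 * q) * (\<Sum>x\<in>F. \<integral>\<^sup>+w. ennreal (\<bar>Z x w\<bar> powr q) \<partial>Om)"
      using F by (simp add: distrib_left add.commute)
    finally show ?thesis .
  qed
qed


section \<open>Moments of weights and birth times\<close>

text \<open>This is $1 + \Phi(\gamma)$ (see \<open>offspring_moment_mark\<close>), written as an integral with values in $[0,\infty]$.\<close>

definition offspring_moment :: "real \<Rightarrow> ennreal" where
  "offspring_moment \<gamma> = (\<integral>\<^sup>+m. (\<Sum>i=1..fst m. ennreal (snd (snd m) i powr \<gamma>)) \<partial>L)"

lemma AE_D_nonneg: "AE e in D. 0 \<le> e"
  unfolding D_def by (subst AE_density) (auto simp: erlang_density_def)

lemma nn_integral_D: "f \<in> borel_measurable borel \<Longrightarrow>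
    (\<integral>\<^sup>+e. f e \<partial>D) = (\<integral>\<^sup>+e. ennreal (exponential_density 1 e) * f e \<partial>lborel)"
  unfolding D_def by (subst nn_integral_density) auto

text \<open>Multiplying the exponential density of rate $1$ by $e^{-\theta e}$ gives, up to the factor $1/(1+\theta)$,
the exponential density of rate $1 + \theta$.\<close>

lemma nn_integral_exp_D:
  assumes "0 \<le> \<theta>"
  shows "(\<integral>\<^sup>+e. ennreal (exp (- \<theta> * e)) \<partial>D) = ennreal (1 / (1 + \<theta>))"
proof -
  interpret D': prob_space "density lborel (exponential_density (1 + \<theta>))"
    using assms by (intro prob_space_exponential_density) auto
  have *: "ennreal (exponential_density 1 e) * ennreal (exp (- \<theta> * e)) =
      ennreal (1 / (1 + \<theta>)) * ennreal (exponential_density (1 + \<theta>) e)" for e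
  proof (cases "e < 0")
    case False
    have "exp (- e) * exp (- \<theta> * e) = exp (- e * (1 + \<theta>))"
      by (simp add: exp_add[symmetric] algebra_simps)
    also have "\<dots> = 1 / (1 + \<theta>) * ((1 + \<theta>) * exp (- e * (1 + \<theta>)))"
      using assms by simp
    finally have "exp (- e) * exp (- \<theta> * e) = 1 / (1 + \<theta>) * ((1 + \<theta>) * exp (- e * (1 + \<theta>)))" .
    then show ?thesis
      using False assms by (simp add: exponential_density_def ennreal_mult[symmetric])
  qed (simp add: exponential_density_def)
  have "(\<integral>\<^sup>+e. ennreal (exp (- \<theta> * e)) \<partial>D) =
      (\<integral>\<^sup>+e. ennreal (1 / (1 + \<theta>)) * ennreal (exponential_density (1 + \<theta>) e) \<partial>lborel)"
    by (subst nn_integral_D, simp, simp only: *)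
  also have "\<dots> = ennreal (1 / (1 + \<theta>)) * (\<integral>\<^sup>+e. ennreal (exponential_density (1 + \<theta>) e) \<partial>lborel)"
    by (rule nn_integral_cmult) simp
  also have "(\<integral>\<^sup>+e. ennreal (exponential_density (1 + \<theta>) e) \<partial>lborel) = 1"
    using D'.emeasure_space_1 by (simp add: emeasure_density)
  finally show ?thesis by simp
qed

lemma nn_integral_Q_mult:
  assumes [measurable]: "f \<in> borel_measurable borel" "g \<in> borel_measurable L"
  shows "(\<integral>\<^sup>+y. f (fst y) * g (snd y) \<partial>Q) = (\<integral>\<^sup>+e. f e \<partial>D) * (\<integral>\<^sup>+m. g m \<partial>L)"
proof -
  have [measurable]: "f \<in> borel_measurable D" by measurable
  have "(\<integral>\<^sup>+y. f (fst y) * g (snd y) \<partial>Q) = (\<integral>\<^sup>+e. \<integral>\<^sup>+m. f e * g m \<partial>L \<partial>D)"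
    unfolding Q_def by (subst L.nn_integral_fst[symmetric]) auto
  also have "\<dots> = (\<integral>\<^sup>+e. f e * (\<integral>\<^sup>+m. g m \<partial>L) \<partial>D)"
    by (intro nn_integral_cong nn_integral_cmult) auto
  also have "\<dots> = (\<integral>\<^sup>+e. f e \<partial>D) * (\<integral>\<^sup>+m. g m \<partial>L)"
    by (rule nn_integral_multc) auto
  finally show ?thesis .
qed

lemma nn_integral_Q_fst:
  assumes "f \<in> borel_measurable borel" shows "(\<integral>\<^sup>+y. f (fst y) \<partial>Q) = (\<integral>\<^sup>+e. f e \<partial>D)"
  using nn_integral_Q_mult[OF assms, of "\<lambda>_. 1"] by (simp add: L.emeasure_space_1)

lemma nn_integral_Q_snd:
  assumes "g \<in> borel_measurable L" shows "(\<integral>\<^sup>+y. g (snd y) \<partial>Q) = (\<integral>\<^sup>+m. g m \<partial>L)"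
  using nn_integral_Q_mult[of "\<lambda>_. 1" g] assms by (simp add: D.emeasure_space_1)

lemma AE_Q_life_nonneg: "AE y in Q. 0 \<le> fst y"
proof -
  have "(\<integral>\<^sup>+y. indicator {..<0} (fst y) \<partial>Q) = (\<integral>\<^sup>+e. indicator {..<0} e \<partial>D)"
    by (rule nn_integral_Q_fst) simp
  also have "\<dots> = 0" using AE_D_nonneg
    by (subst nn_integral_0_iff_AE) (auto elim!: eventually_mono simp: indicator_def)
  finally show ?thesis
    by (subst (asm) nn_integral_0_iff_AE) (auto elim!: eventually_mono simp: indicator_def split: if_splits)
qed

lemma AE_life_nonneg: "AE w in Om. \<forall>x\<in>labels. 0 \<le> life w x"
proof (subst AE_ball_countable[OF countable_labels], intro ballI)
  fix x assume "x \<in> labels"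
  then show "AE w in Om. 0 \<le> life w x"
    unfolding Om_def using AE_PiM_component[of labels "\<lambda>_. Q" x "\<lambda>y. 0 \<le> fst y"] Q.prob_space_axioms AE_Q_life_nonneg by auto
qed

text \<open>The form in which independence of a vertex from its ancestors enters first moments.\<close>

lemma nn_integral_coord_mult:
  assumes x: "x \<in> labels" and [measurable]: "h \<in> borel_measurable Om" "f \<in> borel_measurable Q"
    and hx: "\<And>w y. w \<in> space Om \<Longrightarrow> y \<in> space Q \<Longrightarrow> h (w(x := y)) = h w"
  shows "(\<integral>\<^sup>+w. h w * f (w x) \<partial>Om) = (\<integral>\<^sup>+w. h w \<partial>Om) * (\<integral>\<^sup>+y. f y \<partial>Q)"
proof -
  note measurable_coord[OF x, measurable]
  have "(\<integral>\<^sup>+w. h w * f (w x) \<partial>Om) = (\<integral>\<^sup>+w. \<integral>\<^sup>+y. h (w(x := y)) * f ((w(x := y)) x) \<partial>Q \<partial>Om)"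
    by (rule nn_integral_resample[OF x]) measurable
  also have "\<dots> = (\<integral>\<^sup>+w. \<integral>\<^sup>+y. h w * f y \<partial>Q \<partial>Om)"
    by (intro nn_integral_cong) (simp add: hx)
  also have "\<dots> = (\<integral>\<^sup>+w. h w * (\<integral>\<^sup>+y. f y \<partial>Q) \<partial>Om)"
    by (intro nn_integral_cong nn_integral_cmult) auto
  also have "\<dots> = (\<integral>\<^sup>+w. h w \<partial>Om) * (\<integral>\<^sup>+y. f y \<partial>Q)"
    by (rule nn_integral_multc) auto
  finally show ?thesis .
qed

definition discounted_moment :: "real \<Rightarrow> real \<Rightarrow> nat list \<Rightarrow> ennreal" where
  "discounted_moment \<theta> \<gamma> x = (\<integral>\<^sup>+w. ennreal (wt w x powr \<gamma> * exp (- \<theta> * birth (life w) x)) \<partial>Om)"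

lemma discounted_moment_Nil: "discounted_moment \<theta> \<gamma> [] = 1"
  by (simp add: discounted_moment_def Om.emeasure_space_1)

lemma nn_integral_discounted_mult:
  assumes x: "x \<in> labels" and f: "f \<in> borel_measurable Q"
  shows "(\<integral>\<^sup>+w. ennreal (wt w x powr \<gamma> * exp (- \<theta> * birth (life w) x)) * f (w x) \<partial>Om) =
    discounted_moment \<theta> \<gamma> x * (\<integral>\<^sup>+y. f y \<partial>Q)"
  unfolding discounted_moment_def
proof (rule nn_integral_coord_mult[OF x _ f, where h="\<lambda>w. ennreal (wt w x powr \<gamma> * exp (- \<theta> * birth (life w) x))"])
  note [measurable] = measurable_wt[OF x] measurable_birth[OF x]
  show "(\<lambda>w. ennreal (wt w x powr \<gamma> * exp (- \<theta> * birth (life w) x))) \<in> borel_measurable Om" by measurable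
  show "ennreal (wt (w(x := y)) x powr \<gamma> * exp (- \<theta> * birth (life (w(x := y))) x)) =
      ennreal (wt w x powr \<gamma> * exp (- \<theta> * birth (life w) x))" for w y
    by (simp only: wt_update[OF x order_refl] birth_update[OF x order_refl])
qed

text \<open>Weight and birth time of a child arise from those of the parent $x$ by the data at $x$ alone, so the
discounted moments are multiplicative along ancestral lines.\<close>

lemma discounted_moment_snoc:
  assumes x: "x \<in> labels" and \<theta>: "0 \<le> \<theta>"
  shows "discounted_moment \<theta> \<gamma> (x @ [i]) = discounted_moment \<theta> \<gamma> x *
    (ennreal (1 / (1 + \<theta>)) * (\<integral>\<^sup>+m. ennreal (child_weight \<gamma> i m) \<partial>L))"
proof -
  note [measurable] = measurable_wt[OF x] measurable_birth[OF x]
  have "discounted_moment \<theta> \<gamma> (x @ [i]) =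
      (\<integral>\<^sup>+w. ennreal (wt w x powr \<gamma> * exp (- \<theta> * birth (life w) x)) *
         (ennreal (exp (- \<theta> * fst (w x))) * ennreal (child_weight \<gamma> i (snd (w x)))) \<partial>Om)"
    unfolding discounted_moment_def
  proof (rule nn_integral_cong)
    fix w assume w: "w \<in> space Om"
    have "exp (- \<theta> * birth (life w) (x @ [i])) = exp (- \<theta> * birth (life w) x) * exp (- \<theta> * fst (w x))"
      by (simp add: death_def distrib_left exp_add[symmetric])
    then have "wt w (x @ [i]) powr \<gamma> * exp (- \<theta> * birth (life w) (x @ [i])) =
        (wt w x powr \<gamma> * exp (- \<theta> * birth (life w) x)) *
        (exp (- \<theta> * fst (w x)) * child_weight \<gamma> i (snd (w x)))"
      by (simp add: wt_snoc[OF w x])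
    then show "ennreal (wt w (x @ [i]) powr \<gamma> * exp (- \<theta> * birth (life w) (x @ [i]))) =
        ennreal (wt w x powr \<gamma> * exp (- \<theta> * birth (life w) x)) *
        (ennreal (exp (- \<theta> * fst (w x))) * ennreal (child_weight \<gamma> i (snd (w x))))"
      by (simp only: ennreal_mult' ennreal_mult mult_nonneg_nonneg powr_ge_zero exp_ge_zero child_weight_nonneg)
  qed
  also have "\<dots> = discounted_moment \<theta> \<gamma> x *
      (\<integral>\<^sup>+y. ennreal (exp (- \<theta> * fst y)) * ennreal (child_weight \<gamma> i (snd y)) \<partial>Q)"
    by (rule nn_integral_discounted_mult[OF x, of "\<lambda>y. ennreal (exp (- \<theta> * fst y)) * ennreal (child_weight \<gamma> i (snd y))"]) measurable
  also have "(\<integral>\<^sup>+y. ennreal (exp (- \<theta> * fst y)) * ennreal (child_weight \<gamma> i (snd y)) \<partial>Q) =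
      (\<integral>\<^sup>+e. ennreal (exp (- \<theta> * e)) \<partial>D) * (\<integral>\<^sup>+m. ennreal (child_weight \<gamma> i m) \<partial>L)"
    by (rule nn_integral_Q_mult[where f="\<lambda>e. ennreal (exp (- \<theta> * e))" and g="\<lambda>m. ennreal (child_weight \<gamma> i m)"]) measurable
  finally show ?thesis by (simp only: nn_integral_exp_D[OF \<theta>])
qed

lemma sum_child_weight_le:
  "(\<Sum>i=1..n. \<integral>\<^sup>+m. ennreal (child_weight \<gamma> i m) \<partial>L) \<le> offspring_moment \<gamma>"
proof -
  have "(\<Sum>i=1..n. \<integral>\<^sup>+m. ennreal (child_weight \<gamma> i m) \<partial>L) = (\<integral>\<^sup>+m. (\<Sum>i=1..n. ennreal (child_weight \<gamma> i m)) \<partial>L)"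
    by (subst nn_integral_sum) auto
  also have "\<dots> \<le> offspring_moment \<gamma>"
    unfolding offspring_moment_def
  proof (rule nn_integral_mono)
    fix m :: "nat \<times> real \<times> (nat \<Rightarrow> real)"
    have "(\<Sum>i=1..n. ennreal (child_weight \<gamma> i m)) = (\<Sum>i\<in>{1..n} \<inter> {1..fst m}. ennreal (snd (snd m) i powr \<gamma>))"
      by (rule sum.mono_neutral_cong_right) (auto simp: child_weight_def)
    also have "\<dots> \<le> (\<Sum>i=1..fst m. ennreal (snd (snd m) i powr \<gamma>))"
      by (rule sum_mono2) auto
    finally show "(\<Sum>i=1..n. ennreal (child_weight \<gamma> i m)) \<le> \<dots>" .
  qed
  finally show ?thesis .
qed

lemma discounted_moment_finite:
  assumes "offspring_moment \<gamma> < \<infinity>" "0 \<le> \<theta>" "x \<in> labels"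
  shows "discounted_moment \<theta> \<gamma> x < \<infinity>"
  using assms(3)
proof (induction x rule: rev_induct)
  case Nil
  then show ?case by (simp add: discounted_moment_Nil)
next
  case (snoc i x)
  then have x: "x \<in> labels" and i: "1 \<le> i" by (auto simp: snoc_in_labels_iff)
  have "(\<integral>\<^sup>+m. ennreal (child_weight \<gamma> i m) \<partial>L) \<le> (\<Sum>i=1..i. \<integral>\<^sup>+m. ennreal (child_weight \<gamma> i m) \<partial>L)"
    using i by (intro member_le_sum) auto
  also have "\<dots> \<le> offspring_moment \<gamma>" by (rule sum_child_weight_le)
  finally have "(\<integral>\<^sup>+m. ennreal (child_weight \<gamma> i m) \<partial>L) < \<infinity>" using assms(1) by simp
  then show ?case
    using snoc.IH[OF x] by (simp add: discounted_moment_snoc[OF x assms(2)] ennreal_mult_less_top)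
qed

text \<open>By \<open>discounted_moment_snoc\<close> the sum $T$ over a box satisfies $T \le 1 + \varrho\,T$ with
$\varrho = m/(1+\theta) < 1$. Since $T$ is finite, $T \le 1/(1-\varrho)$, uniformly in the box; this
yields the geometric series without splitting the labels into generations.\<close>

lemma sum_discounted_moment_le:
  assumes m: "offspring_moment \<gamma> = ennreal m" "0 \<le> m" and \<theta>: "0 \<le> \<theta>" "m < 1 + \<theta>"
  shows "(\<integral>\<^sup>+x. discounted_moment \<theta> \<gamma> x \<partial>count_space labels) \<le> ennreal (1 / (1 - m / (1 + \<theta>)))"
proof (rule nn_integral_labels_le)
  fix n
  let ?S = "\<Sum>x\<in>label_box n. discounted_moment \<theta> \<gamma> x"
  define \<rho> where "\<rho> = m / (1 + \<theta>)"
  have \<rho>: "0 \<le> \<rho>" "\<rho> < 1" using m \<theta> by (auto simp: \<rho>_def)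
  have fin: "?S < \<infinity>"
    using discounted_moment_finite[of \<gamma> \<theta>] m \<theta>(1) label_box_subset[of n] finite_label_box[of n] by (auto simp: subset_iff)
  then obtain T where T: "?S = ennreal T" "0 \<le> T"
    by (cases ?S) auto
  have "?S \<le> discounted_moment \<theta> \<gamma> [] + (\<Sum>x\<in>label_box n. \<Sum>i=1..n. discounted_moment \<theta> \<gamma> (x @ [i]))"
    by (rule sum_label_box_le)
  also have "\<dots> = 1 + (\<Sum>x\<in>label_box n. discounted_moment \<theta> \<gamma> x *
      (ennreal (1 / (1 + \<theta>)) * (\<Sum>i=1..n. \<integral>\<^sup>+m. ennreal (child_weight \<gamma> i m) \<partial>L)))"
  proof -
    have "(\<Sum>i=1..n. discounted_moment \<theta> \<gamma> (x @ [i])) = discounted_moment \<theta> \<gamma> x *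
      (ennreal (1 / (1 + \<theta>)) * (\<Sum>i=1..n. \<integral>\<^sup>+m. ennreal (child_weight \<gamma> i m) \<partial>L))" if "x \<in> label_box n" for x
      using that label_box_subset discounted_moment_snoc[OF _ \<theta>(1)] by (auto simp: sum_distrib_left subset_iff)
    then show ?thesis by (simp add: discounted_moment_Nil)
  qed
  also have "\<dots> \<le> 1 + (\<Sum>x\<in>label_box n. discounted_moment \<theta> \<gamma> x * (ennreal (1 / (1 + \<theta>)) * ennreal m))"
    using sum_child_weight_le[where \<gamma>=\<gamma>] m by (intro add_left_mono sum_mono mult_left_mono) auto
  also have "\<dots> = 1 + ?S * ennreal \<rho>"
    using m \<theta> by (simp add: sum_distrib_right \<rho>_def ennreal_mult[symmetric])
  also have "\<dots> = ennreal (1 + T * \<rho>)"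
    using T \<rho> by (simp add: ennreal_mult ennreal_plus)
  finally have "ennreal T \<le> ennreal (1 + T * \<rho>)" by (simp add: T)
  then have "T \<le> 1 + T * \<rho>" using T \<rho> by (subst (asm) ennreal_le_iff) auto
  then have "T \<le> 1 / (1 - \<rho>)" using \<rho> by (simp add: field_simps)
  then show "?S \<le> ennreal (1 / (1 - m / (1 + \<theta>)))"
    unfolding T(1) \<rho>_def by (rule ennreal_leI)
qed

lemma tree_sum_discounted_le:
  assumes m: "offspring_moment \<gamma> = ennreal m" "0 \<le> m" and \<theta>: "0 \<le> \<theta>" "m < 1 + \<theta>"
    and f: "f \<in> borel_measurable Q"
  shows "(\<integral>\<^sup>+x. \<integral>\<^sup>+w. ennreal (wt w x powr \<gamma> * exp (- \<theta> * birth (life w) x)) * f (w x) \<partial>Om \<partial>count_space labels) \<le>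
    ennreal (1 / (1 - m / (1 + \<theta>))) * (\<integral>\<^sup>+y. f y \<partial>Q)"
proof -
  have "(\<integral>\<^sup>+x. \<integral>\<^sup>+w. ennreal (wt w x powr \<gamma> * exp (- \<theta> * birth (life w) x)) * f (w x) \<partial>Om \<partial>count_space labels) =
      (\<integral>\<^sup>+x. discounted_moment \<theta> \<gamma> x * (\<integral>\<^sup>+y. f y \<partial>Q) \<partial>count_space labels)"
  proof (rule nn_integral_cong)
    fix x assume "x \<in> space (count_space labels)"
    then have x: "x \<in> labels" by simp
    show "(\<integral>\<^sup>+w. ennreal (wt w x powr \<gamma> * exp (- \<theta> * birth (life w) x)) * f (w x) \<partial>Om) =
        discounted_moment \<theta> \<gamma> x * (\<integral>\<^sup>+y. f y \<partial>Q)"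
      by (rule nn_integral_discounted_mult[OF x f])
  qed
  also have "\<dots> = (\<integral>\<^sup>+x. discounted_moment \<theta> \<gamma> x \<partial>count_space labels) * (\<integral>\<^sup>+y. f y \<partial>Q)"
    by (rule nn_integral_multc) simp
  also have "\<dots> \<le> ennreal (1 / (1 - m / (1 + \<theta>))) * (\<integral>\<^sup>+y. f y \<partial>Q)"
    by (intro mult_right_mono sum_discounted_moment_le m \<theta>) simp
  finally show ?thesis .
qed

text \<open>Chernoff's bound $1\{B(x) \le t\} \le e^{\theta t} e^{-\theta B(x)}$ makes the law of the birth times,
a sum of exponential variables, irrelevant. If $\Phi(\gamma) \ge 0$, the growth rate
$e^{\Phi(\gamma) t}$ is missed by an arbitrarily small exponent only.\<close>

lemma tree_sum_born_le:
  assumes m: "offspring_moment \<gamma> = ennreal m" "0 \<le> m" and \<theta>: "0 \<le> \<theta>" "m < 1 + \<theta>"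
    and f: "f \<in> borel_measurable Q"
  shows "(\<integral>\<^sup>+x. \<integral>\<^sup>+w. ennreal (wt w x powr \<gamma> * (if birth (life w) x \<le> t then 1 else 0)) * f (w x) \<partial>Om \<partial>count_space labels) \<le>
    ennreal (exp (\<theta> * t) / (1 - m / (1 + \<theta>))) * (\<integral>\<^sup>+y. f y \<partial>Q)"
proof -
  have pt: "ennreal (wt w x powr \<gamma> * (if birth (life w) x \<le> t then 1 else 0)) * f (w x) \<le>
      ennreal (exp (\<theta> * t)) * (ennreal (wt w x powr \<gamma> * exp (- \<theta> * birth (life w) x)) * f (w x))" for x w
  proof -
    have "(if birth (life w) x \<le> t then 1 else 0) \<le> exp (\<theta> * t) * exp (- \<theta> * birth (life w) x)"
      using \<theta>(1) by (auto simp: exp_add[symmetric] right_diff_distrib[symmetric])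
    then have "wt w x powr \<gamma> * (if birth (life w) x \<le> t then 1 else 0) \<le>
        wt w x powr \<gamma> * (exp (\<theta> * t) * exp (- \<theta> * birth (life w) x))"
      by (rule mult_left_mono) simp
    then have "ennreal (wt w x powr \<gamma> * (if birth (life w) x \<le> t then 1 else 0)) \<le>
        ennreal (exp (\<theta> * t)) * ennreal (wt w x powr \<gamma> * exp (- \<theta> * birth (life w) x))"
      by (subst ennreal_mult[symmetric]) (auto intro!: ennreal_leI simp: mult_ac)
    then show ?thesis unfolding mult.assoc[symmetric] by (rule mult_right_mono) simp
  qed
  have "(\<integral>\<^sup>+x. \<integral>\<^sup>+w. ennreal (wt w x powr \<gamma> * (if birth (life w) x \<le> t then 1 else 0)) * f (w x) \<partial>Om \<partial>count_space labels) \<le>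
     (\<integral>\<^sup>+x. \<integral>\<^sup>+w. ennreal (exp (\<theta> * t)) * (ennreal (wt w x powr \<gamma> * exp (- \<theta> * birth (life w) x)) * f (w x)) \<partial>Om \<partial>count_space labels)"
    by (intro nn_integral_mono pt)
  also have "\<dots> = ennreal (exp (\<theta> * t)) *
      (\<integral>\<^sup>+x. \<integral>\<^sup>+w. ennreal (wt w x powr \<gamma> * exp (- \<theta> * birth (life w) x)) * f (w x) \<partial>Om \<partial>count_space labels)"
  proof (subst nn_integral_cmult[symmetric], simp, rule nn_integral_cong)
    fix x assume "x \<in> space (count_space labels)"
    then have x: "x \<in> labels" by simp
    note [measurable] = measurable_wt[OF x] measurable_birth[OF x] measurable_coord[OF x] f
    show "(\<integral>\<^sup>+w. ennreal (exp (\<theta> * t)) * (ennreal (wt w x powr \<gamma> * exp (- \<theta> * birth (life w) x)) * f (w x)) \<partial>Om) =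
        ennreal (exp (\<theta> * t)) * (\<integral>\<^sup>+w. ennreal (wt w x powr \<gamma> * exp (- \<theta> * birth (life w) x)) * f (w x) \<partial>Om)"
      by (rule nn_integral_cmult) measurable
  qed
  also have "\<dots> \<le> ennreal (exp (\<theta> * t)) * (ennreal (1 / (1 - m / (1 + \<theta>))) * (\<integral>\<^sup>+y. f y \<partial>Q))"
    by (intro mult_left_mono tree_sum_discounted_le assms) simp
  also have "\<dots> = ennreal (exp (\<theta> * t) / (1 - m / (1 + \<theta>))) * (\<integral>\<^sup>+y. f y \<partial>Q)"
    using m \<theta> by (simp add: mult.assoc[symmetric] ennreal_mult[symmetric])
  finally show ?thesis .
qed

section \<open>Compensated costs\<close>

text \<open>For a vertex of age $u$ the cost at death, compensated by $c$ times the time lived up to age $u$.\<close>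

definition innovation :: "real \<Rightarrow> real \<Rightarrow> vertex_data \<Rightarrow> real" where
  "innovation c u y = (if fst y \<le> u then fst (snd (snd y)) else 0) - c * min (fst y) u"

lemma measurable_innovation [measurable]:
  "(\<lambda>(u, y). innovation c u y) \<in> borel_measurable (borel \<Otimes>\<^sub>M Q)"
  unfolding innovation_def by measurable

text \<open>Both sides equal $\int_0^u {\bf P}[E > s]\,ds$: for the unit exponential law the tail ${\bf P}[E > s]$ is the
density at $s$. This is the compensation formula for a death at rate one.\<close>

lemma nn_integral_min_D:
  assumes "0 \<le> u"
  shows "(\<integral>\<^sup>+e. ennreal (min e u) \<partial>D) = emeasure D {..u}"
proof -
  have tail: "emeasure D {s<..} = ennreal (exp (- s))" if "0 \<le> s" for s
  proof -
    have "emeasure D {..s} = ennreal (1 - exp (- s))"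
      using that by (simp add: D_def emeasure_erlang_density erlang_CDF_0)
    then have "D.prob {..s} = 1 - exp (- s)"
      using that by (simp add: D.emeasure_eq_measure)
    moreover have "{s<..} = space D - {..s}" using sets_eq_imp_space_eq[OF sets_D] by auto
    ultimately have "D.prob {s<..} = exp (- s)"
      by (simp add: D.prob_compl sets_D)
    then show ?thesis by (simp add: D.emeasure_eq_measure)
  qed
  have "(\<integral>\<^sup>+e. ennreal (min e u) \<partial>D) = (\<integral>\<^sup>+e. (\<integral>\<^sup>+s. indicator {0..u} s * indicator {s<..} e \<partial>lborel) \<partial>D)"
  proof (rule nn_integral_cong_AE, use AE_D_nonneg in eventually_elim)
    fix e :: real assume e: "0 \<le> e"
    have "(\<integral>\<^sup>+s. indicator {0..u} s * indicator {s<..} e \<partial>lborel) = (\<integral>\<^sup>+s. indicator ({0..u} \<inter> {..<e}) s \<partial>lborel)"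
      by (intro nn_integral_cong) (auto simp: indicator_def)
    also have "\<dots> = emeasure lborel ({0..u} \<inter> {..<e})" by simp
    also have "{0..u} \<inter> {..<e} = (if e \<le> u then {0..<e} else {0..u})" by auto
    also have "emeasure lborel (if e \<le> u then {0..<e} else {0..u}) = ennreal (min e u)"
      using e assms by (auto simp: min_def)
    finally show "ennreal (min e u) = (\<integral>\<^sup>+s. indicator {0..u} s * indicator {s<..} e \<partial>lborel)" by simp
  qed
  also have "\<dots> = (\<integral>\<^sup>+s. (\<integral>\<^sup>+e. indicator {0..u} s * indicator {s<..} e \<partial>D) \<partial>lborel)"
  proof -
    interpret pair_sigma_finite D lborel ..
    have "(\<lambda>p. indicator {0..u} (snd p) * (if snd p < fst p then 1 else 0) :: ennreal) \<in> borel_measurable (D \<Otimes>\<^sub>M lborel)"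
      by measurable
    also have "(\<lambda>p. indicator {0..u} (snd p) * (if snd p < fst p then 1 else 0) :: ennreal) =
       (\<lambda>(e, s). indicator {0..u} s * indicator {s<..} e)"
      by (auto simp: fun_eq_iff indicator_def)
    finally show ?thesis
      by (rule Fubini'[symmetric, where f="\<lambda>e s. indicator {0..u} s * indicator {s<..} e"])
  qed
  also have "\<dots> = (\<integral>\<^sup>+s. indicator {0..u} s * ennreal (exp (- s)) \<partial>lborel)"
  proof (rule nn_integral_cong)
    fix s :: real
    have "(\<integral>\<^sup>+e. indicator {0..u} s * indicator {s<..} e \<partial>D) = indicator {0..u} s * emeasure D {s<..}"
      by (subst nn_integral_cmult) (auto simp: sets_D)
    then show "(\<integral>\<^sup>+e. indicator {0..u} s * indicator {s<..} e \<partial>D) = indicator {0..u} s * ennreal (exp (- s))"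
      using tail[of s] by (auto simp: indicator_def)
  qed
  also have "\<dots> = (\<integral>\<^sup>+s. ennreal (exponential_density 1 s) * indicator {..u} s \<partial>lborel)"
    by (intro nn_integral_cong) (auto simp: indicator_def exponential_density_def)
  also have "\<dots> = emeasure D {..u}"
    unfolding D_def by (subst emeasure_density) auto
  finally show ?thesis .
qed

lemma nn_integral_life_powr_finite:
  assumes "0 \<le> q" "q \<le> 2"
  shows "(\<integral>\<^sup>+e. ennreal (\<bar>e\<bar> powr q) \<partial>D) < \<infinity>"
proof -
  have "(\<integral>\<^sup>+e. ennreal (\<bar>e\<bar> powr q) \<partial>D) \<le> (\<integral>\<^sup>+e. 1 + ennreal (e ^ 2) \<partial>D)"
  proof (rule nn_integral_mono)
    fix e :: real
    have "\<bar>e\<bar> powr q \<le> 1 + \<bar>e\<bar> powr 2" using assms by (intro powr_le_one_plus) auto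
    then have "\<bar>e\<bar> powr q \<le> 1 + e ^ 2" by (cases "e = 0") auto
    then have "ennreal (\<bar>e\<bar> powr q) \<le> ennreal (1 + e ^ 2)" by (rule ennreal_leI)
    then show "ennreal (\<bar>e\<bar> powr q) \<le> 1 + ennreal (e ^ 2)" by simp
  qed
  also have "\<dots> = 1 + (\<integral>\<^sup>+e. ennreal (e ^ 2) \<partial>D)"
    by (subst nn_integral_add) (auto simp: D.emeasure_space_1)
  also have "(\<integral>\<^sup>+e. ennreal (e ^ 2) \<partial>D) = (\<integral>\<^sup>+e. ennreal (exponential_density 1 e * e ^ 2) \<partial>lborel)"
    by (subst nn_integral_D) (auto simp: ennreal_mult exponential_density_nonneg)
  also have "\<dots> = 2" by (subst nn_integral_erlang_ith_moment) (auto simp: eval_nat_numeral)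
  finally show ?thesis by (simp add: order_le_less_trans[OF _ ennreal_less_top[of 3]])
qed


lemma innovation_mean:
  assumes Ci: "integrable L (\<lambda>m. fst (snd m))" and c: "c = (\<integral>m. fst (snd m) \<partial>L)" and u: "0 \<le> u"
  shows "(\<integral>y. innovation c u y \<partial>Q) = 0"
proof -
  have "(\<integral>\<^sup>+y. ennreal \<bar>fst (snd (snd y))\<bar> \<partial>Q) = (\<integral>\<^sup>+m. ennreal \<bar>fst (snd m)\<bar> \<partial>L)"
    by (rule nn_integral_Q_snd[where g="\<lambda>m. ennreal \<bar>fst (snd m)\<bar>"]) measurable
  also have "\<dots> < \<infinity>" using Ci by (simp add: integrable_iff_bounded)
  finally have "integrable Q (\<lambda>y. fst (snd (snd y)))"
    by (intro integrableI_bounded) auto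
  then have i1: "integrable Q (\<lambda>y. if fst y \<le> u then fst (snd (snd y)) else 0)"
    by (rule Bochner_Integration.integrable_bound) auto
  have "(\<integral>y. (if fst y \<le> u then fst (snd (snd y)) else 0) \<partial>Q) =
      (\<integral>e. (\<integral>m. (if e \<le> u then fst (snd m) else 0) \<partial>L) \<partial>D)"
    using DL.integral_fst'[OF i1[unfolded Q_def]] by (simp only: Q_def fst_conv snd_conv)
  also have "\<dots> = (\<integral>e. c * indicator {..u} e \<partial>D)"
    by (rule Bochner_Integration.integral_cong[OF refl]) (simp add: c indicator_def)
  also have "\<dots> = c * D.prob {..u}" by (simp add: sets_D)
  finally have e1: "(\<integral>y. (if fst y \<le> u then fst (snd (snd y)) else 0) \<partial>Q) = c * D.prob {..u}" .
  have b: "AE y in Q. 0 \<le> min (fst y) u"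
    using AE_Q_life_nonneg by eventually_elim (use u in auto)
  have i2: "integrable Q (\<lambda>y. min (fst y) u)"
    by (rule Q.integrable_const_bound[where B=u]) (use AE_Q_life_nonneg u in \<open>auto elim!: eventually_mono\<close>)
  have "ennreal (\<integral>y. min (fst y) u \<partial>Q) = (\<integral>\<^sup>+y. ennreal (min (fst y) u) \<partial>Q)"
    by (rule nn_integral_eq_integral[OF i2 b, symmetric])
  also have "\<dots> = (\<integral>\<^sup>+e. ennreal (min e u) \<partial>D)"
    by (rule nn_integral_Q_fst[where f="\<lambda>e. ennreal (min e u)"]) measurable
  also have "\<dots> = ennreal (D.prob {..u})"
    by (simp add: nn_integral_min_D[OF u] D.emeasure_eq_measure)
  finally have e2: "(\<integral>y. min (fst y) u \<partial>Q) = D.prob {..u}"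
    using integral_nonneg_AE[OF b] by simp
  show ?thesis
    unfolding innovation_def using i1 i2 e1 e2 by simp
qed

text \<open>A bound for the $q$-th power of the innovation that does not depend on the age $u$.\<close>

definition innovation_bound :: "real \<Rightarrow> real \<Rightarrow> vertex_data \<Rightarrow> real" where
  "innovation_bound q c y = 2 powr q * (\<bar>fst (snd (snd y))\<bar> powr q + \<bar>c\<bar> powr q * \<bar>fst y\<bar> powr q)"

lemma innovation_powr_le:
  assumes "0 \<le> q" "0 \<le> fst y" "0 \<le> u"
  shows "\<bar>innovation c u y\<bar> powr q \<le> innovation_bound q c y"
proof -
  have "\<bar>innovation c u y\<bar> powr q \<le> \<bar>\<bar>fst (snd (snd y))\<bar> + \<bar>c\<bar> * fst y\<bar> powr q"
  proof (rule powr_mono2)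
    have "\<bar>c * min (fst y) u\<bar> \<le> \<bar>c\<bar> * fst y"
      using assms by (auto simp: abs_mult intro!: mult_left_mono)
    then show "\<bar>innovation c u y\<bar> \<le> \<bar>\<bar>fst (snd (snd y))\<bar> + \<bar>c\<bar> * fst y\<bar>"
      unfolding innovation_def by (auto split: if_splits)
  qed (use assms in auto)
  also have "\<dots> \<le> 2 powr q * (\<bar>\<bar>fst (snd (snd y))\<bar>\<bar> powr q + \<bar>\<bar>c\<bar> * fst y\<bar> powr q)"
    by (rule abs_add_powr_le) (rule assms)
  finally show ?thesis using assms by (simp add: innovation_bound_def abs_mult powr_mult)
qed

lemma nn_integral_innovation_bound_finite:
  assumes q: "1 < q" "q \<le> 2" and Cq: "(\<integral>\<^sup>+m. ennreal (\<bar>fst (snd m)\<bar> powr q) \<partial>L) < \<infinity>"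
  shows "(\<integral>\<^sup>+y. ennreal (innovation_bound q c y) \<partial>Q) < \<infinity>"
proof -
  have "(\<integral>\<^sup>+y. ennreal (innovation_bound q c y) \<partial>Q) =
    (\<integral>\<^sup>+y. ennreal (2 powr q) * (ennreal (\<bar>fst (snd (snd y))\<bar> powr q) + ennreal (\<bar>c\<bar> powr q) * ennreal (\<bar>fst y\<bar> powr q)) \<partial>Q)"
    by (intro nn_integral_cong) (simp add: innovation_bound_def ennreal_mult)
  also have "\<dots> = ennreal (2 powr q) * ((\<integral>\<^sup>+y. ennreal (\<bar>fst (snd (snd y))\<bar> powr q) \<partial>Q) +
      ennreal (\<bar>c\<bar> powr q) * (\<integral>\<^sup>+y. ennreal (\<bar>fst y\<bar> powr q) \<partial>Q))"
    by (subst nn_integral_cmult, measurable, subst nn_integral_add, measurable, subst nn_integral_cmult, measurable)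
  also have "(\<integral>\<^sup>+y. ennreal (\<bar>fst (snd (snd y))\<bar> powr q) \<partial>Q) = (\<integral>\<^sup>+m. ennreal (\<bar>fst (snd m)\<bar> powr q) \<partial>L)"
    by (rule nn_integral_Q_snd[where g="\<lambda>m. ennreal (\<bar>fst (snd m)\<bar> powr q)"]) measurable
  also have "(\<integral>\<^sup>+y. ennreal (\<bar>fst y\<bar> powr q) \<partial>Q) = (\<integral>\<^sup>+e. ennreal (\<bar>e\<bar> powr q) \<partial>D)"
    by (rule nn_integral_Q_fst[where f="\<lambda>e. ennreal (\<bar>e\<bar> powr q)"]) measurable
  finally show ?thesis
    using Cq nn_integral_life_powr_finite[of q] q by (simp add: ennreal_mult_less_top)
qed

text \<open>Realizations for which every sum over the vertices born up to a given time that occurs below converges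
absolutely, for all times at once.\<close>

definition regular :: "(nat list \<Rightarrow> vertex_data) \<Rightarrow> bool" where
  "regular w \<longleftrightarrow> (\<forall>x\<in>labels. 0 \<le> life w x) \<and>
     (\<forall>t. (\<integral>\<^sup>+x. ennreal (wt w x * (if birth (life w) x \<le> t then 1 else 0) * (1 + \<bar>life w x\<bar> + \<bar>cost w x\<bar>))
        \<partial>count_space labels) < \<infinity>)"

text \<open>The first moment bound with $\gamma = 1$ and $\theta = m$ settles integer times, and the summands increase in
the time.\<close>

lemma AE_regular:
  assumes m: "offspring_moment 1 = ennreal m" "0 \<le> m" and Ci: "integrable L (\<lambda>m. fst (snd m))"
  shows "AE w in Om. regular w"
proof -
  define f where "f y = ennreal (1 + \<bar>fst y\<bar> + \<bar>fst (snd (snd y))\<bar>)" for y :: vertex_data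
  have [measurable]: "f \<in> borel_measurable Q" unfolding f_def by measurable
  have "(\<integral>\<^sup>+y. f y \<partial>Q) = (\<integral>\<^sup>+y. 1 + ennreal \<bar>fst y\<bar> + ennreal \<bar>fst (snd (snd y))\<bar> \<partial>Q)"
    by (simp add: f_def)
  also have "\<dots> = 1 + (\<integral>\<^sup>+y. ennreal \<bar>fst y\<bar> \<partial>Q) + (\<integral>\<^sup>+y. ennreal \<bar>fst (snd (snd y))\<bar> \<partial>Q)"
    by (subst nn_integral_add, measurable, subst nn_integral_add, measurable) (simp add: Q.emeasure_space_1)
  also have "(\<integral>\<^sup>+y. ennreal \<bar>fst (snd (snd y))\<bar> \<partial>Q) = (\<integral>\<^sup>+m. ennreal \<bar>fst (snd m)\<bar> \<partial>L)"
    by (rule nn_integral_Q_snd[where g="\<lambda>m. ennreal \<bar>fst (snd m)\<bar>"]) measurable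
  also have "(\<integral>\<^sup>+y. ennreal \<bar>fst y\<bar> \<partial>Q) = (\<integral>\<^sup>+e. ennreal \<bar>e\<bar> \<partial>D)"
    by (rule nn_integral_Q_fst[where f="\<lambda>e. ennreal \<bar>e\<bar>"]) measurable
  finally have ff: "(\<integral>\<^sup>+y. f y \<partial>Q) < \<infinity>"
    using Ci nn_integral_life_powr_finite[of 1] by (simp add: integrable_iff_bounded)
  let ?g = "\<lambda>t x w. ennreal (wt w x * (if birth (life w) x \<le> t then 1 else 0) * (1 + \<bar>life w x\<bar> + \<bar>cost w x\<bar>))"
  have gm: "?g t x \<in> borel_measurable Om" if x: "x \<in> labels" for t x
  proof -
    note [measurable] = measurable_wt[OF x] measurable_birth[OF x] measurable_life[OF x] measurable_cost[OF x]
    show ?thesis by measurable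
  qed
  have "AE w in Om. (\<integral>\<^sup>+x. ?g (real n) x w \<partial>count_space labels) \<noteq> \<infinity>" for n
  proof (rule AE_nn_integral_count_space_finite[OF countable_labels gm])
    have "(\<integral>\<^sup>+x. \<integral>\<^sup>+w. ?g (real n) x w \<partial>Om \<partial>count_space labels) =
        (\<integral>\<^sup>+x. \<integral>\<^sup>+w. ennreal (wt w x powr 1 * (if birth (life w) x \<le> real n then 1 else 0)) * f (w x) \<partial>Om \<partial>count_space labels)"
      by (intro nn_integral_cong) (simp add: f_def ennreal_mult[symmetric] del: ennreal_plus)
    also have "\<dots> \<le> ennreal (exp (m * real n) / (1 - m / (1 + m))) * (\<integral>\<^sup>+y. f y \<partial>Q)"
      using m by (intro tree_sum_born_le) auto
    also have "\<dots> < \<infinity>" using ff by (simp add: ennreal_mult_less_top)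
    finally show "(\<integral>\<^sup>+x. \<integral>\<^sup>+w. ?g (real n) x w \<partial>Om \<partial>count_space labels) < \<infinity>" .
  qed
  then have "AE w in Om. \<forall>n. (\<integral>\<^sup>+x. ?g (real n) x w \<partial>count_space labels) \<noteq> \<infinity>"
    by (subst AE_all_countable) auto
  then show ?thesis
    using AE_life_nonneg
  proof eventually_elim
    case (elim w)
    have "(\<integral>\<^sup>+x. ?g t x w \<partial>count_space labels) < \<infinity>" for t
    proof -
      obtain n where n: "t \<le> real n" using real_arch_simple by blast
      have "(\<integral>\<^sup>+x. ?g t x w \<partial>count_space labels) \<le> (\<integral>\<^sup>+x. ?g (real n) x w \<partial>count_space labels)"
        using n by (intro nn_integral_mono ennreal_leI mult_right_mono mult_left_mono) auto
      also have "\<dots> < \<infinity>" using elim(1) by (auto simp: top.not_eq_extremum)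
      finally show ?thesis .
    qed
    then show ?case using elim(2) by (simp add: regular_def)
  qed
qed

lemma regular_integrable:
  assumes w: "regular w" and a: "\<And>x. x \<in> labels \<Longrightarrow> birth (life w) x \<le> t \<Longrightarrow> \<bar>a x\<bar> \<le> K * (1 + \<bar>life w x\<bar> + \<bar>cost w x\<bar>)"
  shows "integrable (count_space labels) (\<lambda>x. wt w x * (if birth (life w) x \<le> t then a x else 0))"
proof (rule Bochner_Integration.integrable_bound)
  let ?g = "\<lambda>x. wt w x * (if birth (life w) x \<le> t then 1 else 0) * (1 + \<bar>life w x\<bar> + \<bar>cost w x\<bar>)"
  have "integrable (count_space labels) ?g"
    using w by (intro integrableI_nonneg) (auto simp: regular_def AE_count_space)
  then show "integrable (count_space labels) (\<lambda>x. K * ?g x)" by simp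
  show "AE x in count_space labels. norm (wt w x * (if birth (life w) x \<le> t then a x else 0)) \<le> norm (K * ?g x)"
  proof (unfold AE_count_space, safe)
    fix x assume x: "x \<in> labels"
    show "norm (wt w x * (if birth (life w) x \<le> t then a x else 0)) \<le> norm (K * ?g x)"
    proof (cases "birth (life w) x \<le> t")
      case True
      have "wt w x * \<bar>a x\<bar> \<le> wt w x * (K * (1 + \<bar>life w x\<bar> + \<bar>cost w x\<bar>))"
        by (rule mult_left_mono[OF a[OF x True]]) simp
      also have "\<dots> \<le> \<bar>K * (wt w x * (1 + \<bar>life w x\<bar> + \<bar>cost w x\<bar>))\<bar>" by (simp add: mult_ac)
      finally show ?thesis using True by (simp add: abs_mult)
    qed simp
  qed
qed simp

text \<open>The difference between $C_t$ and $c \int_0^t Y_s\,ds$; see \<open>regular_cost_decomposition\<close>.\<close>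

definition deviation :: "real \<Rightarrow> real \<Rightarrow> (nat list \<Rightarrow> vertex_data) \<Rightarrow> real" where
  "deviation c t w = (\<Sum>\<^sub>\<infinity>x\<in>labels. wt w x *
     (if birth (life w) x \<le> t then innovation c (t - birth (life w) x) (w x) else 0))"

lemma measurable_innovation_summand:
  assumes x: "x \<in> labels"
  shows "(\<lambda>w. wt w x * (if birth (life w) x \<le> t then innovation c (t - birth (life w) x) (w x) else 0)) \<in> borel_measurable Om"
proof -
  note [measurable] = measurable_wt[OF x] measurable_birth[OF x] measurable_coord[OF x]
  have [measurable]: "(\<lambda>w. innovation c (t - birth (life w) x) (w x)) \<in> borel_measurable Om"
    using measurable_compose[OF measurable_Pair[of "\<lambda>w. t - birth (life w) x" Om borel "\<lambda>w. w x" Q] measurable_innovation[of c]] by simp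
  show ?thesis by measurable
qed

lemma measurable_deviation [measurable]: "deviation c t \<in> borel_measurable Om"
  unfolding deviation_def[abs_def]
  by (rule borel_measurable_infsum[OF countable_labels measurable_innovation_summand])

lemma innovation_abs_le:
  assumes "0 \<le> fst y" "0 \<le> u"
  shows "\<bar>innovation c u y\<bar> \<le> (1 + \<bar>c\<bar>) * (1 + \<bar>fst y\<bar> + \<bar>fst (snd (snd y))\<bar>)"
proof -
  have 1: "\<bar>c * min (fst y) u\<bar> \<le> \<bar>c\<bar> * fst y"
    using assms by (auto simp: abs_mult intro!: mult_left_mono)
  have "\<bar>innovation c u y\<bar> \<le> \<bar>fst (snd (snd y))\<bar> + \<bar>c\<bar> * fst y"
    using 1 unfolding innovation_def by (auto split: if_splits)
  also have "\<dots> \<le> (1 + \<bar>c\<bar>) * (1 + \<bar>fst y\<bar> + \<bar>fst (snd (snd y))\<bar>)"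
    using assms by (simp add: algebra_simps)
  finally show ?thesis .
qed

lemma regular_birth_nonneg: "regular w \<Longrightarrow> x \<in> labels \<Longrightarrow> 0 \<le> birth (life w) x"
  by (rule birth_nonneg) (auto simp: regular_def)

lemma integrable_innovation_summand:
  assumes "regular w"
  shows "integrable (count_space labels)
     (\<lambda>x. wt w x * (if birth (life w) x \<le> t then innovation c (t - birth (life w) x) (w x) else 0))"
proof (rule regular_integrable[OF assms, where K="1 + \<bar>c\<bar>"])
  fix x assume "x \<in> labels" "birth (life w) x \<le> t"
  with assms show "\<bar>innovation c (t - birth (life w) x) (w x)\<bar> \<le> (1 + \<bar>c\<bar>) * (1 + \<bar>life w x\<bar> + \<bar>cost w x\<bar>)"
    by (intro innovation_abs_le) (auto simp: regular_def)
qed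

text \<open>The von Bahr-Esseen inequality for the sums over boxes of labels, combined with the first moment bound for
$w(x)^q$; Fatou's lemma carries the bound over to the sum over all labels.\<close>

lemma deviation_moment_le:
  assumes q: "1 < q" "q \<le> 2"
    and m: "offspring_moment q = ennreal m" "0 \<le> m" and \<theta>: "0 \<le> \<theta>" "m < 1 + \<theta>"
    and m1: "offspring_moment 1 = ennreal m1" "0 \<le> m1"
    and Ci: "integrable L (\<lambda>m. fst (snd m))" and c: "c = (\<integral>m. fst (snd m) \<partial>L)"
    and Cq: "(\<integral>\<^sup>+m. ennreal (\<bar>fst (snd m)\<bar> powr q) \<partial>L) < \<infinity>"
  obtains K where "0 \<le> K" "\<And>t. 0 \<le> t \<Longrightarrow>
    (\<integral>\<^sup>+w. ennreal (\<bar>deviation c t w\<bar> powr q) \<partial>Om) \<le> ennreal (K * exp (\<theta> * t))"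
proof -
  obtain G where G: "(\<integral>\<^sup>+y. ennreal (innovation_bound q c y) \<partial>Q) = ennreal G" "0 \<le> G"
    using nn_integral_innovation_bound_finite[OF q Cq, of c]
    by (cases "\<integral>\<^sup>+y. ennreal (innovation_bound q c y) \<partial>Q") auto
  define r where "r = 1 - m / (1 + \<theta>)"
  have r: "0 < r" using m \<theta> by (simp add: r_def)
  have "(\<integral>\<^sup>+w. ennreal (\<bar>deviation c t w\<bar> powr q) \<partial>Om) \<le> ennreal (2 * q / r * G * exp (\<theta> * t))" if t: "0 \<le> t" for t
  proof -
    define Z where "Z x w = wt w x * (if birth (life w) x \<le> t then innovation c (t - birth (life w) x) (w x) else 0)" for x w
    have Zm: "Z x \<in> borel_measurable Om" if "x \<in> labels" for x
      unfolding Z_def by (rule measurable_innovation_summand[OF that])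
    have Zle: "(\<integral>\<^sup>+w. ennreal (\<bar>Z x w\<bar> powr q) \<partial>Om) \<le>
       (\<integral>\<^sup>+w. ennreal (wt w x powr q * (if birth (life w) x \<le> t then 1 else 0)) * ennreal (innovation_bound q c (w x)) \<partial>Om)"
      if x: "x \<in> labels" for x
    proof (rule nn_integral_mono_AE, use AE_life_nonneg in eventually_elim)
      fix w assume w: "\<forall>x\<in>labels. 0 \<le> life w x"
      show "ennreal (\<bar>Z x w\<bar> powr q) \<le> ennreal (wt w x powr q * (if birth (life w) x \<le> t then 1 else 0)) * ennreal (innovation_bound q c (w x))"
      proof (cases "birth (life w) x \<le> t")
        case True
        have "\<bar>Z x w\<bar> powr q = wt w x powr q * \<bar>innovation c (t - birth (life w) x) (w x)\<bar> powr q"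
          using True by (simp add: Z_def abs_mult powr_mult)
        also have "\<dots> \<le> wt w x powr q * innovation_bound q c (w x)"
          using q w x True by (intro mult_left_mono innovation_powr_le) auto
        finally show ?thesis
          using True by (simp add: ennreal_mult'[symmetric] ennreal_leI)
      qed (use q in \<open>simp add: Z_def\<close>)
    qed
    have "(\<integral>\<^sup>+x. \<integral>\<^sup>+w. ennreal (\<bar>Z x w\<bar> powr q) \<partial>Om \<partial>count_space labels) \<le>
       (\<integral>\<^sup>+x. \<integral>\<^sup>+w. ennreal (wt w x powr q * (if birth (life w) x \<le> t then 1 else 0)) * ennreal (innovation_bound q c (w x)) \<partial>Om \<partial>count_space labels)"
      by (rule nn_integral_mono) (use Zle in auto)
    also have "\<dots> \<le> ennreal (exp (\<theta> * t) / (1 - m / (1 + \<theta>))) * (\<integral>\<^sup>+y. ennreal (innovation_bound q c y) \<partial>Q)"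
      by (rule tree_sum_born_le[OF m \<theta>]) (simp add: innovation_bound_def[abs_def])
    also have "\<dots> = ennreal (exp (\<theta> * t) / r * G)"
      using r G unfolding r_def[symmetric] by (simp add: ennreal_mult[symmetric])
    finally have tot: "(\<integral>\<^sup>+x. \<integral>\<^sup>+w. ennreal (\<bar>Z x w\<bar> powr q) \<partial>Om \<partial>count_space labels) \<le> ennreal (exp (\<theta> * t) / r * G)" .
    have part: "(\<Sum>x\<in>F. \<integral>\<^sup>+w. ennreal (\<bar>Z x w\<bar> powr q) \<partial>Om) \<le> ennreal (exp (\<theta> * t) / r * G)"
      if "finite F" "F \<subseteq> labels" for F
      using sum_le_nn_integral_count_space[OF that] tot by (rule order_trans)
    have box: "(\<integral>\<^sup>+w. ennreal (\<bar>\<Sum>x\<in>label_box n. Z x w\<bar> powr q) \<partial>Om) \<le> ennreal (2 * q / r * G * exp (\<theta> * t))" for n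
    proof -
      have "(\<integral>\<^sup>+w. ennreal (\<bar>\<Sum>x\<in>label_box n. Z x w\<bar> powr q) \<partial>Om) \<le>
          ennreal (2 * q) * (\<Sum>x\<in>label_box n. \<integral>\<^sup>+w. ennreal (\<bar>Z x w\<bar> powr q) \<partial>Om)"
      proof (rule moment_sum_le[OF q Zm _ _ _ finite_label_box label_box_subset])
        fix x z and w :: "nat list \<Rightarrow> vertex_data" and y assume "x \<in> labels" and z: "z \<in> labels" "z \<noteq> x" "length z \<le> length x"
        have "(w(x := y)) z = w z" using z by simp
        then show "Z z (w(x := y)) = Z z w"
          unfolding Z_def wt_update[OF z(1,3)] birth_update[OF z(1,3)] by (simp only:)
      next
        fix x w assume x: "x \<in> labels" and w: "w \<in> space Om"
        show "(\<integral>y. Z x (w(x := y)) \<partial>Q) = 0"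
          unfolding Z_def wt_update[OF x order_refl] birth_update[OF x order_refl]
          using innovation_mean[OF Ci c, of "t - birth (life w) x"]
          by (cases "birth (life w) x \<le> t") simp_all
      next
        fix x assume "x \<in> labels"
        then show "(\<integral>\<^sup>+w. ennreal (\<bar>Z x w\<bar> powr q) \<partial>Om) < \<infinity>"
          using part[of "{x}"] by (simp add: order_le_less_trans[OF _ ennreal_less_top])
      qed
      also have "\<dots> \<le> ennreal (2 * q) * ennreal (exp (\<theta> * t) / r * G)"
        by (rule mult_left_mono[OF part[OF finite_label_box label_box_subset]]) simp
      also have "\<dots> = ennreal (2 * q / r * G * exp (\<theta> * t))"
        using q r G by (simp add: ennreal_mult[symmetric] mult_ac)
      finally show ?thesis .
    qed
    have "(\<integral>\<^sup>+w. ennreal (\<bar>deviation c t w\<bar> powr q) \<partial>Om) =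
        (\<integral>\<^sup>+w. liminf (\<lambda>n. ennreal (\<bar>\<Sum>x\<in>label_box n. Z x w\<bar> powr q)) \<partial>Om)"
    proof (rule nn_integral_cong_AE, use AE_regular[OF m1 Ci] in eventually_elim)
      fix w assume w: "regular w"
      have "(\<lambda>x. Z x w) summable_on labels"
        unfolding summable_on_iff_integrable_count_space Z_def by (rule integrable_innovation_summand[OF w])
      then have "((\<lambda>x. Z x w) has_sum deviation c t w) labels"
        unfolding deviation_def Z_def by (rule has_sum_infsum)
      then have "(\<lambda>n. \<Sum>x\<in>label_box n. Z x w) \<longlonglongrightarrow> deviation c t w"
        unfolding has_sum_def by (rule filterlim_compose[OF _ filterlim_label_box])
      then have "(\<lambda>n. ennreal (\<bar>\<Sum>x\<in>label_box n. Z x w\<bar> powr q)) \<longlonglongrightarrow> ennreal (\<bar>deviation c t w\<bar> powr q)"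
        using q by (intro tendsto_ennrealI tendsto_powr' tendsto_rabs tendsto_const) auto
      then show "ennreal (\<bar>deviation c t w\<bar> powr q) = liminf (\<lambda>n. ennreal (\<bar>\<Sum>x\<in>label_box n. Z x w\<bar> powr q))"
        by (intro lim_imp_Liminf[symmetric]) auto
    qed
    also have "\<dots> \<le> liminf (\<lambda>n. \<integral>\<^sup>+w. ennreal (\<bar>\<Sum>x\<in>label_box n. Z x w\<bar> powr q) \<partial>Om)"
    proof (rule nn_integral_liminf)
      fix n
      have [measurable]: "(\<lambda>w. \<Sum>x\<in>label_box n. Z x w) \<in> borel_measurable Om"
        using Zm label_box_subset by (intro borel_measurable_sum) auto
      show "(\<lambda>w. ennreal (\<bar>\<Sum>x\<in>label_box n. Z x w\<bar> powr q)) \<in> borel_measurable Om" by measurable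
    qed
    also have "\<dots> \<le> limsup (\<lambda>n. \<integral>\<^sup>+w. ennreal (\<bar>\<Sum>x\<in>label_box n. Z x w\<bar> powr q) \<partial>Om)"
      by (rule Liminf_le_Limsup) simp
    also have "\<dots> \<le> ennreal (2 * q / r * G * exp (\<theta> * t))"
      by (rule Limsup_bounded) (use box in auto)
    finally show ?thesis .
  qed
  then show ?thesis using that[of "2 * q / r * G"] q r G by auto
qed

text \<open>Tonelli's theorem: a vertex of weight $w(x)$ contributes $w(x)$ times the length of the part of its life
that falls into $[0,t]$.\<close>

lemma regular_total_weight:
  assumes w: "regular w"
  shows "set_integrable lborel {0..t} (total_weight w)"
    and "(LINT s:{0..t}|lborel. total_weight w s) =
      (\<Sum>\<^sub>\<infinity>x\<in>labels. wt w x * (if birth (life w) x \<le> t then min (life w x) (t - birth (life w) x) else 0))"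
proof -
  let ?a = "\<lambda>x s. wt w x * (if birth (life w) x \<le> s \<and> s < death (life w) x then 1 else 0)"
  let ?m = "\<lambda>x. wt w x * (if birth (life w) x \<le> t then min (life w x) (t - birth (life w) x) else 0)"
  have nn: "0 \<le> life w x" if "x \<in> labels" for x using w that by (auto simp: regular_def)
  have ai: "integrable (count_space labels) (\<lambda>x. ?a x s)" for s
  proof -
    have "integrable (count_space labels) (\<lambda>x. wt w x * (if birth (life w) x \<le> s then (if s < death (life w) x then 1 else 0) else 0))"
      by (rule regular_integrable[OF w, where K=1]) auto
    moreover have "(\<lambda>x. ?a x s) = (\<lambda>x. wt w x * (if birth (life w) x \<le> s then (if s < death (life w) x then 1 else 0) else 0))"
      by auto
    ultimately show ?thesis by simp
  qed
  have mi: "integrable (count_space labels) ?m"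
    by (rule regular_integrable[OF w, where K=1]) (auto dest: nn)
  have m0: "AE x in count_space labels. 0 \<le> ?m x"
    by (auto simp: AE_count_space dest: nn)
  have pm[measurable]: "total_weight w \<in> borel_measurable borel"
    unfolding population_weight_def[abs_def] by (rule borel_measurable_infsum) auto
  have p: "ennreal (total_weight w s) = (\<integral>\<^sup>+x. ennreal (?a x s) \<partial>count_space labels)" for s
    unfolding population_weight_def infsum_eq_integral_count_space
    by (rule nn_integral_eq_integral[OF ai, symmetric]) (auto simp: AE_count_space)
  have p0: "0 \<le> total_weight w s" for s
    unfolding population_weight_def by (rule infsum_nonneg) simp
  have "(\<integral>\<^sup>+s. ennreal (indicator {0..t} s * total_weight w s) \<partial>lborel) =
      (\<integral>\<^sup>+s. \<integral>\<^sup>+x. indicator {0..t} s * ennreal (?a x s) \<partial>count_space labels \<partial>lborel)"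
    by (rule nn_integral_cong) (simp add: ennreal_mult p0 p nn_integral_cmult ennreal_indicator)
  also have "\<dots> = (\<integral>\<^sup>+x. \<integral>\<^sup>+s. indicator {0..t} s * ennreal (?a x s) \<partial>lborel \<partial>count_space labels)"
    by (rule nn_integral_count_space_nn_integral) auto
  also have "\<dots> = (\<integral>\<^sup>+x. ennreal (?m x) \<partial>count_space labels)"
  proof (rule nn_integral_cong)
    fix x assume "x \<in> space (count_space labels)"
    then have x: "x \<in> labels" by simp
    let ?b = "birth (life w) x" and ?e = "life w x"
    have be: "0 \<le> ?b" "0 \<le> ?e" using regular_birth_nonneg[OF w x] nn[OF x] by auto
    have "(\<integral>\<^sup>+s. indicator {0..t} s * ennreal (?a x s) \<partial>lborel) =
        (\<integral>\<^sup>+s. ennreal (wt w x) * indicator ({0..t} \<inter> {?b..<?b + ?e}) s \<partial>lborel)"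
      by (rule nn_integral_cong) (auto simp: indicator_def death_def)
    also have "\<dots> = ennreal (wt w x) * emeasure lborel ({0..t} \<inter> {?b..<?b + ?e})"
      by (rule nn_integral_cmult_indicator) auto
    also have "{0..t} \<inter> {?b..<?b + ?e} = (if ?b \<le> t then (if ?b + ?e \<le> t then {?b..<?b + ?e} else {?b..t}) else {})"
      using be by auto
    also have "emeasure lborel \<dots> = ennreal (if ?b \<le> t then min ?e (t - ?b) else 0)"
      using be by (auto simp: min_def)
    also have "ennreal (wt w x) * \<dots> = ennreal (?m x)"
      by (rule ennreal_mult'[symmetric]) simp
    finally show "(\<integral>\<^sup>+s. indicator {0..t} s * ennreal (?a x s) \<partial>lborel) = ennreal (?m x)" .
  qed
  also have "\<dots> = ennreal (\<integral>x. ?m x \<partial>count_space labels)"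
    by (rule nn_integral_eq_integral[OF mi m0])
  finally have eq: "(\<integral>\<^sup>+s. ennreal (indicator {0..t} s * total_weight w s) \<partial>lborel) = ennreal (\<integral>x. ?m x \<partial>count_space labels)" .
  have int: "integrable lborel (\<lambda>s. indicator {0..t} s * total_weight w s)"
    by (rule integrableI_nonneg) (auto simp: eq p0)
  then show "set_integrable lborel {0..t} (total_weight w)"
    by (simp add: set_integrable_def)
  have "ennreal (\<integral>s. indicator {0..t} s * total_weight w s \<partial>lborel) = ennreal (\<integral>x. ?m x \<partial>count_space labels)"
    using eq by (subst nn_integral_eq_integral[OF int, symmetric]) (auto simp: p0)
  then have "(\<integral>s. indicator {0..t} s * total_weight w s \<partial>lborel) = (\<integral>x. ?m x \<partial>count_space labels)"
    using integral_nonneg_AE[OF m0] by (subst (asm) ennreal_inj) (auto simp: p0)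
  then show "(LINT s:{0..t}|lborel. total_weight w s) = infsum ?m labels"
    by (simp add: set_lebesgue_integral_def infsum_eq_integral_count_space)
qed

lemma regular_cost_decomposition:
  assumes w: "regular w"
  shows "(\<Sum>\<^sub>\<infinity>x\<in>labels. wt w x * (if death (life w) x \<le> t then cost w x else 0)) =
    c * (LINT s:{0..t}|lborel. total_weight w s) + deviation c t w"
proof -
  have nn: "0 \<le> life w x" if "x \<in> labels" for x using w that by (auto simp: regular_def)
  let ?m = "\<lambda>x. wt w x * (if birth (life w) x \<le> t then min (life w x) (t - birth (life w) x) else 0)"
  have mi: "integrable (count_space labels) ?m"
    by (rule regular_integrable[OF w, where K=1]) (auto dest: nn)
  have "(\<Sum>\<^sub>\<infinity>x\<in>labels. wt w x * (if death (life w) x \<le> t then cost w x else 0)) =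
      (\<integral>x. c * ?m x + wt w x * (if birth (life w) x \<le> t then innovation c (t - birth (life w) x) (w x) else 0) \<partial>count_space labels)"
    unfolding infsum_eq_integral_count_space
  proof (rule Bochner_Integration.integral_cong[OF refl])
    fix x assume "x \<in> space (count_space labels)"
    then have "0 \<le> life w x" using nn by simp
    then show "wt w x * (if death (life w) x \<le> t then cost w x else 0) =
        c * ?m x + wt w x * (if birth (life w) x \<le> t then innovation c (t - birth (life w) x) (w x) else 0)"
      by (auto simp: death_def innovation_def algebra_simps)
  qed
  also have "\<dots> = c * (\<integral>x. ?m x \<partial>count_space labels) + deviation c t w"
    unfolding deviation_def infsum_eq_integral_count_space
    using mi integrable_innovation_summand[OF w, of t c] by simp
  finally show ?thesis by (simp add: regular_total_weight(2)[OF w] infsum_eq_integral_count_space)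
qed

end

section \<open>The total cost and its fixed point equation\<close>

definition subtree :: "nat \<Rightarrow> (nat list \<Rightarrow> vertex_data) \<Rightarrow> nat list \<Rightarrow> vertex_data" where
  "subtree k w = (\<lambda>x\<in>labels. w (k # x))"

definition total_cost :: "(nat list \<Rightarrow> vertex_data) \<Rightarrow> real" where
  "total_cost w = (\<Sum>\<^sub>\<infinity>x\<in>labels. wt w x * cost w x)"

lemma Cons_in_labels_iff: "k # x \<in> labels \<longleftrightarrow> 1 \<le> k \<and> x \<in> labels"
  by (auto simp: labels_def)

lemma wt_Cons:
  assumes "x \<in> labels"
  shows "wt w (k # x) =
    (if 1 \<le> k \<and> k \<le> kids w [] then exp (ln (factor w [] k)) else 0) * wt (subtree k w) x"
  using assms
proof (induction x rule: rev_induct)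
  case Nil
  show ?case using weight_snoc[of "kids w" "factor w" "[]" k] by simp
next
  case (snoc i x)
  then have x: "x \<in> labels" by (simp add: snoc_in_labels_iff)
  have "wt w (k # x @ [i]) = wt w (k # x) * (if 1 \<le> i \<and> i \<le> kids w (k # x) then exp (ln (factor w (k # x) i)) else 0)"
    using weight_snoc[of "kids w" "factor w" "k # x" i] by simp
  moreover have "subtree k w x = w (k # x)" using x by (simp add: subtree_def)
  ultimately show ?case
    by (simp add: snoc.IH[OF x] weight_snoc)
qed

text \<open>Every label other than the root lies in exactly one subtree, and only the subtrees of the finitely many
children of the root carry weight.\<close>

lemma total_cost_recursion:
  assumes pos: "\<And>k. 1 \<le> k \<Longrightarrow> 0 < factor w [] k"
    and sub: "\<And>k. 1 \<le> k \<Longrightarrow> (\<lambda>x. wt (subtree k w) x * cost (subtree k w) x) summable_on labels"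
  shows "total_cost w = (\<Sum>k=1..kids w []. factor w [] k * total_cost (subtree k w)) + cost w []"
proof -
  let ?f = "\<lambda>x. wt w x * cost w x"
  let ?n = "kids w []"
  let ?B = "\<lambda>k. (#) k ` labels"
  have each: "(?f has_sum (factor w [] k * total_cost (subtree k w))) (?B k)" if k: "k \<in> {1..?n}" for k
  proof -
    have "((\<lambda>x. factor w [] k * (wt (subtree k w) x * cost (subtree k w) x)) has_sum
        (factor w [] k * total_cost (subtree k w))) labels"
      unfolding total_cost_def using sub k by (intro has_sum_cmult_right has_sum_infsum) auto
    also have "?this \<longleftrightarrow> ((?f \<circ> (#) k) has_sum (factor w [] k * total_cost (subtree k w))) labels"
    proof (rule has_sum_cong)
      fix x assume x: "x \<in> labels"
      show "factor w [] k * (wt (subtree k w) x * cost (subtree k w) x) = (?f \<circ> (#) k) x"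
        using pos[of k] k by (simp add: wt_Cons[OF x]) (use x in \<open>simp add: subtree_def\<close>)
    qed
    finally show ?thesis by (subst has_sum_reindex) (auto simp: inj_on_def)
  qed
  have "(?f has_sum (\<Sum>k\<in>{1..?n}. factor w [] k * total_cost (subtree k w))) (\<Union>k\<in>{1..?n}. ?B k)"
    by (rule has_sum_finite_UN[OF _ each]) (auto simp: disjoint_family_on_def)
  moreover have "(?f has_sum cost w []) {[]}"
    using has_sum_finite[of "{[]}" ?f] by simp
  ultimately have "(?f has_sum ((\<Sum>k\<in>{1..?n}. factor w [] k * total_cost (subtree k w)) + cost w []))
      ((\<Union>k\<in>{1..?n}. ?B k) \<union> {[]})"
    by (rule has_sum_Un_disjoint) auto
  also have "?this \<longleftrightarrow> (?f has_sum ((\<Sum>k\<in>{1..?n}. factor w [] k * total_cost (subtree k w)) + cost w [])) labels"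
  proof (rule has_sum_cong_neutral)
    fix x assume x: "x \<in> labels - ((\<Union>k\<in>{1..?n}. ?B k) \<union> {[]})"
    then obtain k z where kz: "x = k # z" "z \<in> labels" by (cases x) (auto simp: Cons_in_labels_iff)
    then have "\<not> (1 \<le> k \<and> k \<le> ?n)" using x by auto
    then show "?f x = 0" using kz by (simp only: wt_Cons[OF kz(2)]) simp
  qed (auto simp: Cons_in_labels_iff)
  finally show ?thesis unfolding total_cost_def by (rule infsumI)
qed

context marked_tree
begin

text \<open>With $\theta = 0$ the geometric series of \<open>tree_sum_discounted_le\<close> has ratio $m = 1 + \Phi(1) < 1$.\<close>

lemma AE_summable_cost:
  assumes m: "offspring_moment 1 = ennreal m" "0 \<le> m" "m < 1" and Ci: "integrable L (\<lambda>m. fst (snd m))"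
  shows "AE w in Om. integrable (count_space labels) (\<lambda>x. wt w x * cost w x)"
proof -
  let ?g = "\<lambda>x w. ennreal (norm (wt w x * cost w x))"
  have gm: "?g x \<in> borel_measurable Om" if x: "x \<in> labels" for x
  proof -
    note [measurable] = measurable_wt[OF x] measurable_cost[OF x]
    show ?thesis by measurable
  qed
  have "AE w in Om. (\<integral>\<^sup>+x. ?g x w \<partial>count_space labels) \<noteq> \<infinity>"
  proof (rule AE_nn_integral_count_space_finite[OF countable_labels gm])
    have "(\<integral>\<^sup>+x. \<integral>\<^sup>+w. ?g x w \<partial>Om \<partial>count_space labels) =
        (\<integral>\<^sup>+x. \<integral>\<^sup>+w. ennreal (wt w x powr 1 * exp (- 0 * birth (life w) x)) * ennreal \<bar>fst (snd (snd (w x)))\<bar> \<partial>Om \<partial>count_space labels)"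
      by (intro nn_integral_cong) (simp add: ennreal_mult[symmetric] abs_mult)
    also have "\<dots> \<le> ennreal (1 / (1 - m / (1 + 0))) * (\<integral>\<^sup>+y. ennreal \<bar>fst (snd (snd y))\<bar> \<partial>Q)"
      using m by (intro tree_sum_discounted_le) auto
    also have "(\<integral>\<^sup>+y. ennreal \<bar>fst (snd (snd y))\<bar> \<partial>Q) = (\<integral>\<^sup>+m. ennreal \<bar>fst (snd m)\<bar> \<partial>L)"
      by (rule nn_integral_Q_snd[where g="\<lambda>m. ennreal \<bar>fst (snd m)\<bar>"]) measurable
    also have "ennreal (1 / (1 - m / (1 + 0))) * \<dots> < \<infinity>"
      using Ci by (simp add: integrable_iff_bounded ennreal_mult_less_top)
    finally show "(\<integral>\<^sup>+x. \<integral>\<^sup>+w. ?g x w \<partial>Om \<partial>count_space labels) < \<infinity>" .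
  qed
  then show ?thesis
    by eventually_elim (simp add: integrable_iff_bounded top.not_eq_extremum)
qed

lemma measurable_total_cost [measurable]: "total_cost \<in> borel_measurable Om"
  unfolding total_cost_def[abs_def]
proof (rule borel_measurable_infsum)
  fix x assume x: "x \<in> labels"
  note [measurable] = measurable_wt[OF x] measurable_cost[OF x]
  show "(\<lambda>w. wt w x * cost w x) \<in> borel_measurable Om" by measurable
qed simp

lemma cost_up_to_tendsto_total_cost:
  assumes "integrable (count_space labels) (\<lambda>x. wt w x * cost w x)"
  shows "((\<lambda>t. \<Sum>\<^sub>\<infinity>x\<in>labels. wt w x * (if death (life w) x \<le> t then cost w x else 0)) \<longlongrightarrow> total_cost w) at_top"
  unfolding total_cost_def infsum_eq_integral_count_space
proof (rule integral_dominated_convergence_at_top[where w="\<lambda>x. norm (wt w x * cost w x)"])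
  show "AE x in count_space labels. ((\<lambda>t. wt w x * (if death (life w) x \<le> t then cost w x else 0)) \<longlongrightarrow> wt w x * cost w x) at_top"
  proof (rule AE_I2)
    fix x
    have "\<forall>\<^sub>F t in at_top. wt w x * (if death (life w) x \<le> t then cost w x else 0) = wt w x * cost w x"
      using eventually_ge_at_top[of "death (life w) x"] by eventually_elim simp
    then show "((\<lambda>t. wt w x * (if death (life w) x \<le> t then cost w x else 0)) \<longlongrightarrow> wt w x * cost w x) at_top"
      by (rule tendsto_eventually)
  qed
qed (use assms in auto)

lemma measurable_subtree: "1 \<le> k \<Longrightarrow> subtree k \<in> measurable Om Om"
  unfolding subtree_def[abs_def] Om_def
  by (rule measurable_restrict) (auto simp: Cons_in_labels_iff intro!: measurable_component_singleton)

lemma distr_subtree: assumes "1 \<le> k" shows "distr Om Om (subtree k) = Om"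
  using distr_PiM_reindex[of labels "\<lambda>_. Q" "(#) k" labels] assms Q.prob_space_axioms
  by (auto simp: Om_def subtree_def[abs_def] Cons_in_labels_iff inj_on_def)

lemma AE_total_cost_recursion:
  assumes m: "offspring_moment 1 = ennreal m" "0 \<le> m" "m < 1" and Ci: "integrable L (\<lambda>m. fst (snd m))"
  shows "AE w in Om. total_cost w = (\<Sum>k=1..kids w []. factor w [] k * total_cost (subtree k w)) + cost w []"
proof -
  have "AE w in Om. integrable (count_space labels) (\<lambda>x. wt (subtree k w) x * cost (subtree k w) x)" if k: "1 \<le> k" for k
    by (rule AE_distrD[OF measurable_subtree[OF k]]) (simp only: distr_subtree[OF k], rule AE_summable_cost[OF m Ci])
  then have "AE w in Om. \<forall>k\<in>{1..}. integrable (count_space labels) (\<lambda>x. wt (subtree k w) x * cost (subtree k w) x)"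
    by (subst AE_ball_countable) auto
  with AE_space show ?thesis
  proof eventually_elim
    case (elim w)
    have "w [] \<in> space Q" by (rule coord_in_space[OF elim(1)]) simp
    then have "snd (w []) \<in> space mark_space"
      by (auto simp: space_Q space_pair_measure)
    then show ?case
      using elim(2) mark_factor_pos
      by (intro total_cost_recursion) (auto simp: summable_on_iff_integrable_count_space)
  qed
qed

abbreviation cost_law :: "real measure" where
  "cost_law \<equiv> distr Om borel total_cost"

text \<open>The product space with the root left out. On it the subtrees of the children are independent copies of the
whole family, since they use disjoint sets of labels.\<close>

definition offspring_space :: "(nat list \<Rightarrow> vertex_data) measure" where
  "offspring_space = (\<Pi>\<^sub>M x\<in>labels - {[]}. Q)"

sublocale offspring: prob_space offspring_space
  unfolding offspring_space_def by (rule prob_space_PiM) (rule Q.prob_space_axioms)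

lemma measurable_subtree': "1 \<le> k \<Longrightarrow> subtree k \<in> measurable offspring_space Om"
  unfolding subtree_def[abs_def] Om_def offspring_space_def
  by (rule measurable_restrict) (auto simp: Cons_in_labels_iff intro!: measurable_component_singleton)

lemma distr_subtree': assumes "1 \<le> k" shows "distr offspring_space Om (subtree k) = Om"
  using distr_PiM_reindex[of "labels - {[]}" "\<lambda>_. Q" "(#) k" labels] assms Q.prob_space_axioms
  by (auto simp: Om_def offspring_space_def subtree_def[abs_def] Cons_in_labels_iff inj_on_def)

lemma distr_root_offspring:
  "distr (Q \<Otimes>\<^sub>M offspring_space) Om (\<lambda>(y, w). w([] := y)) = Om"
proof -
  have "insert [] (labels - {[]}) = labels" by (auto simp: labels_def)
  then show ?thesis
    using distr_pair_PiM_eq_PiM[of "labels - {[]}" "\<lambda>_. Q" "[]"] Q.prob_space_axioms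
    by (simp add: Om_def offspring_space_def)
qed

lemma distr_subtree_costs:
  "distr offspring_space (\<Pi>\<^sub>M k\<in>{1..}. borel) (\<lambda>w. \<lambda>k\<in>{1..}. total_cost (subtree k w)) = (\<Pi>\<^sub>M k\<in>{1..}. cost_law)"
proof -
  let ?I = "labels - {[]}"
  have ne: "[1] \<in> ?I" by (simp add: labels_def)
  have coord: "(\<lambda>w. w x) \<in> measurable offspring_space Q" if "x \<in> ?I" for x
    unfolding offspring_space_def by (rule measurable_component_singleton[OF that])
  have "distr offspring_space (\<Pi>\<^sub>M x\<in>?I. Q) (\<lambda>w. \<lambda>x\<in>?I. w x) = distr offspring_space offspring_space (\<lambda>w. w)"
    by (rule distr_cong) (auto simp: offspring_space_def space_PiM PiE_def extensional_restrict)
  also have "\<dots> = offspring_space" by simp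
  also have "offspring_space = (\<Pi>\<^sub>M x\<in>?I. distr offspring_space Q (\<lambda>w. w x))"
    using distr_PiM_component[of ?I "\<lambda>_. Q"] Q.prob_space_axioms
    by (subst (1) offspring_space_def, intro PiM_cong refl) (auto simp: offspring_space_def)
  finally have "offspring.indep_vars (\<lambda>_. Q) (\<lambda>x w. w x) ?I"
    by (subst offspring.indep_vars_iff_distr_eq_PiM') (use ne coord in auto)
  then have "offspring.indep_vars (\<lambda>k. \<Pi>\<^sub>M x\<in>(#) k ` labels. Q) (\<lambda>k w. restrict (\<lambda>x. w x) ((#) k ` labels)) {1..}"
    by (rule offspring.indep_vars_restrict) (auto simp: disjoint_family_on_def Cons_in_labels_iff)
  then have "offspring.indep_vars (\<lambda>_. borel) (\<lambda>k w. total_cost (subtree k (restrict (\<lambda>x. w x) ((#) k ` labels)))) {1..}"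
  proof (rule offspring.indep_vars_compose2)
    fix k :: nat assume "k \<in> {1..}"
    have "subtree k \<in> measurable (\<Pi>\<^sub>M x\<in>(#) k ` labels. Q) Om"
      unfolding subtree_def[abs_def] Om_def
      by (rule measurable_restrict) (auto intro!: measurable_component_singleton)
    then show "(\<lambda>w. total_cost (subtree k w)) \<in> borel_measurable (\<Pi>\<^sub>M x\<in>(#) k ` labels. Q)"
      by (rule measurable_compose[OF _ measurable_total_cost])
  qed
  moreover have "subtree k (restrict (\<lambda>x. w x) ((#) k ` labels)) = subtree k w" for k and w
    by (auto simp: subtree_def fun_eq_iff)
  ultimately have ind: "offspring.indep_vars (\<lambda>_. borel) (\<lambda>k w. total_cost (subtree k w)) {1..}"
    by simp
  have tm: "(\<lambda>w. total_cost (subtree k w)) \<in> borel_measurable offspring_space" if "k \<in> {1..}" for k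
    using that by (intro measurable_compose[OF measurable_subtree' measurable_total_cost]) auto
  have "distr offspring_space (\<Pi>\<^sub>M k\<in>{1..}. borel) (\<lambda>w. \<lambda>k\<in>{1..}. total_cost (subtree k w)) =
      (\<Pi>\<^sub>M k\<in>{1..}. distr offspring_space borel (\<lambda>w. total_cost (subtree k w)))"
    using ind by (subst (asm) offspring.indep_vars_iff_distr_eq_PiM') (use tm in auto)
  also have "\<dots> = (\<Pi>\<^sub>M k\<in>{1..}. cost_law)"
  proof (rule PiM_cong[OF refl])
    fix k :: nat assume "k \<in> {1..}"
    then have k: "1 \<le> k" by simp
    have "distr offspring_space borel (\<lambda>w. total_cost (subtree k w)) = distr (distr offspring_space Om (subtree k)) borel total_cost"
      by (subst distr_distr) (auto simp: measurable_subtree'[OF k] comp_def)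
    then show "distr offspring_space borel (\<lambda>w. total_cost (subtree k w)) = cost_law"
      by (simp add: distr_subtree'[OF k])
  qed
  finally show ?thesis .
qed

text \<open>The map $((N, C, A), y) \mapsto \sum_{k=1}^N A_k y_k + C$ of the distributional equation.\<close>

definition smoothing :: "(nat \<times> real \<times> (nat \<Rightarrow> real)) \<times> (nat \<Rightarrow> real) \<Rightarrow> real" where
  "smoothing = (\<lambda>(m, y). (\<Sum>k=1..fst m. snd (snd m) k * y k) + fst (snd m))"

lemma measurable_smoothing: "smoothing \<in> borel_measurable (mark_space \<Otimes>\<^sub>M (\<Pi>\<^sub>M k\<in>{1..}. borel))"
proof -
  let ?R = "mark_space \<Otimes>\<^sub>M (\<Pi>\<^sub>M k\<in>{1..}. (borel :: real measure))"
  have *: "(\<lambda>p. snd (snd (fst p)) k * snd p k) \<in> borel_measurable ?R" if k: "1 \<le> k" for k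
  proof -
    have "(\<lambda>p. snd (snd (fst p)) k) \<in> borel_measurable ?R"
      by (rule measurable_compose[OF measurable_fst measurable_mark_factor[OF k]])
    moreover have "(\<lambda>p. snd p k) \<in> borel_measurable ?R"
      by (rule measurable_compose[OF measurable_snd]) (use k in \<open>auto intro!: measurable_component_singleton\<close>)
    ultimately show ?thesis by (rule borel_measurable_times)
  qed
  have s: "(\<lambda>p. \<Sum>k=1..n. snd (snd (fst p)) k * snd p k) \<in> borel_measurable ?R" for n
    by (rule borel_measurable_sum) (use * in auto)
  have "(\<lambda>p. \<Sum>k=1..fst (fst p). snd (snd (fst p)) k * snd p k) \<in> borel_measurable ?R"
    by (rule measurable_compose_countable[OF s]) measurable
  then show ?thesis unfolding smoothing_def case_prod_unfold by measurable
qed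

text \<open>The whole family has the law of a root attached to an independent family on the remaining labels
(\<open>distr_root_offspring\<close>), and under that product law the recursion for the total cost expresses it
through the mark of the root and independent copies of itself.\<close>

lemma total_cost_fixed_point:
  assumes m: "offspring_moment 1 = ennreal m" "0 \<le> m" "m < 1" and Ci: "integrable L (\<lambda>m. fst (snd m))"
  shows "cost_law = distr (L \<Otimes>\<^sub>M (\<Pi>\<^sub>M k\<in>{1..}. cost_law)) borel smoothing"
proof -
  let ?R = "mark_space \<Otimes>\<^sub>M (\<Pi>\<^sub>M k\<in>{1..}. (borel :: real measure))"
  let ?T = "\<lambda>w. \<lambda>k\<in>{1::nat..}. total_cost (subtree k w)"
  have Tm: "?T \<in> measurable Om (\<Pi>\<^sub>M k\<in>{1..}. borel)"
    by (rule measurable_restrict) (auto intro!: measurable_compose[OF measurable_subtree measurable_total_cost])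
  have Tm': "?T \<in> measurable offspring_space (\<Pi>\<^sub>M k\<in>{1..}. borel)"
    by (rule measurable_restrict) (auto intro!: measurable_compose[OF measurable_subtree' measurable_total_cost])
  have rm: "(\<lambda>w. snd (w [])) \<in> measurable Om mark_space"
    by (rule measurable_compose[OF measurable_coord]) measurable
  have cm: "(\<lambda>w. (snd (w []), ?T w)) \<in> measurable Om ?R"
    by (rule measurable_Pair[OF rm Tm])
  have um: "(\<lambda>(y, w). w([] := y)) \<in> measurable (Q \<Otimes>\<^sub>M offspring_space) Om"
  proof -
    have "(\<lambda>p. (snd p)([] := fst p)) \<in> measurable (Q \<Otimes>\<^sub>M offspring_space) (\<Pi>\<^sub>M x\<in>labels. Q)"
    proof (rule measurable_fun_upd[where J="labels - {[]}"])
      show "labels = labels - {[]} \<union> {[]}" by (auto simp: labels_def)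
      show "snd \<in> measurable (Q \<Otimes>\<^sub>M offspring_space) (\<Pi>\<^sub>M x\<in>labels - {[]}. Q)"
        unfolding offspring_space_def by measurable
    qed measurable
    then show ?thesis by (simp add: Om_def case_prod_unfold)
  qed
  have snd_law: "distr Q mark_space snd = L"
  proof (rule measure_eqI)
    fix X assume "X \<in> sets (distr Q mark_space snd)"
    then have X[measurable]: "X \<in> sets mark_space" by simp
    then have XL[measurable]: "X \<in> sets L" by (simp add: sets_L)
    have "emeasure (distr Q mark_space snd) X = (\<integral>\<^sup>+y. indicator X (snd y) \<partial>Q)"
      by (subst nn_integral_indicator[symmetric], simp, subst nn_integral_distr) auto
    also have "\<dots> = (\<integral>\<^sup>+m. indicator X m \<partial>L)"
      by (rule nn_integral_Q_snd) measurable
    finally show "emeasure (distr Q mark_space snd) X = emeasure L X" by simp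
  qed (simp add: sets_L)
  have pc: "prob_space (\<Pi>\<^sub>M k\<in>{1::nat..}. cost_law)"
    by (intro prob_space_PiM Om.prob_space_distr) simp
  have "cost_law = distr Om borel (\<lambda>w. smoothing (snd (w []), ?T w))"
  proof (rule distr_cong_AE[OF refl refl])
    show "AE w in Om. total_cost w = smoothing (snd (w []), ?T w)"
      using AE_total_cost_recursion[OF m Ci] by eventually_elim (simp add: smoothing_def)
    show "(\<lambda>w. smoothing (snd (w []), ?T w)) \<in> borel_measurable Om"
      by (rule measurable_compose[OF cm measurable_smoothing])
  qed simp
  also have "\<dots> = distr (distr Om ?R (\<lambda>w. (snd (w []), ?T w))) borel smoothing"
    by (subst distr_distr[OF measurable_smoothing cm]) (simp add: comp_def)
  also have "distr Om ?R (\<lambda>w. (snd (w []), ?T w)) = distr (Q \<Otimes>\<^sub>M offspring_space) ?R (\<lambda>(y, w). (snd y, ?T w))"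
  proof -
    have "distr Om ?R (\<lambda>w. (snd (w []), ?T w)) =
        distr (distr (Q \<Otimes>\<^sub>M offspring_space) Om (\<lambda>(y, w). w([] := y))) ?R (\<lambda>w. (snd (w []), ?T w))"
      by (simp add: distr_root_offspring)
    also have "\<dots> = distr (Q \<Otimes>\<^sub>M offspring_space) ?R (\<lambda>(y, w). (snd y, ?T w))"
      by (subst distr_distr[OF cm um]) (auto simp: comp_def case_prod_unfold subtree_def intro!: distr_cong)
    finally show ?thesis .
  qed
  also have "\<dots> = distr Q mark_space snd \<Otimes>\<^sub>M distr offspring_space (\<Pi>\<^sub>M k\<in>{1..}. borel) ?T"
  proof (rule pair_measure_distr[symmetric])
    show "sigma_finite_measure (distr offspring_space (\<Pi>\<^sub>M k\<in>{1..}. borel) ?T)"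
      unfolding distr_subtree_costs using pc by (rule prob_space_imp_sigma_finite)
  qed (use Tm' in measurable)
  also have "\<dots> = L \<Otimes>\<^sub>M (\<Pi>\<^sub>M k\<in>{1..}. cost_law)"
    by (simp only: snd_law distr_subtree_costs)
  finally show ?thesis .
qed


section \<open>Asymptotics of the accumulated cost\<close>

text \<open>On regular realizations this is $\int_0^t Y_s\,ds$; unlike the integral, it is evidently measurable in the
realization.\<close>

definition integrated_weight :: "real \<Rightarrow> (nat list \<Rightarrow> vertex_data) \<Rightarrow> real" where
  "integrated_weight t w = (\<Sum>\<^sub>\<infinity>x\<in>labels. wt w x *
     (if birth (life w) x \<le> t then min (life w x) (t - birth (life w) x) else 0))"

lemma measurable_integrated_weight [measurable]: "integrated_weight t \<in> borel_measurable Om"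
  unfolding integrated_weight_def[abs_def]
proof (rule borel_measurable_infsum)
  fix x assume x: "x \<in> labels"
  note [measurable] = measurable_wt[OF x] measurable_birth[OF x] measurable_life[OF x]
  show "(\<lambda>w. wt w x * (if birth (life w) x \<le> t then min (life w x) (t - birth (life w) x) else 0)) \<in> borel_measurable Om"
    by measurable
qed simp

definition cost_up_to :: "real \<Rightarrow> (nat list \<Rightarrow> vertex_data) \<Rightarrow> real" where
  "cost_up_to t w = (\<Sum>\<^sub>\<infinity>x\<in>labels. wt w x * (if death (life w) x \<le> t then cost w x else 0))"

lemma measurable_cost_up_to [measurable]: "cost_up_to t \<in> borel_measurable Om"
  unfolding cost_up_to_def[abs_def]
proof (rule borel_measurable_infsum)
  fix x assume x: "x \<in> labels"
  note [measurable] = measurable_wt[OF x] measurable_birth[OF x] measurable_life[OF x] measurable_cost[OF x]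
  show "(\<lambda>w. wt w x * (if death (life w) x \<le> t then cost w x else 0)) \<in> borel_measurable Om"
    unfolding death_def by measurable
qed simp

text \<open>The two growing regimes differ only in the scale \<open>a\<close>. Local integrability of the weight process is a premise of
the limit along a realization, because it holds only for regular ones.\<close>

lemma scaled_cost_tendsto_in_prob:
  assumes P: "prob_space P" and X[measurable]: "X \<in> measurable P Om" and XL: "distr P Om X = Om"
    and q: "1 < q" "q \<le> 2"
    and m: "offspring_moment q = ennreal m" "0 \<le> m" and \<theta>: "0 \<le> \<theta>" "m < 1 + \<theta>"
    and m1: "offspring_moment 1 = ennreal m1" "0 \<le> m1"
    and Ci: "integrable L (\<lambda>m. fst (snd m))" and c: "c = (\<integral>m. fst (snd m) \<partial>L)"
    and Cq: "(\<integral>\<^sup>+m. ennreal (\<bar>fst (snd m)\<bar> powr q) \<partial>L) < \<infinity>"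
    and a: "((\<lambda>t. \<bar>a t\<bar> powr q * exp (\<theta> * t)) \<longlongrightarrow> 0) at_top"
    and Y: "Y \<in> borel_measurable P"
    and lim: "AE \<omega> in P. (\<forall>t. set_integrable lborel {0..t} (total_weight (X \<omega>))) \<longrightarrow>
       ((\<lambda>t. a t * (LINT s:{0..t}|lborel. total_weight (X \<omega>) s)) \<longlongrightarrow> Y \<omega>) at_top"
  shows "tendsto_in_prob P (\<lambda>t \<omega>. a t * cost_up_to t (X \<omega>)) (\<lambda>\<omega>. c * Y \<omega>) at_top"
proof -
  interpret P: prob_space P by (rule P)
  have reg: "AE \<omega> in P. regular (X \<omega>)"
    by (rule AE_distrD[OF X]) (simp only: XL, rule AE_regular[OF m1 Ci])
  obtain K where K: "0 \<le> K" "\<And>t. 0 \<le> t \<Longrightarrow>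
      (\<integral>\<^sup>+w. ennreal (\<bar>deviation c t w\<bar> powr q) \<partial>Om) \<le> ennreal (K * exp (\<theta> * t))"
    using deviation_moment_le[OF q m \<theta> m1 Ci c Cq] by blast
  have Z: "tendsto_in_prob P (\<lambda>t \<omega>. c * (a t * integrated_weight t (X \<omega>))) (\<lambda>\<omega>. c * Y \<omega>) at_top"
  proof (rule P.AE_tendsto_imp_tendsto_in_prob)
    show "AE \<omega> in P. ((\<lambda>t. c * (a t * integrated_weight t (X \<omega>))) \<longlongrightarrow> c * Y \<omega>) at_top"
      using reg lim
    proof eventually_elim
      case (elim \<omega>)
      have "((\<lambda>t. c * (a t * (LINT s:{0..t}|lborel. total_weight (X \<omega>) s))) \<longlongrightarrow> c * Y \<omega>) at_top"
        using elim(2) regular_total_weight(1)[OF elim(1)] by (intro tendsto_mult_left) auto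
      then show ?case
        unfolding regular_total_weight(2)[OF elim(1)] integrated_weight_def .
    qed
  qed (use Y in measurable)
  show ?thesis
  proof (rule P.tendsto_in_prob_add_null[OF Z, where R="\<lambda>t \<omega>. a t * deviation c t (X \<omega>)" and q=q
        and b="\<lambda>t. K * (\<bar>a t\<bar> powr q * exp (\<theta> * t))"])
    show "((\<lambda>t. K * (\<bar>a t\<bar> powr q * exp (\<theta> * t))) \<longlongrightarrow> 0) at_top"
      by (rule tendsto_mult_right_zero[OF a])
    show "0 < q" using q by simp
    show "(\<lambda>\<omega>. a t * deviation c t (X \<omega>)) \<in> borel_measurable P" for t by measurable
    show "(\<lambda>\<omega>. a t * cost_up_to t (X \<omega>)) \<in> borel_measurable P" for t by measurable
    fix t :: real assume t: "0 \<le> t"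
    have "(\<integral>\<^sup>+\<omega>. ennreal (\<bar>a t * deviation c t (X \<omega>)\<bar> powr q) \<partial>P) =
        (\<integral>\<^sup>+w. ennreal (\<bar>a t * deviation c t w\<bar> powr q) \<partial>Om)"
      by (rule P.nn_integral_sample[OF X XL]) measurable
    also have "\<dots> = (\<integral>\<^sup>+w. ennreal (\<bar>a t\<bar> powr q) * ennreal (\<bar>deviation c t w\<bar> powr q) \<partial>Om)"
      by (simp add: abs_mult powr_mult ennreal_mult)
    also have "\<dots> = ennreal (\<bar>a t\<bar> powr q) * (\<integral>\<^sup>+w. ennreal (\<bar>deviation c t w\<bar> powr q) \<partial>Om)"
      by (rule nn_integral_cmult) measurable
    also have "\<dots> \<le> ennreal (\<bar>a t\<bar> powr q) * ennreal (K * exp (\<theta> * t))"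
      by (rule mult_left_mono[OF K(2)[OF t]]) simp
    also have "\<dots> = ennreal (K * (\<bar>a t\<bar> powr q * exp (\<theta> * t)))"
      using K(1) by (simp add: ennreal_mult[symmetric] mult_ac)
    finally show "(\<integral>\<^sup>+\<omega>. ennreal (\<bar>a t * deviation c t (X \<omega>)\<bar> powr q) \<partial>P) \<le> ennreal (K * (\<bar>a t\<bar> powr q * exp (\<theta> * t)))" .
    show "AE \<omega> in P. a t * cost_up_to t (X \<omega>) = c * (a t * integrated_weight t (X \<omega>)) + a t * deviation c t (X \<omega>)"
      using reg
    proof eventually_elim
      case (elim \<omega>)
      show ?case
        using regular_cost_decomposition[OF elim, of t c] regular_total_weight(2)[OF elim, of t]
        by (simp add: cost_up_to_def integrated_weight_def algebra_simps)
    qed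
  qed
qed

end

text \<open>With $F = \Phi$ the function $F(s)/s$ is $\mu$, and $\mu$ decreases at $1$.\<close>

lemma exists_moment_order:
  fixes S :: "real set"
  assumes S: "1 \<in> interior S" and p: "1 < p" and d: "d < 0" "((\<lambda>s. F s / s) has_real_derivative d) (at 1)"
  obtains q where "1 < q" "q \<le> 2" "q \<le> p" "q \<in> S" "F q < q * F 1"
proof -
  obtain e where e: "e > 0" "ball 1 e \<subseteq> S"
    using S by (auto simp: mem_interior)
  obtain r where r: "r > 0" "\<And>h. 0 < h \<Longrightarrow> h < r \<Longrightarrow> F (1 + h) / (1 + h) < F 1 / 1"
    using DERIV_neg_dec_right[OF d(2,1)] by auto
  define h where "h = min (min (e / 2) (r / 2)) (min 1 (p - 1))"
  have h: "0 < h" "h < r" "h < e" "h \<le> 1" "h \<le> p - 1"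
    using e r p by (auto simp: h_def)
  show ?thesis
  proof
    show "F (1 + h) < (1 + h) * F 1"
      using r(2)[of h] h by (simp add: pos_divide_less_eq mult.commute)
    have "1 + h \<in> ball 1 e" using h by (simp add: dist_real_def)
    then show "1 + h \<in> S" using e by blast
  qed (use h in auto)
qed

text \<open>The point of the product space given by a realization of the marks, with the data at lists that are not
labels and the weights with index $0$ forgotten.\<close>

definition sample_tree ::
  "(nat list \<Rightarrow> real) \<Rightarrow> (nat list \<Rightarrow> nat) \<Rightarrow> (nat list \<Rightarrow> real) \<Rightarrow> (nat list \<Rightarrow> nat \<Rightarrow> real) \<Rightarrow> nat list \<Rightarrow> vertex_data"
  where "sample_tree E N C A = (\<lambda>x\<in>labels. (E x, N x, C x, \<lambda>k\<in>{1..}. A x k))"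

lemma
  assumes x: "x \<in> labels"
  shows weight_sample_tree: "wt (sample_tree E N C A) x = weight N A x"
    and birth_sample_tree: "birth (life (sample_tree E N C A)) x = birth E x"
    and death_sample_tree: "death (life (sample_tree E N C A)) x = death E x"
    and cost_sample_tree: "cost (sample_tree E N C A) x = C x"
proof -
  show "wt (sample_tree E N C A) x = weight N A x"
    by (rule weight_cong[OF x]) (auto simp: sample_tree_def)
  show b: "birth (life (sample_tree E N C A)) x = birth E x"
    by (rule birth_cong[OF x]) (auto simp: sample_tree_def)
  show "death (life (sample_tree E N C A)) x = death E x"
    using x by (simp add: death_def b) (simp add: sample_tree_def)
  show "cost (sample_tree E N C A) x = C x" using x by (simp add: sample_tree_def)
qed

lemma (in prob_space) offspring_moment_mark:
  assumes vector: "mark N C A \<in> measurable M mark_space" and \<gamma>: "\<gamma> \<in> moment_domain M N A"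
  shows "marked_tree.offspring_moment (distr M mark_space (mark N C A)) \<gamma> = ennreal (1 + Phi M N A \<gamma>)"
    and "0 \<le> 1 + Phi M N A \<gamma>"
proof -
  define L where "L = distr M mark_space (mark N C A)"
  interpret L: prob_space L unfolding L_def by (rule prob_space_distr[OF vector])
  interpret marked_tree L by unfold_locales (simp add: L_def)
  let ?S = "\<lambda>\<omega>. \<Sum>k=1..N \<omega>. A k \<omega> powr \<gamma>"
  let ?T = "\<lambda>m::nat \<times> real \<times> (nat \<Rightarrow> real). \<Sum>i=1..fst m. ennreal (snd (snd m) i powr \<gamma>)"
  have Tm: "?T \<in> borel_measurable mark_space"
  proof (rule measurable_compose_countable[where f="\<lambda>n m. \<Sum>i=1..n. ennreal (snd (snd m) i powr \<gamma>)"])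
    fix n :: nat
    have "(\<lambda>m. ennreal (snd (snd m) i powr \<gamma>)) \<in> borel_measurable mark_space" if "i \<in> {1..n}" for i
    proof -
      have "1 \<le> i" using that by simp
      note [measurable] = measurable_mark_factor[OF this]
      show ?thesis by measurable
    qed
    then show "(\<lambda>m. \<Sum>i=1..n. ennreal (snd (snd m) i powr \<gamma>)) \<in> borel_measurable mark_space"
      by (rule borel_measurable_sum)
  qed measurable
  have TS: "?T (mark N C A \<omega>) = ennreal (?S \<omega>)" for \<omega>
    by (simp add: mark_def)
  have S0: "0 \<le> ?S \<omega>" for \<omega> by (intro sum_nonneg) simp
  have Sm: "?S \<in> borel_measurable M"
  proof -
    have "(\<lambda>\<omega>. enn2real (?T (mark N C A \<omega>))) \<in> borel_measurable M"
      using measurable_compose[OF vector Tm] by measurable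
    then show ?thesis by (simp only: TS enn2real_ennreal[OF S0])
  qed
  have fin: "(\<integral>\<^sup>+\<omega>. ennreal (?S \<omega>) \<partial>M) < \<infinity>" using \<gamma> by (simp add: moment_domain_def)
  have int: "integrable M ?S" by (rule integrableI_nonneg[OF Sm _ fin]) (rule AE_I2, rule S0)
  have "offspring_moment \<gamma> = (\<integral>\<^sup>+m. ?T m \<partial>L)"
    by (rule offspring_moment_def)
  also have "\<dots> = (\<integral>\<^sup>+\<omega>. ?T (mark N C A \<omega>) \<partial>M)"
    unfolding L_def by (rule nn_integral_distr[OF vector]) (simp only: measurable_distr_eq1 Tm)
  also have "\<dots> = (\<integral>\<^sup>+\<omega>. ennreal (?S \<omega>) \<partial>M)" by (simp only: TS)
  also have "\<dots> = ennreal (\<integral>\<omega>. ?S \<omega> \<partial>M)"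
    by (rule nn_integral_eq_integral[OF int]) (rule AE_I2, rule S0)
  finally show "marked_tree.offspring_moment (distr M mark_space (mark N C A)) \<gamma> = ennreal (1 + Phi M N A \<gamma>)"
    by (simp add: Phi_def L_def)
  have "0 \<le> (\<integral>\<omega>. ?S \<omega> \<partial>M)"
    by (rule integral_nonneg_AE, rule AE_I2, rule S0)
  then show "0 \<le> 1 + Phi M N A \<gamma>" by (simp add: Phi_def)
qed

theorem theorem2p3:
  fixes M :: "'a measure" and N :: "'a \<Rightarrow> nat" and C :: "'a \<Rightarrow> real"
    and A :: "nat \<Rightarrow> 'a \<Rightarrow> real"
    and P :: "'w measure" and E' :: "nat list \<Rightarrow> 'w \<Rightarrow> real" and N' :: "nat list \<Rightarrow> 'w \<Rightarrow> nat"
    and C' :: "nat list \<Rightarrow> 'w \<Rightarrow> real" and A' :: "nat list \<Rightarrow> nat \<Rightarrow> 'w \<Rightarrow> real"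
    and p :: real
  assumes prob_M: "prob_space M"
    and vector: "mark N C A \<in> measurable M mark_space"
    and i: "\<forall>\<^sub>F \<epsilon> in at_right (0::real).
        (\<integral>\<^sup>+s\<in>{1 - \<epsilon><..<1}. ennreal (1 / (s - (\<integral>\<omega>. s ^ N \<omega> \<partial>M))) \<partial>lborel) = \<infinity>"
    and ii: "\<And>m. \<P>(\<omega> in M. N \<omega> = m) > 0 \<Longrightarrow>
        \<P>(\<omega> in M. (\<forall>k\<in>{1..m}. A k \<omega> > 0) \<bar> N \<omega> = m) = 1"
    and iii: "\<exists>m. \<P>(\<omega> in M. N \<omega> = m) > 0 \<and>
        \<P>(\<omega> in M. (\<forall>k\<in>{1..m}. A k \<omega> = 1) \<bar> N \<omega> = m) < 1"
    and iv: "(\<integral>\<^sup>+\<omega>. of_nat (N \<omega>) \<partial>M) > 1"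
    and EC: "(\<integral>\<omega>. C \<omega> \<partial>M) \<noteq> 0"
    and p: "p > 1" "integrable M (\<lambda>\<omega>. \<bar>C \<omega>\<bar> powr p)"
    and D: "1 \<in> interior (moment_domain M N A)"
    and mu': "\<exists>d<0. (mu M N A has_real_derivative d) (at 1)"
    and prob_P: "prob_space P"
    and copies_indep: "prob_space.indep_vars P (\<lambda>_. borel \<Otimes>\<^sub>M mark_space)
        (\<lambda>x \<omega>. (E' x \<omega>, mark (N' x) (C' x) (A' x) \<omega>)) labels"
    and copies_law: "\<And>x. x \<in> labels \<Longrightarrow>
        distr P (borel \<Otimes>\<^sub>M mark_space) (\<lambda>\<omega>. (E' x \<omega>, mark (N' x) (C' x) (A' x) \<omega>)) =
        density lborel (exponential_density 1) \<Otimes>\<^sub>M distr M mark_space (mark N C A)"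
  shows
    "(\<forall>M_inf. as_limit P (add_mart (Phi M N A) E' N' A' 1) M_inf at_top \<longrightarrow>
        (Phi M N A 1 > 0 \<longrightarrow>
          tendsto_in_prob P (\<lambda>t \<omega>. exp (- mu M N A 1 * t) * C_sum E' N' C' A' t \<omega>)
            (\<lambda>\<omega>. (\<integral>\<upsilon>. C \<upsilon> \<partial>M) / Phi M N A 1 * M_inf \<omega>) at_top) \<and>
        (Phi M N A 1 = 0 \<longrightarrow>
          tendsto_in_prob P (\<lambda>t \<omega>. 1 / t * C_sum E' N' C' A' t \<omega>)
            (\<lambda>\<omega>. (\<integral>\<upsilon>. C \<upsilon> \<partial>M) * M_inf \<omega>) at_top)) \<and>
     (Phi M N A 1 < 0 \<longrightarrow>
        tendsto_in_prob P (C_sum E' N' C' A') (C_sum_inf N' C' A') at_top \<and>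
        (AE \<omega> in P. (\<lambda>x. exp (pos (\<lambda>x k. A' x k \<omega>) x) * C' x \<omega>)
            summable_on gw_tree (\<lambda>x. N' x \<omega>)) \<and>
        distr P borel (C_sum_inf N' C' A') =
        distr (M \<Otimes>\<^sub>M (\<Pi>\<^sub>M k\<in>{1..}. distr P borel (C_sum_inf N' C' A'))) borel
          (\<lambda>(\<omega>, y). (\<Sum>k=1..N \<omega>. A k \<omega> * y k) + C \<omega>))"
proof -
  interpret M: prob_space M by (rule prob_M)
  interpret P: prob_space P by (rule prob_P)
  define L where "L = distr M mark_space (mark N C A)"
  interpret L: prob_space L unfolding L_def by (rule M.prob_space_distr[OF vector])
  interpret marked_tree L by unfold_locales (simp add: L_def)
  let ?\<Phi> = "Phi M N A 1"
  have C_meas: "C \<in> borel_measurable M"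
    using measurable_compose[OF vector measurable_mark_cost] by (simp add: mark_def)
  have C_int: "integrable M C"
  proof (rule Bochner_Integration.integrable_bound[of _ "\<lambda>\<omega>. 1 + \<bar>C \<omega>\<bar> powr p"])
    show "AE \<omega> in M. norm (C \<omega>) \<le> norm (1 + \<bar>C \<omega>\<bar> powr p)"
    proof (rule AE_I2)
      fix \<omega> show "norm (C \<omega>) \<le> norm (1 + \<bar>C \<omega>\<bar> powr p)"
        using powr_le_one_plus[of "\<bar>C \<omega>\<bar>" 1 p] p(1) by simp
    qed
  qed (use p C_meas in auto)
  have Ci: "integrable L (\<lambda>m. fst (snd m))"
    unfolding L_def using C_int by (subst integrable_distr_eq[OF vector]) (auto simp: mark_def)
  have c: "(\<integral>\<omega>. C \<omega> \<partial>M) = (\<integral>m. fst (snd m) \<partial>L)"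
    unfolding L_def by (subst integral_distr[OF vector]) (auto simp: mark_def)
  have one: "1 \<in> moment_domain M N A" using D interior_subset by blast
  note m1 = M.offspring_moment_mark[OF vector one, folded L_def]

  define X where "X \<omega> = (\<lambda>x\<in>labels. (E' x \<omega>, mark (N' x) (C' x) (A' x) \<omega>))" for \<omega>
  have rv: "(\<lambda>\<omega>. (E' x \<omega>, mark (N' x) (C' x) (A' x) \<omega>)) \<in> measurable P vertex_space" if "x \<in> labels" for x
    using copies_indep that by (simp add: P.indep_vars_def)
  have Xm: "X \<in> measurable P Om"
  proof -
    have "X \<in> measurable P (\<Pi>\<^sub>M x\<in>labels. vertex_space)"
      unfolding X_def[abs_def] by (rule measurable_restrict) (rule rv)
    then show ?thesis by (simp add: measurable_cong_sets[OF refl sets_Om])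
  qed
  have XL: "distr P Om X = Om"
  proof -
    have "distr P Om X = distr P (\<Pi>\<^sub>M x\<in>labels. vertex_space) X"
      by (rule distr_cong) (auto simp: sets_Om)
    also have "\<dots> = (\<Pi>\<^sub>M x\<in>labels. distr P vertex_space (\<lambda>\<omega>. (E' x \<omega>, mark (N' x) (C' x) (A' x) \<omega>)))"
      unfolding X_def[abs_def]
      using P.indep_vars_iff_distr_eq_PiM'[of labels "\<lambda>x \<omega>. (E' x \<omega>, mark (N' x) (C' x) (A' x) \<omega>)" "\<lambda>_. vertex_space"]
        copies_indep rv Nil_in_labels by blast
    also have "\<dots> = Om"
      unfolding Om_def by (rule PiM_cong[OF refl]) (simp only: copies_law[folded L_def] Q_def D_def)
    finally show ?thesis .
  qed
  have Xeq: "X \<omega> = sample_tree (\<lambda>x. E' x \<omega>) (\<lambda>x. N' x \<omega>) (\<lambda>x. C' x \<omega>) (\<lambda>x k. A' x k \<omega>)" for \<omega>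
    by (simp add: X_def mark_def sample_tree_def)
  note sample = weight_sample_tree birth_sample_tree death_sample_tree cost_sample_tree
  have C_t: "C_sum E' N' C' A' t \<omega> = cost_up_to t (X \<omega>)" for t \<omega>
    unfolding C_sum_eq cost_up_to_def by (rule infsum_cong) (simp only: Xeq sample)
  have C_inf: "C_sum_inf N' C' A' \<omega> = total_cost (X \<omega>)" for \<omega>
    unfolding C_sum_inf_eq total_cost_def by (rule infsum_cong) (simp only: Xeq sample)
  have mart: "add_mart \<Phi> E' N' A' 1 t \<omega> = exp (- \<Phi> 1 * t) * total_weight (X \<omega>) t" for \<Phi> t \<omega>
    unfolding add_mart_eq population_weight_def
    by (rule arg_cong2[where f="(*)", OF refl], rule infsum_cong) (simp only: Xeq sample)

  have ab: "(?\<Phi> > 0 \<longrightarrow> tendsto_in_prob P (\<lambda>t \<omega>. exp (- mu M N A 1 * t) * C_sum E' N' C' A' t \<omega>)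
            (\<lambda>\<omega>. (\<integral>\<upsilon>. C \<upsilon> \<partial>M) / ?\<Phi> * M_inf \<omega>) at_top) \<and>
        (?\<Phi> = 0 \<longrightarrow> tendsto_in_prob P (\<lambda>t \<omega>. 1 / t * C_sum E' N' C' A' t \<omega>)
            (\<lambda>\<omega>. (\<integral>\<upsilon>. C \<upsilon> \<partial>M) * M_inf \<omega>) at_top)"
    if lim: "as_limit P (add_mart (Phi M N A) E' N' A' 1) M_inf at_top" for M_inf
  proof -
    have Mm: "M_inf \<in> borel_measurable P"
      and Mlim: "AE \<omega> in P. ((\<lambda>t. exp (- ?\<Phi> * t) * total_weight (X \<omega>) t) \<longlongrightarrow> M_inf \<omega>) at_top"
      using lim by (auto simp: as_limit_def mart)
    obtain d where d: "d < 0" "((\<lambda>s. Phi M N A s / s) has_real_derivative d) (at 1)"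
      using mu' by (auto simp: mu_def[abs_def])
    obtain q where q: "1 < q" "q \<le> 2" "q \<le> p" "q \<in> moment_domain M N A" "Phi M N A q < q * ?\<Phi>"
      using exists_moment_order[OF D p(1) d] by blast
    note mq = M.offspring_moment_mark[OF vector q(4), folded L_def]
    have Cq: "(\<integral>\<^sup>+m. ennreal (\<bar>fst (snd m)\<bar> powr q) \<partial>L) < \<infinity>"
    proof -
      have "(\<integral>\<^sup>+m. ennreal (\<bar>fst (snd m)\<bar> powr q) \<partial>L) = (\<integral>\<^sup>+\<omega>. ennreal (\<bar>C \<omega>\<bar> powr q) \<partial>M)"
        unfolding L_def by (subst nn_integral_distr[OF vector]) (auto simp: mark_def)
      also have "\<dots> \<le> (\<integral>\<^sup>+\<omega>. ennreal (1 + \<bar>C \<omega>\<bar> powr p) \<partial>M)"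
        using q by (intro nn_integral_mono ennreal_leI powr_le_one_plus) auto
      also have "\<dots> < \<infinity>"
      proof -
        have "integrable M (\<lambda>\<omega>. 1 + \<bar>C \<omega>\<bar> powr p)" using p(2) by simp
        then show ?thesis by (simp add: integrable_iff_bounded)
      qed
      finally show ?thesis .
    qed
    show ?thesis
    proof (intro conjI impI)
      assume \<Phi>: "?\<Phi> > 0"
      \<comment> \<open>Any exponent strictly between $\max(0, \Phi(q))$ and $q\,\Phi(1)$ would do.\<close>
      define \<theta> where "\<theta> = (max 0 (Phi M N A q) + q * ?\<Phi>) / 2"
      have \<theta>: "0 \<le> \<theta>" "1 + Phi M N A q < 1 + \<theta>" "\<theta> < q * ?\<Phi>"
        using q \<Phi> mult_pos_pos[of q ?\<Phi>] by (auto simp: \<theta>_def)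
      have "tendsto_in_prob P (\<lambda>t \<omega>. exp (- ?\<Phi> * t) * cost_up_to t (X \<omega>))
          (\<lambda>\<omega>. (\<integral>\<upsilon>. C \<upsilon> \<partial>M) * (M_inf \<omega> / ?\<Phi>)) at_top"
      proof (rule scaled_cost_tendsto_in_prob[OF prob_P Xm XL q(1,2) mq \<theta>(1,2) m1 Ci c Cq])
        have "((\<lambda>t. exp ((\<theta> - q * ?\<Phi>) * t)) \<longlongrightarrow> 0) at_top"
          using \<theta> by (intro filterlim_compose[OF exp_at_bot]
            filterlim_tendsto_neg_mult_at_bot[OF tendsto_const _ filterlim_ident]) simp
        also have "(\<lambda>t. exp ((\<theta> - q * ?\<Phi>) * t)) = (\<lambda>t. \<bar>exp (- ?\<Phi> * t)\<bar> powr q * exp (\<theta> * t))"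
          by (simp add: fun_eq_iff exp_powr_real exp_add[symmetric] algebra_simps)
        finally show "((\<lambda>t. \<bar>exp (- ?\<Phi> * t)\<bar> powr q * exp (\<theta> * t)) \<longlongrightarrow> 0) at_top" .
        show "AE \<omega> in P. (\<forall>t. set_integrable lborel {0..t} (total_weight (X \<omega>))) \<longrightarrow>
            ((\<lambda>t. exp (- ?\<Phi> * t) * (LINT s:{0..t}|lborel. total_weight (X \<omega>) s)) \<longlongrightarrow> M_inf \<omega> / ?\<Phi>) at_top"
          using Mlim by eventually_elim (intro impI exp_weighted_cesaro[OF \<Phi>], blast+)
      qed (use Mm in measurable)
      then show "tendsto_in_prob P (\<lambda>t \<omega>. exp (- mu M N A 1 * t) * C_sum E' N' C' A' t \<omega>)
            (\<lambda>\<omega>. (\<integral>\<upsilon>. C \<upsilon> \<partial>M) / ?\<Phi> * M_inf \<omega>) at_top"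
        by (simp add: C_t mu_def)
    next
      assume \<Phi>: "?\<Phi> = 0"
      have "tendsto_in_prob P (\<lambda>t \<omega>. 1 / t * cost_up_to t (X \<omega>)) (\<lambda>\<omega>. (\<integral>\<upsilon>. C \<upsilon> \<partial>M) * M_inf \<omega>) at_top"
      proof (rule scaled_cost_tendsto_in_prob[OF prob_P Xm XL q(1,2) mq order_refl _ m1 Ci c Cq _ Mm])
        show "1 + Phi M N A q < 1 + 0" using q(5) \<Phi> by simp
        have "((\<lambda>t::real. \<bar>1 / t\<bar> powr q) \<longlongrightarrow> \<bar>0\<bar> powr q) at_top"
          using q by (intro tendsto_powr' tendsto_rabs tendsto_divide_0[OF tendsto_const]
            filterlim_mono[OF filterlim_ident at_top_le_at_infinity order_refl] tendsto_const) auto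
        then show "((\<lambda>t::real. \<bar>1 / t\<bar> powr q * exp (0 * t)) \<longlongrightarrow> 0) at_top" by simp
        show "AE \<omega> in P. (\<forall>t. set_integrable lborel {0..t} (total_weight (X \<omega>))) \<longrightarrow>
            ((\<lambda>t. 1 / t * (LINT s:{0..t}|lborel. total_weight (X \<omega>) s)) \<longlongrightarrow> M_inf \<omega>) at_top"
          using Mlim
        proof eventually_elim
          case (elim \<omega>)
          then have "(total_weight (X \<omega>) \<longlongrightarrow> M_inf \<omega>) at_top" by (simp add: \<Phi>)
          then show ?case using plain_cesaro by blast
        qed
      qed
      then show "tendsto_in_prob P (\<lambda>t \<omega>. 1 / t * C_sum E' N' C' A' t \<omega>)
            (\<lambda>\<omega>. (\<integral>\<upsilon>. C \<upsilon> \<partial>M) * M_inf \<omega>) at_top"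
        by (simp add: C_t)
    qed
  qed

  have cc: "tendsto_in_prob P (C_sum E' N' C' A') (C_sum_inf N' C' A') at_top \<and>
        (AE \<omega> in P. (\<lambda>x. exp (pos (\<lambda>x k. A' x k \<omega>) x) * C' x \<omega>)
            summable_on gw_tree (\<lambda>x. N' x \<omega>)) \<and>
        distr P borel (C_sum_inf N' C' A') =
        distr (M \<Otimes>\<^sub>M (\<Pi>\<^sub>M k\<in>{1..}. distr P borel (C_sum_inf N' C' A'))) borel
          (\<lambda>(\<omega>, y). (\<Sum>k=1..N \<omega>. A k \<omega> * y k) + C \<omega>)"
    if \<Phi>: "?\<Phi> < 0"
  proof (intro conjI)
    have m2: "1 + ?\<Phi> < 1" using \<Phi> by simp
    have sm: "AE \<omega> in P. integrable (count_space labels) (\<lambda>x. wt (X \<omega>) x * cost (X \<omega>) x)"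
      by (rule AE_distrD[OF Xm]) (simp only: XL, rule AE_summable_cost[OF m1 m2 Ci])
    have C_inf': "C_sum_inf N' C' A' = (\<lambda>\<omega>. total_cost (X \<omega>))"
      by (simp add: fun_eq_iff C_inf)
    show "tendsto_in_prob P (C_sum E' N' C' A') (C_sum_inf N' C' A') at_top"
    proof (rule P.AE_tendsto_imp_tendsto_in_prob)
      show "C_sum E' N' C' A' t \<in> borel_measurable P" for t
        using measurable_compose[OF Xm measurable_cost_up_to] by (simp add: C_t[abs_def])
      show "C_sum_inf N' C' A' \<in> borel_measurable P"
        unfolding C_inf' by (rule measurable_compose[OF Xm measurable_total_cost])
      show "AE \<omega> in P. ((\<lambda>t. C_sum E' N' C' A' t \<omega>) \<longlongrightarrow> C_sum_inf N' C' A' \<omega>) at_top"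
        unfolding C_t C_inf cost_up_to_def
        using sm by eventually_elim (rule cost_up_to_tendsto_total_cost)
    qed
    show "AE \<omega> in P. (\<lambda>x. exp (pos (\<lambda>x k. A' x k \<omega>) x) * C' x \<omega>) summable_on gw_tree (\<lambda>x. N' x \<omega>)"
      using sm
    proof eventually_elim
      case (elim \<omega>)
      have "(\<lambda>x. weight (\<lambda>x. N' x \<omega>) (\<lambda>x k. A' x k \<omega>) x * C' x \<omega>) summable_on labels"
        using elim unfolding summable_on_iff_integrable_count_space[symmetric]
        by (rule summable_on_cong[THEN iffD1, rotated]) (simp only: Xeq sample)
      then show ?case
        by (rule summable_on_cong_neutral[THEN iffD1, rotated 3]) (use gw_tree_subset_labels in \<open>auto simp: weight_def\<close>)
    qed
    have law: "distr P borel (C_sum_inf N' C' A') = cost_law"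
    proof -
      have "distr P borel (\<lambda>\<omega>. total_cost (X \<omega>)) = distr (distr P Om X) borel total_cost"
        by (subst distr_distr[OF measurable_total_cost Xm]) (simp add: comp_def)
      then show ?thesis by (simp add: XL C_inf')
    qed
    let ?V = "\<Pi>\<^sub>M k\<in>{1::nat..}. cost_law"
    interpret V: prob_space ?V by (intro prob_space_PiM Om.prob_space_distr) simp
    have V: "distr ?V ?V (\<lambda>y. y) = ?V" by simp
    have sV: "sets ?V = sets (\<Pi>\<^sub>M k\<in>{1::nat..}. (borel :: real measure))" by (rule sets_PiM_cong) auto
    have "L \<Otimes>\<^sub>M ?V = distr M mark_space (mark N C A) \<Otimes>\<^sub>M distr ?V ?V (\<lambda>y. y)"
      unfolding L_def[symmetric] V ..
    also have "\<dots> = distr (M \<Otimes>\<^sub>M ?V) (mark_space \<Otimes>\<^sub>M ?V) (\<lambda>(\<omega>, y). (mark N C A \<omega>, y))"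
    proof (rule pair_measure_distr[OF vector])
      show "(\<lambda>y. y) \<in> measurable ?V ?V" by simp
      show "sigma_finite_measure (distr ?V ?V (\<lambda>y. y))"
        unfolding V by (rule V.sigma_finite_measure_axioms)
    qed
    finally have LV: "L \<Otimes>\<^sub>M ?V = distr (M \<Otimes>\<^sub>M ?V) (mark_space \<Otimes>\<^sub>M ?V) (\<lambda>(\<omega>, y). (mark N C A \<omega>, y))" .
    have pm: "(\<lambda>(\<omega>, y). (mark N C A \<omega>, y)) \<in> measurable (M \<Otimes>\<^sub>M ?V) (mark_space \<Otimes>\<^sub>M ?V)"
      using vector by measurable
    have sm': "smoothing \<in> borel_measurable (mark_space \<Otimes>\<^sub>M ?V)"
      using measurable_smoothing by (simp add: measurable_cong_sets[OF sets_pair_measure_cong[OF refl sV] refl])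
    have "cost_law = distr (L \<Otimes>\<^sub>M ?V) borel smoothing"
      by (rule total_cost_fixed_point[OF m1 m2 Ci])
    also have "\<dots> = distr (M \<Otimes>\<^sub>M ?V) borel (smoothing \<circ> (\<lambda>(\<omega>, y). (mark N C A \<omega>, y)))"
      unfolding LV by (rule distr_distr[OF sm' pm])
    also have "smoothing \<circ> (\<lambda>(\<omega>, y). (mark N C A \<omega>, y)) = (\<lambda>(\<omega>, y). (\<Sum>k=1..N \<omega>. A k \<omega> * y k) + C \<omega>)"
      by (simp add: fun_eq_iff smoothing_def mark_def)
    finally show "distr P borel (C_sum_inf N' C' A') =
        distr (M \<Otimes>\<^sub>M (\<Pi>\<^sub>M k\<in>{1..}. distr P borel (C_sum_inf N' C' A'))) borel
          (\<lambda>(\<omega>, y). (\<Sum>k=1..N \<omega>. A k \<omega> * y k) + C \<omega>)"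
      by (simp only: law)
  qed
  show ?thesis using ab cc by blast
qed

end
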